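(* Let $m>1$ and $n>1$ be integers and let $R=(r_1,\ldots,r_m)$ and $C=(c_1,\ldots,c_n)$ be vectors of positive integers with $r_1+\cdots+r_m=c_1+\cdots+c_n=N$. Let $\#(R,C)$ denote the number of $m\times n$ matrices with non-negative integer entries whose row sums are $r_1,\ldots,r_m$ and whose column sums are $c_1,\ldots,c_n$. For $\mathbf{x}=(x_1,\ldots,x_m)$ and $\mathbf{y}=(y_1,\ldots,y_n)$ define $$F(\mathbf{x},\mathbf{y})=\Big(\prod_{i=1}^m x_i^{-r_i}\Big)\Big(\prod_{j=1}^n y_j^{-c_j}\Big)\prod_{i=1}^m\prod_{j=1}^n\frac{1}{1-x_iy_j}.$$ Then $F$ attains its minimum $$\rho=\rho(R,C)=\min_{0<x_1,\ldots,x_m<1,\ 0<y_1,\ldots,y_n<1}F(\mathbf{x},\mathbf{y})$$ on the open cube $0<x_i,y_j<1$, and $$\rho\ \ge\ \#(R,C)\ \ge\ N^{-\gamma(m+n)}\rho,$$ where $\gamma>0$ is an absolute constant. *)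

theory Defs
  imports Complex_Main "Jordan_Normal_Form.Matrix"
begin

text \<open>
  The dimensions \<open>m\<close> and \<open>n\<close> must be quantified inside the scope of the absolute constant,
  so vectors and matrices have dimensions given by terms; indices start at 0.
\<close>

definition contingency_tables :: "nat vec \<Rightarrow> nat vec \<Rightarrow> nat mat set" where
  "contingency_tables r c =
     {D \<in> carrier_mat (dim_vec r) (dim_vec c).
        (\<forall>i<dim_vec r. (\<Sum>j<dim_vec c. D $$ (i, j)) = r $ i) \<and>
        (\<forall>j<dim_vec c. (\<Sum>i<dim_vec r. D $$ (i, j)) = c $ j)}"

definition num_tables :: "nat vec \<Rightarrow> nat vec \<Rightarrow> nat" where
  "num_tables r c = card (contingency_tables r c)"

definition table_fun :: "nat vec \<Rightarrow> nat vec \<Rightarrow> real vec \<Rightarrow> real vec \<Rightarrow> real" where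
  "table_fun r c x y =
     (\<Prod>i<dim_vec r. (x $ i) powi (- int (r $ i))) *
     (\<Prod>j<dim_vec c. (y $ j) powi (- int (c $ j))) *
     (\<Prod>i<dim_vec r. \<Prod>j<dim_vec c. 1 / (1 - x $ i * y $ j))"

definition open_cube :: "nat \<Rightarrow> real vec set" where
  "open_cube k = {x \<in> carrier_vec k. \<forall>i<k. 0 < x $ i \<and> x $ i < 1}"

text \<open>
  \<open>\<rho>(R,C)\<close> is introduced as an infimum; that it is a minimum is part of the theorem.
\<close>

definition rho :: "nat vec \<Rightarrow> nat vec \<Rightarrow> real" where
  "rho r c = (INF (x, y) \<in> open_cube (dim_vec r) \<times> open_cube (dim_vec c). table_fun r c x y)"

text \<open>The set of tables is always finite, so the cardinality is the actual number of tables.\<close>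

lemma finite_contingency_tables: "finite (contingency_tables r c)"
proof -
  let ?m = "dim_vec r" and ?n = "dim_vec c"
  let ?I = "{..<?m} \<times> {..<?n}"
  let ?P = "PiE ?I (\<lambda>(i, j). {..r $ i})"
  have "contingency_tables r c \<subseteq> (\<lambda>f. mat ?m ?n f) ` ?P"
  proof
    fix D assume D: "D \<in> contingency_tables r c"
    let ?f = "restrict (\<lambda>ij. D $$ ij) ?I"
    have "D $$ (i, j) \<le> r $ i" if "i < ?m" "j < ?n" for i j
    proof -
      have "D $$ (i, j) \<le> (\<Sum>j<?n. D $$ (i, j))"
        using that by (intro member_le_sum) auto
      also have "\<dots> = r $ i"
        using D that by (auto simp: contingency_tables_def)
      finally show ?thesis .
    qed
    then have "?f \<in> ?P" by auto
    moreover have "D = mat ?m ?n ?f"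
      using D by (intro eq_matI) (auto simp: contingency_tables_def)
    ultimately show "D \<in> (\<lambda>f. mat ?m ?n f) ` ?P" by blast
  qed
  moreover have "finite ?P" by (intro finite_PiE) auto
  ultimately show ?thesis by (blast intro: finite_subset)
qed

end

theory Submission
  imports
    "HOL-Analysis.Analysis"
    "HOL-Computational_Algebra.Fundamental_Theorem_Algebra"
    Defs
begin

text \<open>
  Let \<open>f(\<alpha>)\<close> be the number of tables with row sums \<open>r\<close> and column sums \<open>\<alpha>\<close>, so that
  \<open>P(y) = \<Prod>\<^sub>i h\<^bsub>r\<^sub>i\<^esub>(y) = \<Sum>\<^sub>\<alpha> f(\<alpha>) y\<^sup>\<alpha>\<close> with complete homogeneous polynomials \<open>h\<close>. Since
  \<open>k \<mapsto> h\<^sub>k(y)\<close> is log-concave, each \<open>x\<^sub>i\<close> can be chosen at the cost of a factor linear in \<open>r\<^sub>i\<close>, and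
  \<open>\<rho>\<close> is at most \<open>N\<^bsup>O(m)\<^esup> min\<^sub>y P(y) y\<^bsup>-C\<^esup>\<close>. It remains to bound \<open>f(C)\<close> below by
  \<open>N\<^bsup>-O(n)\<^esup> P(y) y\<^bsup>-C\<^esup>\<close> at the minimizer \<open>y\<close>. There the weights \<open>w\<^sub>\<alpha> = f(\<alpha>) y\<^sup>\<alpha> / P(y)\<close> have mean \<open>C\<close>
  and entropy at most \<open>n log(N + 1)\<close>, so a Jensen-type inequality
  \<open>\<Prod>\<^sub>\<alpha> f(\<alpha>)\<^bsup>w\<^sub>\<alpha>\<^esup> \<le> N\<^bsup>O(n)\<^esup> f(C)\<close> suffices.

  To prove it, write \<open>f(\<alpha>)\<close>, up to a constant factor, as an average over integer matrices \<open>\<gamma>\<close> with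
  weights \<open>\<theta>\<^bsup>|\<gamma>|\<^esup>\<close>, where \<open>\<theta>\<close> is close to 1, of the coefficient of \<open>y\<^sup>\<alpha>\<close> in the product
  \<open>\<Prod>\<^sub>i (\<Sum>\<^sub>j \<gamma>\<^sub>i\<^sub>j y\<^sub>j)\<^bsup>r\<^sub>i\<^esup> / r\<^sub>i!\<close> of linear forms. This product is a stable polynomial, so by Gurvits' argument the
  coefficient agrees up to \<open>(N + 1)\<^sup>n\<close> with its capacity, which is log-concave in \<open>(\<gamma>, \<alpha>)\<close> jointly.
  A discrete Prekopa-Leindler inequality transfers log-concavity to the average over \<open>\<gamma>\<close>. Rounding of the
  matrices is absorbed because the capacity is monotone in \<open>\<gamma>\<close> and a shift of \<open>\<gamma>\<close> by the
  all-ones matrix costs only a factor \<open>\<theta>\<^bsup>-mn\<^esup>\<close>.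
\<close>

section \<open>Stable polynomials and capacity\<close>

text \<open>By partial fractions the logarithmic derivative is the sum of \<open>1 / (t - w)\<close>
  over the roots \<open>w\<close>. These all lie in the open lower half plane, so every term has
  negative imaginary part. The induction splits off one root at a time.\<close>

lemma Im_logderiv_neg:
  fixes Q :: "complex poly"
  assumes "\<And>t. Im t \<ge> 0 \<Longrightarrow> poly Q t \<noteq> 0" "degree Q > 0" "Im t \<ge> 0"
  shows "Im (poly (pderiv Q) t / poly Q t) < 0"
  using assms(1,2)
proof (induction "degree Q" arbitrary: Q)
  case 0
  then show ?case by simp
next
  case (Suc n)
  have "\<not> constant (poly Q)"
    using Suc.prems(2) constant_degree by force
  then obtain w where w: "poly Q w = 0"
    using fundamental_theorem_of_algebra by blast
  then have Imw: "Im w < 0" using Suc.prems(1)[of w] by force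
  from w obtain S where S: "Q = [:-w, 1:] * S"
    by (meson dvdE poly_eq_0_iff_dvd)
  have Q0: "poly Q t \<noteq> 0" using Suc.prems(1) assms(3) by blast
  then have S0: "poly S t \<noteq> 0" and tw: "t - w \<noteq> 0" using S by auto
  have "S \<noteq> 0" using S0 by auto
  have degS: "degree S = n" using Suc.hyps(2) S \<open>S \<noteq> 0\<close>
    by (simp add: degree_mult_eq del: mult_pCons_left)
  have "poly (pderiv Q) t = (t - w) * poly (pderiv S) t + poly S t"
    unfolding S pderiv_mult by (simp add: pderiv_pCons algebra_simps)
  moreover have "poly Q t = (t - w) * poly S t"
    unfolding S by (simp add: algebra_simps)
  ultimately have eq: "poly (pderiv Q) t / poly Q t = 1 / (t - w) + poly (pderiv S) t / poly S t"
    using S0 tw by (simp add: add_divide_distrib)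
  have 1: "Im (1 / (t - w)) < 0"
    using Imw assms(3) by (simp add: Im_divide divide_neg_pos sum_power2_gt_zero_iff)
  show ?case
  proof (cases "n = 0")
    case True
    then have "pderiv S = 0" using degS by (simp add: pderiv_eq_0_iff)
    then show ?thesis using eq 1 by simp
  next
    case False
    have "Im (poly (pderiv S) t / poly S t) < 0"
      using Suc.hyps(1)[OF degS[symmetric]] Suc.prems(1) S False degS by auto
    then show ?thesis using eq 1 by simp
  qed
qed

text \<open>A logarithmic derivative with negative imaginary part is nonzero, so the derivative
  again has no zero in the closed upper half plane (Gauss-Lucas). Up to a factorial, the coefficient
  is the \<open>k\<close>-th derivative at 0.\<close>

lemma coeff_nonzero_if_stable:
  fixes Q :: "complex poly"
  assumes "\<And>t. Im t \<ge> 0 \<Longrightarrow> poly Q t \<noteq> 0" "k \<le> degree Q"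
  shows "coeff Q k \<noteq> 0"
  using assms
proof (induction k arbitrary: Q)
  case 0
  then show ?case using "0.prems"(1)[of 0] by (simp add: poly_0_coeff_0)
next
  case (Suc k)
  have "poly (pderiv Q) t \<noteq> 0" if "Im t \<ge> 0" for t
    using Im_logderiv_neg[of Q t] Suc.prems that by force
  moreover have "k \<le> degree (pderiv Q)" using Suc.prems(2) by (simp add: degree_pderiv)
  ultimately have "coeff (pderiv Q) k \<noteq> 0" by (rule Suc.IH)
  then show ?case by (simp add: coeff_pderiv)
qed

section \<open>Log-concave sequences and real-rooted polynomials\<close>

text \<open>The inequality for all pairs \<open>i < j\<close>, not only for neighbours, excludes
  internal zeros. It can therefore be used directly for coefficient sequences, which vanish beyond
  the degree.\<close>

definition log_conc :: "(nat \<Rightarrow> real) \<Rightarrow> bool" where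
  "log_conc a \<longleftrightarrow> (\<forall>i. a i \<ge> 0) \<and> (\<forall>i j. i < j \<longrightarrow> a i * a (Suc j) \<le> a (Suc i) * a j)"

lemma log_concD: "log_conc a \<Longrightarrow> i \<le> j \<Longrightarrow> a i * a (Suc j) \<le> a (Suc i) * a j"
  unfolding log_conc_def by (cases "i = j") auto

text \<open>\<open>b\<close> is the coefficient sequence after multiplication by
  \<open>X + \<rho>\<close>. Both sides are quadratic polynomials in \<open>\<rho>\<close>, and they
  are compared coefficient by coefficient.\<close>

lemma log_conc_mult_linear:
  assumes "log_conc a" "\<rho> \<ge> 0" "b 0 = \<rho> * a 0" "\<And>k. b (Suc k) = \<rho> * a (Suc k) + a k"
  shows "log_conc b"
  unfolding log_conc_def
proof (intro conjI allI impI)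
  have a0: "a i \<ge> 0" for i using assms(1) by (auto simp: log_conc_def)
  show "0 \<le> b i" for i by (cases i) (use assms a0 in auto)
  fix i j :: nat assume ij: "i < j"
  then obtain j' where j: "j = Suc j'" by (cases j) auto
  have 1: "\<rho>\<^sup>2 * (a i * a (Suc j)) \<le> \<rho>\<^sup>2 * (a (Suc i) * a j)"
    using log_concD[OF assms(1), of i j] ij by (intro mult_left_mono) auto
  show "b i * b (Suc j) \<le> b (Suc i) * b j"
  proof (cases i)
    case 0
    have "a 0 * a j' \<ge> 0" "a j * a 0 \<ge> 0" "a (Suc 0) * a j' \<ge> 0" using a0 by auto
    then have "\<rho> * (a (Suc 0) * a j') \<ge> 0" using assms(2) by simp
    then show ?thesis using 1 \<open>a 0 * a j' \<ge> 0\<close> unfolding 0 j assms(3,4)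
      by (simp add: algebra_simps power2_eq_square)
  next
    case (Suc i')
    have 2: "a i' * a j \<le> a i * a j'" using log_concD[OF assms(1), of i' j'] ij Suc j by simp
    have 3: "a i' * a (Suc j) \<le> a i * a j" using log_concD[OF assms(1), of i' j] ij Suc j by simp
    have 4: "a i * a j \<le> a (Suc i) * a j'" using log_concD[OF assms(1), of i j'] ij Suc j by simp
    from 3 4 have "\<rho> * (a i' * a (Suc j)) \<le> \<rho> * (a (Suc i) * a j')"
      using assms(2) by (intro mult_left_mono) auto
    then show ?thesis using 1 2 unfolding Suc j assms(3,4)
      by (simp add: algebra_simps power2_eq_square)
  qed
qed

lemma poly_map_poly_of_real:
  "poly (map_poly complex_of_real Q) (of_real x) = of_real (poly Q x)"
  by (induction Q) (simp_all add: map_poly_pCons)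

text \<open>Newton's inequalities: each root is some \<open>- \<rho>\<close> with
  \<open>\<rho> > 0\<close>, so the polynomial is a positive constant times linear factors
  \<open>X + \<rho>\<close>, and each factor preserves log-concavity and positivity.\<close>

lemma log_conc_coeff_if_real_rooted:
  fixes Q :: "real poly"
  assumes "lead_coeff Q > 0"
    and "\<And>t. poly (map_poly complex_of_real Q) t = 0 \<Longrightarrow> Im t = 0 \<and> Re t < 0"
  shows "log_conc (coeff Q) \<and> (\<forall>k\<le>degree Q. coeff Q k > 0)"
  using assms
proof (induction "degree Q" arbitrary: Q)
  case 0
  then obtain c where "Q = [:c:]" by (metis degree_0_id)
  then show ?case using "0.prems" by (auto simp: log_conc_def coeff_pCons split: nat.splits)
next
  case (Suc n)
  have "degree (map_poly complex_of_real Q) = Suc n"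
    using Suc.hyps(2) by (simp add: degree_map_poly)
  then have "\<not> constant (poly (map_poly complex_of_real Q))"
    using constant_degree by (metis nat.distinct(1))
  then obtain w where w: "poly (map_poly complex_of_real Q) w = 0"
    using fundamental_theorem_of_algebra by blast
  define \<rho> where "\<rho> = - Re w"
  have weq: "w = of_real (- \<rho>)" and \<rho>: "\<rho> > 0" using Suc.prems(2)[OF w] by (auto simp: \<rho>_def complex_eq_iff)
  have "poly Q (-\<rho>) = 0"
    using w unfolding weq poly_map_poly_of_real by (simp only: of_real_eq_0_iff)
  then obtain S where S: "Q = [:\<rho>, 1:] * S"
    by (metis add.inverse_inverse dvdE poly_eq_0_iff_dvd)
  have "S \<noteq> 0" using S Suc.hyps(2) by auto
  have degS: "degree S = n" using Suc.hyps(2) S \<open>S \<noteq> 0\<close>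
    by (simp add: degree_mult_eq del: mult_pCons_left)
  have lS: "lead_coeff S > 0" using Suc.prems(1) unfolding S lead_coeff_mult by simp
  have "map_poly complex_of_real Q = [:of_real \<rho>, 1:] * map_poly complex_of_real S"
    unfolding S by (rule poly_eqI) (simp add: coeff_map_poly coeff_pCons split: nat.splits)
  then have "log_conc (coeff S) \<and> (\<forall>k\<le>degree S. coeff S k > 0)"
    using Suc.prems(2) by (intro Suc.hyps(1)[OF degS[symmetric]] lS) auto
  then have ls: "log_conc (coeff S)" and pos: "\<And>k. k \<le> n \<Longrightarrow> coeff S k > 0" by (auto simp: degS)
  have c0: "coeff Q 0 = \<rho> * coeff S 0" and cS: "coeff Q (Suc k) = \<rho> * coeff S (Suc k) + coeff S k" for k
    unfolding S by (simp_all add: coeff_pCons)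
  have "log_conc (coeff Q)" by (rule log_conc_mult_linear[OF ls _ c0 cS]) (use \<rho> in auto)
  moreover have "coeff Q k > 0" if "k \<le> Suc n" for k
  proof (cases k)
    case 0 then show ?thesis using c0 pos[of 0] \<rho> by simp
  next
    case (Suc k')
    have "coeff S (Suc k') \<ge> 0" using ls by (auto simp: log_conc_def)
    then show ?thesis using Suc cS pos[of k'] \<rho> that by (simp add: add_nonneg_pos)
  qed
  ultimately show ?case using Suc.hyps(2) by simp
qed

text \<open>The ratios \<open>a k / a (Suc k)\<close> increase with \<open>k\<close>, so tilting by
  the ratio at \<open>r\<close> makes \<open>r\<close> a mode of \<open>a k * \<tau> ^ k\<close>.
  The last clause fixes \<open>\<tau>\<close> independently of \<open>d\<close>, for use with
  infinite sequences.\<close>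

lemma log_conc_max:
  assumes "log_conc a" "\<And>k. k \<le> d \<Longrightarrow> a k > 0" "r \<le> d"
  obtains \<tau> where "\<tau> > 0" "\<And>k. k \<le> d \<Longrightarrow> a k * \<tau> ^ k \<le> a r * \<tau> ^ r"
    "r < d \<Longrightarrow> \<tau> = a r / a (Suc r)"
proof -
  define \<tau> where "\<tau> = (if r < d then a r / a (Suc r) else if r = 0 then 1 else a (r - 1) / a r)"
  have \<tau>: "\<tau> > 0" using assms(2,3) by (auto simp: \<tau>_def)
  have up: "a k * \<tau> ^ k \<le> a r * \<tau> ^ r" if "r \<le> k" "k \<le> d" for k
    using that
  proof (induction k rule: dec_induct)
    case (step k)
    have "r < d" using step by auto
    then have t: "\<tau> = a r / a (Suc r)" by (simp add: \<tau>_def)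
    have "a (Suc r) > 0" using assms(2) \<open>r < d\<close> by auto
    then have "a (Suc k) * \<tau> \<le> a k" using log_concD[OF assms(1) step.hyps(1)] unfolding t
      by (simp add: field_simps)
    then have "a (Suc k) * \<tau> ^ Suc k \<le> a k * \<tau> ^ k"
      using mult_right_mono[of "a (Suc k) * \<tau>" "a k" "\<tau> ^ k"] \<tau> by (simp add: mult_ac)
    then show ?case using step by auto
  qed simp
  have down: "a k * \<tau> ^ k \<le> a r * \<tau> ^ r" if "k \<le> r" for k
    using that
  proof (induction k rule: inc_induct)
    case (step k)
    have kd: "k < d" using step assms(3) by auto
    have "a k \<le> a (Suc k) * \<tau>"
    proof (cases "r < d")
      case True
      have "a (Suc r) > 0" using assms(2) True by auto
      then show ?thesis using log_concD[OF assms(1), of k r] step.hyps True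
        by (simp add: \<tau>_def field_simps)
    next
      case False
      then have t: "\<tau> = a (r - 1) / a r" using step.hyps by (simp add: \<tau>_def)
      have "a r > 0" using assms(2,3) by auto
      then show ?thesis using log_concD[OF assms(1), of k "r - 1"] step.hyps unfolding t
        by (simp add: field_simps)
    qed
    then have "a k * \<tau> ^ k \<le> a (Suc k) * \<tau> ^ Suc k"
      using mult_right_mono[of "a k" "a (Suc k) * \<tau>" "\<tau> ^ k"] \<tau> by (simp add: mult_ac)
    then show ?case using step by auto
  qed simp
  show ?thesis
  proof (rule that[OF \<tau>])
    show "a k * \<tau> ^ k \<le> a r * \<tau> ^ r" if "k \<le> d" for k
      using up[of k] down[of k] that by linarith
    show "\<tau> = a r / a (Suc r)" if "r < d" using that by (simp add: \<tau>_def)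
  qed
qed

text \<open>At the tilt for which the term of index \<open>r\<close> is largest, the sum is at most
  \<open>d + 1\<close> times that term.\<close>

lemma log_conc_capacity:
  assumes "log_conc a" "\<And>k. k \<le> d \<Longrightarrow> a k > 0" "r \<le> d"
    and "\<And>t. t > 0 \<Longrightarrow> (\<Sum>k\<le>d. a k * t ^ k) \<ge> B * t ^ r"
  shows "a r \<ge> B / (real d + 1)"
proof -
  obtain \<tau> where \<tau>: "\<tau> > 0" "\<And>k. k \<le> d \<Longrightarrow> a k * \<tau> ^ k \<le> a r * \<tau> ^ r"
    using log_conc_max[OF assms(1-3)] by blast
  have "B * \<tau> ^ r \<le> (\<Sum>k\<le>d. a k * \<tau> ^ k)" using assms(4) \<tau> by simp
  also have "\<dots> \<le> (\<Sum>k\<le>d. a r * \<tau> ^ r)" using \<tau> by (intro sum_mono) auto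
  also have "\<dots> = (real d + 1) * a r * \<tau> ^ r" by simp
  finally have "B \<le> (real d + 1) * a r" using \<tau>(1) by simp
  then show ?thesis by (simp add: field_simps)
qed

section \<open>Gurvits' capacity bound for stable homogeneous polynomials\<close>

text \<open>Exponent vectors of the monomials of degree \<open>d\<close> in variables indexed by
  \<open>J\<close>; being extensional, they form a finite set that can index sums.\<close>

definition comps :: "'b set \<Rightarrow> nat \<Rightarrow> ('b \<Rightarrow> nat) set" where
  "comps J d = {\<alpha> \<in> PiE J (\<lambda>_. {..d}). sum \<alpha> J = d}"

lemma finite_comps [simp]: "finite J \<Longrightarrow> finite (comps J d)"
  unfolding comps_def by (simp add: finite_PiE)

lemma comps_zero: "finite J \<Longrightarrow> comps J 0 = {\<lambda>j\<in>J. 0}"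
  unfolding comps_def by (auto simp: PiE_def extensional_def restrict_def fun_eq_iff)

lemma comps_empty: "comps {} d = (if d = 0 then {\<lambda>_. undefined} else {})"
  unfolding comps_def by auto

lemma comps_nonempty:
  assumes "finite J" "J \<noteq> {}" shows "comps J d \<noteq> {}"
proof -
  obtain i where i: "i \<in> J" using assms by auto
  have "(\<lambda>j\<in>J. if j = i then d else 0) \<in> comps J d"
    unfolding comps_def using i assms(1) by (auto simp: sum.delta cong: sum.cong)
  then show ?thesis by auto
qed

lemma comps_memI:
  assumes "finite J" "\<alpha> \<in> extensional J" "sum \<alpha> J = d" shows "\<alpha> \<in> comps J d"
  using assms member_le_sum[of _ J \<alpha>] unfolding comps_def by (auto simp: PiE_def)

text \<open>Monomials are sorted by the exponent \<open>k\<close> of \<open>v\<close>. The inverse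
  map resets the value at \<open>v\<close> to \<open>undefined\<close>, so that the remaining
  exponent vector is extensional on \<open>J\<close>.\<close>

lemma sum_comps_insert:
  assumes "finite J" "v \<notin> J"
  shows "(\<Sum>\<alpha>\<in>comps (insert v J) d. g \<alpha>) = (\<Sum>k\<le>d. \<Sum>\<alpha>\<in>comps J (d - k). g (\<alpha>(v := k)))"
proof -
  have eq: "sum (\<alpha>(v := k)) J = sum \<alpha> J" for \<alpha> :: "_ \<Rightarrow> nat" and k
    using assms by (intro sum.cong) auto
  have "(\<Sum>k\<le>d. \<Sum>\<alpha>\<in>comps J (d - k). g (\<alpha>(v := k))) =
      (\<Sum>(k, \<alpha>)\<in>(SIGMA k:{..d}. comps J (d - k)). g (\<alpha>(v := k)))"
    using assms by (subst sum.Sigma) auto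
  also have "\<dots> = (\<Sum>\<alpha>\<in>comps (insert v J) d. g \<alpha>)"
  proof (rule sum.reindex_bij_witness[of _ "\<lambda>\<alpha>. (\<alpha> v, \<alpha>(v := undefined))" "\<lambda>(k, \<alpha>). \<alpha>(v := k)"])
    fix x assume x: "x \<in> (SIGMA k:{..d}. comps J (d - k))"
    obtain k \<alpha> where k: "x = (k, \<alpha>)" "k \<le> d" "\<alpha> \<in> comps J (d - k)" using x by auto
    have ext: "\<alpha> \<in> extensional J" "sum \<alpha> J = d - k" using k by (auto simp: comps_def PiE_def)
    then have "\<alpha> v = undefined" using assms by (auto simp: extensional_def)
    then show "(\<lambda>\<alpha>. (\<alpha> v, \<alpha>(v := undefined))) ((\<lambda>(k, \<alpha>). \<alpha>(v := k)) x) = x"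
      using k by (simp add: fun_upd_idem)
    show "(\<lambda>(k, \<alpha>). \<alpha>(v := k)) x \<in> comps (insert v J) d"
      unfolding k(1) prod.case
    proof (rule comps_memI)
      show "sum (\<alpha>(v := k)) (insert v J) = d"
        using assms ext k(2) eq[of \<alpha> k] by (simp del: fun_upd_apply) simp
    qed (use assms ext in \<open>auto simp: extensional_def\<close>)
    show "g ((\<lambda>(k, \<alpha>). \<alpha>(v := k)) x) = (case x of (k, \<alpha>) \<Rightarrow> g (\<alpha>(v := k)))"
      using k by simp
  next
    fix \<alpha> assume a: "\<alpha> \<in> comps (insert v J) d"
    then have "\<alpha> \<in> extensional (insert v J)" "\<alpha> v + sum \<alpha> J = d"
      using assms by (auto simp: comps_def PiE_def)
    then show "(\<alpha> v, \<alpha>(v := undefined)) \<in> (SIGMA k:{..d}. comps J (d - k))"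
      using assms by (auto intro!: comps_memI simp: eq extensional_def simp del: fun_upd_apply)
  qed (auto simp: fun_eq_iff)
  finally show ?thesis by simp
qed

text \<open>\<open>a\<close> is the coefficient family of a homogeneous polynomial. Unlike ordinary
  stability, all variables but one may be real here; this closed version lets coefficients be
  extracted without a limiting argument.\<close>

definition strictly_stable :: "'b set \<Rightarrow> nat \<Rightarrow> (('b \<Rightarrow> nat) \<Rightarrow> real) \<Rightarrow> bool" where
  "strictly_stable J d a \<longleftrightarrow>
     (\<forall>z. (\<forall>j\<in>J. Im (z j) \<ge> 0) \<longrightarrow> (\<exists>j\<in>J. Im (z j) > 0) \<longrightarrow>
        (\<Sum>\<alpha>\<in>comps J d. of_real (a \<alpha>) * (\<Prod>j\<in>J. z j ^ \<alpha> j)) \<noteq> (0::complex))"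

lemma sum_comps_insert_monomials:
  fixes z :: "'b \<Rightarrow> 'c :: {comm_ring_1, real_algebra_1}"
  assumes "finite J" "v \<notin> J"
  shows "(\<Sum>\<alpha>\<in>comps (insert v J) d. of_real (a \<alpha>) * (\<Prod>j\<in>insert v J. (z(v := t)) j ^ \<alpha> j)) =
    (\<Sum>k\<le>d. (\<Sum>\<alpha>\<in>comps J (d - k). of_real (a (\<alpha>(v := k))) * (\<Prod>j\<in>J. z j ^ \<alpha> j)) * t ^ k)"
  unfolding sum_comps_insert[OF assms] sum_distrib_right
proof (intro sum.cong refl)
  fix k \<alpha>
  have "(\<Prod>j\<in>J. (z(v := t)) j ^ (\<alpha>(v := k)) j) = (\<Prod>j\<in>J. z j ^ \<alpha> j)"
    using assms(2) by (intro prod.cong) auto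
  then show "of_real (a (\<alpha>(v := k))) * (\<Prod>j\<in>insert v J. (z(v := t)) j ^ (\<alpha>(v := k)) j) =
    of_real (a (\<alpha>(v := k))) * (\<Prod>j\<in>J. z j ^ \<alpha> j) * t ^ k"
    using assms by (simp add: mult_ac)
qed

lemma coeff_poly_sum:
  fixes q :: "nat \<Rightarrow> 'a :: comm_ring_1" and d :: nat
  defines "Q \<equiv> \<Sum>k\<le>d. monom (q k) k"
  assumes "q d \<noteq> 0"
  shows "degree Q = d" "k \<le> d \<Longrightarrow> coeff Q k = q k" "poly Q t = (\<Sum>k\<le>d. q k * t ^ k)"
proof -
  have c: "coeff Q i = (if i \<le> d then q i else 0)" for i
    unfolding Q_def by (simp add: coeff_sum if_distrib sum.delta' cong: if_cong)
  show "k \<le> d \<Longrightarrow> coeff Q k = q k" using c by simp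
  show "degree Q = d" using c assms(2) by (intro antisym degree_le le_degree) auto
  show "poly Q t = (\<Sum>k\<le>d. q k * t ^ k)" unfolding Q_def by (simp add: poly_sum poly_monom)
qed

text \<open>With the other variables frozen at \<open>z\<close>, one of them already in the open
  half plane, the polynomial in the variable \<open>v\<close> has no zero in the closed upper half
  plane, so \<open>coeff_nonzero_if_stable\<close> applies to its \<open>k\<close>-th
  coefficient.\<close>

lemma strictly_stable_coefficient:
  assumes "finite J" "v \<notin> J" and st: "strictly_stable (insert v J) d a"
    and pos: "\<And>\<alpha>. \<alpha> \<in> comps (insert v J) d \<Longrightarrow> a \<alpha> > 0" and "k \<le> d"
  shows "strictly_stable J (d - k) (\<lambda>\<alpha>. a (\<alpha>(v := k)))"
  unfolding strictly_stable_def
proof (intro allI impI)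
  fix z :: "'a \<Rightarrow> complex" assume z: "\<forall>j\<in>J. Im (z j) \<ge> 0" "\<exists>j\<in>J. Im (z j) > 0"
  define q where "q k = (\<Sum>\<alpha>\<in>comps J (d - k). complex_of_real (a (\<alpha>(v := k))) * (\<Prod>j\<in>J. z j ^ \<alpha> j))" for k
  \<comment> \<open>The pure power of \<open>v\<close> is the only monomial with exponent
    \<open>d\<close> at \<open>v\<close>; its positive coefficient makes the degree exactly
    \<open>d\<close>.\<close>
  have "(\<lambda>j\<in>J. 0)(v := d) \<in> comps (insert v J) d"
    using assms(1,2) by (intro comps_memI) (auto simp: extensional_def sum.neutral)
  then have "a ((\<lambda>j\<in>J. 0)(v := d)) > 0" by (rule pos)
  then have qd: "q d \<noteq> 0" unfolding q_def using assms(1) by (simp add: comps_zero)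
  define Q where "Q = (\<Sum>k\<le>d. monom (q k) k)"
  note Q = coeff_poly_sum[of q d, OF qd, folded Q_def]
  have "poly Q t \<noteq> 0" if "Im t \<ge> 0" for t
  proof -
    have "\<forall>j\<in>insert v J. Im ((z(v := t)) j) \<ge> 0" using z that by auto
    moreover have "\<exists>j\<in>insert v J. Im ((z(v := t)) j) > 0" using z assms(2) by (auto intro!: bexI)
    ultimately have "(\<Sum>\<alpha>\<in>comps (insert v J) d. of_real (a \<alpha>) *
        (\<Prod>j\<in>insert v J. (z(v := t)) j ^ \<alpha> j)) \<noteq> 0"
      using st unfolding strictly_stable_def by blast
    then show ?thesis unfolding sum_comps_insert_monomials[OF assms(1,2)] Q(3) q_def .
  qed
  then have "coeff Q k \<noteq> 0" using coeff_nonzero_if_stable Q(1) \<open>k \<le> d\<close> by metis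
  then show "(\<Sum>\<alpha>\<in>comps J (d - k). complex_of_real (a (\<alpha>(v := k))) * (\<Prod>j\<in>J. z j ^ \<alpha> j)) \<noteq> 0"
    using Q(2)[OF \<open>k \<le> d\<close>] by (simp add: q_def)
qed

text \<open>With the other variables frozen at positive reals, the polynomial in \<open>t\<close>
  has no zero above the real axis by stability, none below it by conjugation, and none on
  \<open>t \<ge> 0\<close> because its coefficients are positive. Its roots are thus negative reals,
  its coefficients are log-concave, and \<open>log_conc_capacity\<close> applies.\<close>

lemma strictly_stable_univariate_capacity:
  assumes "finite J" "J \<noteq> {}" "v \<notin> J" and st: "strictly_stable (insert v J) d a"
    and pos: "\<And>\<alpha>. \<alpha> \<in> comps (insert v J) d \<Longrightarrow> a \<alpha> > 0" and "r \<le> d"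
    and y: "\<And>j. j \<in> J \<Longrightarrow> y j > 0"
    and B: "\<And>t. t > 0 \<Longrightarrow> (\<Sum>\<alpha>\<in>comps (insert v J) d. a \<alpha> * (\<Prod>j\<in>insert v J. (y(v := t)) j ^ \<alpha> j)) \<ge> B * t ^ r"
  shows "(\<Sum>\<alpha>\<in>comps J (d - r). a (\<alpha>(v := r)) * (\<Prod>j\<in>J. y j ^ \<alpha> j)) \<ge> B / (real d + 1)"
proof -
  define q where "q k = (\<Sum>\<alpha>\<in>comps J (d - k). a (\<alpha>(v := k)) * (\<Prod>j\<in>J. y j ^ \<alpha> j))" for k
  have qpos: "q k > 0" if "k \<le> d" for k
  proof -
    have "a (\<alpha>(v := k)) > 0" if "\<alpha> \<in> comps J (d - k)" for \<alpha>
    proof (rule pos, rule comps_memI)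
      have "sum (\<alpha>(v := k)) J = sum \<alpha> J" using assms(3) by (intro sum.cong) auto
      then show "sum (\<alpha>(v := k)) (insert v J) = d" "\<alpha>(v := k) \<in> extensional (insert v J)"
        using that \<open>k \<le> d\<close> assms(1,3) by (auto simp: comps_def PiE_def extensional_def)
    qed (use assms in auto)
    then show ?thesis unfolding q_def using assms(1,2) comps_nonempty y
      by (intro sum_pos) (auto intro!: mult_pos_pos prod_pos)
  qed
  then have qd: "q d \<noteq> 0" by force
  define Q where "Q = (\<Sum>k\<le>d. monom (q k) k)"
  note Q = coeff_poly_sum[of q d, OF qd, folded Q_def]
  have mapQ: "poly (map_poly complex_of_real Q) t = (\<Sum>k\<le>d. of_real (q k) * t ^ k)" for t
    by (simp add: poly_altdef degree_map_poly coeff_map_poly Q)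
  have nz: "poly (map_poly complex_of_real Q) t \<noteq> 0" if "Im t > 0" for t
  proof -
    let ?z = "(\<lambda>j. complex_of_real (y j))(v := t)"
    have "\<forall>j\<in>insert v J. Im (?z j) \<ge> 0" "\<exists>j\<in>insert v J. Im (?z j) > 0" using that by auto
    then have "(\<Sum>\<alpha>\<in>comps (insert v J) d. of_real (a \<alpha>) * (\<Prod>j\<in>insert v J. ?z j ^ \<alpha> j)) \<noteq> 0"
      using st unfolding strictly_stable_def by blast
    then show ?thesis unfolding sum_comps_insert_monomials[OF assms(1,3)] mapQ q_def by simp
  qed
  have "Im t = 0 \<and> Re t < 0" if t: "poly (map_poly complex_of_real Q) t = 0" for t
  proof -
    have "Im t \<le> 0" using nz[of t] t by force
    moreover have "poly (map_poly complex_of_real Q) (cnj t) = cnj (poly (map_poly complex_of_real Q) t)"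
      by (simp add: mapQ)
    then have "Im t \<ge> 0" using nz[of "cnj t"] t by force
    ultimately have im: "Im t = 0" by simp
    then have tr: "t = of_real (Re t)" by (simp add: complex_eq_iff)
    have "poly Q (Re t) = 0" using t by (subst (asm) tr) (simp only: poly_map_poly_of_real of_real_eq_0_iff)
    moreover have "poly Q s > 0" if "s \<ge> 0" for s
    proof -
      have "q k * s ^ k \<ge> 0" if "k \<le> d" for k using qpos[OF that] \<open>s \<ge> 0\<close> by simp
      then have "q 0 * s ^ 0 \<le> (\<Sum>k\<le>d. q k * s ^ k)"
        by (intro member_le_sum) auto
      then show ?thesis using qpos[of 0] unfolding Q(3) by simp
    qed
    then have "poly Q (Re t) > 0" if "Re t \<ge> 0" using that .
    ultimately show ?thesis using im by (metis less_irrefl not_less)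
  qed
  then have lc: "log_conc (coeff Q)" "\<And>k. k \<le> d \<Longrightarrow> coeff Q k > 0"
    using log_conc_coeff_if_real_rooted[of Q] qpos[of d] Q(2)[of d] unfolding Q(1) by auto
  have "B * t ^ r \<le> (\<Sum>k\<le>d. coeff Q k * t ^ k)" if "t > 0" for t
    using B[OF that] sum_comps_insert_monomials[OF assms(1,3), where 'c = real and z = y]
    by (simp add: Q(2) q_def)
  then have "coeff Q r \<ge> B / (real d + 1)"
    by (intro log_conc_capacity[OF lc \<open>r \<le> d\<close>])
  then show ?thesis using Q(2)[OF \<open>r \<le> d\<close>] by (simp add: q_def)
qed

text \<open>Gurvits' argument: variables are eliminated one by one by extracting the coefficient of
  \<open>v\<close> to the power \<open>C v\<close>. Each extraction preserves stability and costs at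
  most a factor \<open>d + 1\<close> of the capacity.\<close>

theorem strictly_stable_capacity:
  assumes "finite J" "strictly_stable J d a" "\<And>\<alpha>. \<alpha> \<in> comps J d \<Longrightarrow> a \<alpha> > 0" "C \<in> comps J d"
    and "\<And>y. (\<And>j. j \<in> J \<Longrightarrow> y j > 0) \<Longrightarrow>
      (\<Sum>\<alpha>\<in>comps J d. a \<alpha> * (\<Prod>j\<in>J. y j ^ \<alpha> j)) \<ge> B * (\<Prod>j\<in>J. y j ^ C j)"
    and "B \<ge> 0"
  shows "a C \<ge> B / (real d + 1) ^ card J"
  using assms
proof (induction J arbitrary: d a C B rule: finite_induct)
  case empty
  then show ?case by (auto simp: comps_empty split: if_splits)
next
  case (insert v J)
  note pos = insert.prems(2)
  have Cd: "C v + sum C J = d" and Cext: "C \<in> extensional (insert v J)"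
    using insert.prems(3) insert.hyps by (auto simp: comps_def PiE_def)
  show ?case
  proof (cases "J = {}")
    case True
    \<comment> \<open>With a single variable the polynomial is the one monomial with exponent
      \<open>C\<close>, and evaluation at 1 gives the bound.\<close>
    have sum_comps: "(\<Sum>\<alpha>\<in>comps (insert v J) d. g \<alpha>) = g C" for g :: "('a \<Rightarrow> nat) \<Rightarrow> real"
    proof -
      have "\<alpha> = C" if "\<alpha> \<in> comps (insert v J) d" for \<alpha>
      proof (rule extensionalityI)
        show "\<alpha> \<in> extensional {v}" "C \<in> extensional {v}" "\<And>x. x \<in> {v} \<Longrightarrow> \<alpha> x = C x"
          using that Cd Cext True by (auto simp: comps_def PiE_def)
      qed
      then have "comps (insert v J) d = {C}" using insert.prems(3) by blast
      then show ?thesis by simp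
    qed
    have "B \<le> a C" using insert.prems(4)[of "\<lambda>_. 1"] by (simp add: sum_comps)
    moreover have "B / (real d + 1) \<le> B" using insert.prems(5) by (simp add: divide_le_eq mult_left_mono algebra_simps)
    ultimately show ?thesis using True by simp
  next
    case False
    let ?C = "C(v := undefined)"
    define B' where "B' = B / (real d + 1)"
    have Cv: "C v \<le> d" using Cd by simp
    have "sum ?C J = sum C J" using insert.hyps by (intro sum.cong) auto
    then have C': "?C \<in> comps J (d - C v)"
      using Cd Cext insert.hyps by (intro comps_memI) (auto simp: extensional_def)
    have "B' / (real (d - C v) + 1) ^ card J \<le> a (?C(v := C v))"
    proof (rule insert.IH[of "d - C v" "\<lambda>\<alpha>. a (\<alpha>(v := C v))"])
      show "strictly_stable J (d - C v) (\<lambda>\<alpha>. a (\<alpha>(v := C v)))"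
        by (rule strictly_stable_coefficient) (use insert Cv in auto)
      fix \<alpha> assume "\<alpha> \<in> comps J (d - C v)"
      moreover have "sum (\<alpha>(v := C v)) J = sum \<alpha> J" using insert.hyps by (intro sum.cong) auto
      ultimately show "a (\<alpha>(v := C v)) > 0" using insert.hyps Cv
        by (intro pos comps_memI) (auto simp: comps_def PiE_def extensional_def)
    next
      fix y :: "'a \<Rightarrow> real" assume y: "\<And>j. j \<in> J \<Longrightarrow> y j > 0"
      have "(B * (\<Prod>j\<in>J. y j ^ C j)) / (real d + 1) \<le>
        (\<Sum>\<alpha>\<in>comps J (d - C v). a (\<alpha>(v := C v)) * (\<Prod>j\<in>J. y j ^ \<alpha> j))"
      proof (rule strictly_stable_univariate_capacity)
        fix t :: real assume t: "t > 0"
        have yt: "(y(v := t)) j > 0" if "j \<in> insert v J" for j using that y t by auto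
        have "(\<Prod>j\<in>J. (y(v := t)) j ^ C j) = (\<Prod>j\<in>J. y j ^ C j)"
          using insert.hyps by (intro prod.cong) auto
        moreover have "B * (\<Prod>j\<in>insert v J. (y(v := t)) j ^ C j)
          \<le> (\<Sum>\<alpha>\<in>comps (insert v J) d. a \<alpha> * (\<Prod>j\<in>insert v J. (y(v := t)) j ^ \<alpha> j))"
          by (rule insert.prems(4)) (rule yt)
        ultimately show "B * (\<Prod>j\<in>J. y j ^ C j) * t ^ C v
          \<le> (\<Sum>\<alpha>\<in>comps (insert v J) d. a \<alpha> * (\<Prod>j\<in>insert v J. (y(v := t)) j ^ \<alpha> j))"
          using insert.hyps by (simp add: mult_ac)
      qed (use insert False Cv y in auto)
      moreover have "(\<Prod>j\<in>J. y j ^ ?C j) = (\<Prod>j\<in>J. y j ^ C j)"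
        using insert.hyps by (intro prod.cong) auto
      ultimately show "B' * (\<Prod>j\<in>J. y j ^ ?C j)
         \<le> (\<Sum>\<alpha>\<in>comps J (d - C v). a (\<alpha>(v := C v)) * (\<Prod>j\<in>J. y j ^ \<alpha> j))"
        by (simp add: B'_def)
    next
      show "?C \<in> comps J (d - C v)" by (rule C')
      show "B' \<ge> 0" using insert.prems(5) by (simp add: B'_def)
    qed
    \<comment> \<open>The remaining degree only decreases, so every later factor is bounded by the
      initial \<open>d + 1\<close>.\<close>
    moreover have "B' / (real d + 1) ^ card J \<le> B' / (real (d - C v) + 1) ^ card J"
      using insert.prems(5) unfolding B'_def by (intro divide_left_mono power_mono) auto
    ultimately show ?thesis using insert.hyps by (simp add: B'_def mult_ac)
  qed
qed

section \<open>A discrete Prekopa-Leindler inequality\<close>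

definition mid_points :: "'a set \<Rightarrow> ('a \<Rightarrow> real) \<Rightarrow> ('a \<Rightarrow> nat set) \<Rightarrow> nat set" where
  "mid_points A w S = {z. \<exists>u. (\<forall>a\<in>A. u a \<in> S a) \<and> \<bar>real z - (\<Sum>a\<in>A. w a * real (u a))\<bar> < 1}"

lemma mid_points_mono: "(\<And>a. a \<in> A \<Longrightarrow> S a \<subseteq> S' a) \<Longrightarrow> mid_points A w S \<subseteq> mid_points A w S'"
  unfolding mid_points_def by blast

lemma finite_mid_points:
  assumes "finite A" "\<And>a. a \<in> A \<Longrightarrow> finite (S a)"
  shows "finite (mid_points A w S)"
proof -
  have "mid_points A w S \<subseteq> (\<Union>u\<in>PiE A S. {z. z \<le> nat \<lceil>(\<Sum>a\<in>A. w a * real (u a)) + 1\<rceil>})"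
  proof
    fix z assume "z \<in> mid_points A w S"
    then obtain u where u: "\<forall>a\<in>A. u a \<in> S a" "\<bar>real z - (\<Sum>a\<in>A. w a * real (u a))\<bar> < 1"
      by (auto simp: mid_points_def)
    have "(\<Sum>a\<in>A. w a * real (restrict u A a)) = (\<Sum>a\<in>A. w a * real (u a))" by simp
    then have "z \<le> nat \<lceil>(\<Sum>a\<in>A. w a * real (restrict u A a)) + 1\<rceil>" using u(2) by linarith
    moreover have "restrict u A \<in> PiE A S" using u(1) by auto
    ultimately show "z \<in> (\<Union>u\<in>PiE A S. {z. z \<le> nat \<lceil>(\<Sum>a\<in>A. w a * real (u a)) + 1\<rceil>})" by blast
  qed
  then show ?thesis by (rule finite_subset) (use assms in \<open>auto intro!: finite_PiE\<close>)
qed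

text \<open>With \<open>M\<close> the weighted sum of the maxima, the extra term \<open>\<lceil>M\<rceil> - M\<close> makes the induction on the
  sizes of the sets go through: it is the part of the last unit cell that is not yet used up.\<close>
lemma card_mid_points_aux:
  assumes "finite A" "\<And>a. a \<in> A \<Longrightarrow> w a > 0" "sum w A = 1"
    and "\<And>a. a \<in> A \<Longrightarrow> finite (S a) \<and> S a \<noteq> {}"
  shows "real (card (mid_points A w S)) \<ge>
    (\<Sum>a\<in>A. w a * real (card (S a))) + (of_int \<lceil>\<Sum>a\<in>A. w a * real (Max (S a))\<rceil> - (\<Sum>a\<in>A. w a * real (Max (S a))))"
  using assms(4)
proof (induction "\<Sum>a\<in>A. card (S a)" arbitrary: S rule: less_induct)
  case less
  define M where "M = (\<Sum>a\<in>A. w a * real (Max (S a)))"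
  have M0: "M \<ge> 0" unfolding M_def using assms(2) by (intro sum_nonneg mult_nonneg_nonneg) (auto intro: less_imp_le)
  have fin: "finite (mid_points A w S)" using less.prems assms(1) by (intro finite_mid_points) auto
  have top: "z \<in> mid_points A w S" if "\<bar>real z - M\<bar> < 1" for z
    unfolding mid_points_def using that less.prems by (auto simp: M_def intro!: exI[of _ "\<lambda>a. Max (S a)"])
  \<comment> \<open>Both roundings of \<open>M\<close> are midpoints; they are two different points
    unless \<open>M\<close> is an integer.\<close>
  have top_floor: "nat \<lfloor>M\<rfloor> \<in> mid_points A w S" and top_ceil: "nat \<lceil>M\<rceil> \<in> mid_points A w S"
    using M0 by (auto intro!: top) linarith+
  show ?case
  proof (cases "\<forall>a\<in>A. card (S a) = 1")
    case True
    then have "(\<Sum>a\<in>A. w a * real (card (S a))) = 1" using assms(3) by simp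
    moreover have "real (card (mid_points A w S)) \<ge> 1 + (of_int \<lceil>M\<rceil> - M)"
    proof (cases "M \<in> \<int>")
      case True
      then have "of_int \<lceil>M\<rceil> = M" by (auto elim!: Ints_cases)
      moreover have "card (mid_points A w S) \<ge> 1" using top_floor fin card_gt_0_iff by (metis One_nat_def Suc_leI empty_iff)
      ultimately show ?thesis by linarith
    next
      case False
      then have "\<lfloor>M\<rfloor> < \<lceil>M\<rceil>" by (metis Ints_of_int floor_less_iff less_ceiling_iff linorder_neqE_linordered_idom less_le_not_le of_int_floor_le le_of_int_ceiling order_antisym_conv not_less)
      then have "nat \<lfloor>M\<rfloor> \<noteq> nat \<lceil>M\<rceil>" using M0 by linarith
      then have "card {nat \<lfloor>M\<rfloor>, nat \<lceil>M\<rceil>} = 2" by simp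
      then have "card (mid_points A w S) \<ge> 2"
        using card_mono[OF fin, of "{nat \<lfloor>M\<rfloor>, nat \<lceil>M\<rceil>}"] top_floor top_ceil by simp
      then show ?thesis by linarith
    qed
    ultimately show ?thesis by (simp add: M_def)
  next
    case False
    then obtain b where b: "b \<in> A" "card (S b) \<noteq> 1" by auto
    \<comment> \<open>Removing the largest element of a set with at least two elements lowers the
      weighted count by exactly \<open>w b\<close> and the weighted maximum by at least
      \<open>w b\<close>.\<close>
    define S' where "S' = S(b := S b - {Max (S b)})"
    have Sb: "finite (S b)" "S b \<noteq> {}" "card (S b) > 0" using less.prems b(1) card_gt_0_iff by auto
    have cb: "card (S b) = card (S' b) + 1" using Sb by (simp add: S'_def)
    have S': "finite (S' a) \<and> S' a \<noteq> {}" if "a \<in> A" for a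
    proof (cases "a = b")
      case True
      have "card (S' b) > 0" using cb b Sb by linarith
      then show ?thesis using True card_gt_0_iff by blast
    next
      case False then show ?thesis using less.prems that by (simp add: S'_def)
    qed
    define M' where "M' = (\<Sum>a\<in>A. w a * real (Max (S' a)))"
    have split: "(\<Sum>a\<in>A. g a) = g b + (\<Sum>a\<in>A-{b}. g a)" for g :: "'a \<Rightarrow> 'c :: comm_monoid_add"
      using assms(1) b(1) by (rule sum.remove)
    have rest: "(\<Sum>a\<in>A-{b}. g a (S' a)) = (\<Sum>a\<in>A-{b}. g a (S a))" for g :: "'a \<Rightarrow> nat set \<Rightarrow> 'c :: comm_monoid_add"
      by (intro sum.cong) (auto simp: S'_def)
    have "(\<Sum>a\<in>A. card (S' a)) < (\<Sum>a\<in>A. card (S a))"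
      unfolding split rest[of "\<lambda>_. card"] using cb by simp
    note IH = less.hyps[OF this S']
    have cS: "(\<Sum>a\<in>A. w a * real (card (S a))) = (\<Sum>a\<in>A. w a * real (card (S' a))) + w b"
      unfolding split rest[of "\<lambda>a s. w a * real (card s)"] using cb by (simp add: algebra_simps)
    have "Max (S' b) \<in> S' b" using S'[OF b(1)] by auto
    then have "Max (S' b) \<le> Max (S b)" "Max (S' b) \<noteq> Max (S b)" using Sb by (auto simp: S'_def)
    then have "real (Max (S' b)) + 1 \<le> real (Max (S b))" by linarith
    then have "w b * (real (Max (S' b)) + 1) \<le> w b * real (Max (S b))"
      using assms(2)[OF b(1)] by (intro mult_left_mono) auto
    then have MM: "M' + w b \<le> M" unfolding M_def M'_def split rest[of "\<lambda>a s. w a * real (Max s)"]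
      by (simp add: algebra_simps)
    have wb: "w b \<le> 1" "w b > 0" using assms member_le_sum[of b A w] b(1) by (auto intro: less_imp_le)
    have sub: "mid_points A w S' \<subseteq> mid_points A w S"
      by (rule mid_points_mono) (auto simp: S'_def)
    \<comment> \<open>Selections from \<open>S'\<close> average to at most \<open>M'\<close>, so
      midpoints of \<open>S\<close> from \<open>M' + 1\<close> on are new.\<close>
    have below: "real z < M' + 1" if z: "z \<in> mid_points A w S'" for z
    proof -
      obtain u where u: "\<forall>a\<in>A. u a \<in> S' a" "\<bar>real z - (\<Sum>a\<in>A. w a * real (u a))\<bar> < 1"
        using z by (auto simp: mid_points_def)
      have "(\<Sum>a\<in>A. w a * real (u a)) \<le> M'"
        unfolding M'_def using u(1) S' assms(2) by (intro sum_mono mult_left_mono) (auto intro: less_imp_le)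
      then show ?thesis using u(2) by linarith
    qed
    have finS': "finite (mid_points A w S')" using sub fin finite_subset by blast
    have new: "card (mid_points A w S) \<ge> card (mid_points A w S') + card T"
      if "T \<subseteq> mid_points A w S" "\<And>z. z \<in> T \<Longrightarrow> real z \<ge> M' + 1" for T
    proof -
      have "T \<inter> mid_points A w S' = {}" using that(2) below by force
      then have "card (mid_points A w S' \<union> T) = card (mid_points A w S') + card T"
        using finS' that(1) fin by (intro card_Un_disjoint) (auto intro: finite_subset)
      then show ?thesis using card_mono[OF fin, of "mid_points A w S' \<union> T"] sub that(1) by simp
    qed
    have M'0: "M' \<ge> 0" unfolding M'_def using assms(2) by (intro sum_nonneg mult_nonneg_nonneg) (auto intro: less_imp_le)
    \<comment> \<open>If the ceiling stays, the loss of slack pays for \<open>w b\<close>. If it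
      grows by 1, the new point \<open>\<lceil>M\<rceil>\<close> makes up for it. For larger jumps
      the new slack is 0 and one new point suffices, or it is below 1 and both roundings are new;
      here \<open>w b \<le> 1\<close> enters.\<close>
    consider "\<lceil>M\<rceil> = \<lceil>M'\<rceil>" | "\<lceil>M\<rceil> = \<lceil>M'\<rceil> + 1" | "\<lceil>M\<rceil> \<ge> \<lceil>M'\<rceil> + 2" "\<lceil>M\<rceil> = \<lfloor>M\<rfloor>" | "\<lceil>M\<rceil> \<ge> \<lceil>M'\<rceil> + 2" "\<lceil>M\<rceil> = \<lfloor>M\<rfloor> + 1"
      using MM wb by linarith
    then have "real (card (mid_points A w S)) \<ge>
      (\<Sum>a\<in>A. w a * real (card (S' a))) + w b + (of_int \<lceil>M\<rceil> - M)"
    proof cases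
      case 1
      then show ?thesis using new[of "{}"] IH MM by (simp add: M'_def)
    next
      case 2
      have "real (nat \<lceil>M\<rceil>) \<ge> M' + 1" using 2 M0 by linarith
      then show ?thesis using new[of "{nat \<lceil>M\<rceil>}"] top_ceil IH MM 2 by (simp add: M'_def)
    next
      case 3
      have "real (nat \<lceil>M\<rceil>) \<ge> M' + 1" using 3 M0 by linarith
      then have "real (card (mid_points A w S)) \<ge> real (card (mid_points A w S')) + 1"
        using new[of "{nat \<lceil>M\<rceil>}"] top_ceil by simp
      then show ?thesis using IH 3 wb unfolding M'_def[symmetric] by linarith
    next
      case 4
      have "real (nat \<lceil>M\<rceil>) \<ge> M' + 1" "real (nat \<lfloor>M\<rfloor>) \<ge> M' + 1" "nat \<lfloor>M\<rfloor> \<noteq> nat \<lceil>M\<rceil>"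
        using 4 M0 M'0 by linarith+
      then have "card (mid_points A w S) \<ge> card (mid_points A w S') + card {nat \<lceil>M\<rceil>, nat \<lfloor>M\<rfloor>}"
        using top_ceil top_floor by (intro new) auto
      then have "real (card (mid_points A w S)) \<ge> real (card (mid_points A w S')) + 2"
        using \<open>nat \<lfloor>M\<rfloor> \<noteq> nat \<lceil>M\<rceil>\<close> by simp
      then show ?thesis using IH 4 wb unfolding M'_def[symmetric] by linarith
    qed
    then show ?thesis using cS by (simp add: M_def)
  qed
qed

text \<open>A one-dimensional Brunn-Minkowski inequality for finite sets of integers, obtained by
  dropping the nonnegative slack.\<close>

lemma card_mid_points:
  assumes "finite A" "\<And>a. a \<in> A \<Longrightarrow> w a > 0" "sum w A = 1"
    and "\<And>a. a \<in> A \<Longrightarrow> finite (S a) \<and> S a \<noteq> {}"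
  shows "(\<Sum>a\<in>A. w a * real (card (S a))) \<le> real (card (mid_points A w S))"
  using card_mid_points_aux[of A w S] assms le_of_int_ceiling[of "\<Sum>a\<in>A. w a * real (Max (S a))"] by (smt (verit))

section \<open>From sets to functions\<close>

lemma weighted_arith_geom_mean:
  fixes x :: "'a \<Rightarrow> real"
  assumes "finite A" "\<And>a. a \<in> A \<Longrightarrow> w a > 0" "sum w A = 1" "\<And>a. a \<in> A \<Longrightarrow> x a \<ge> 0"
  shows "(\<Prod>a\<in>A. x a powr w a) \<le> (\<Sum>a\<in>A. w a * x a)"
proof (cases "\<exists>a\<in>A. x a = 0")
  case True
  then have "(\<Prod>a\<in>A. x a powr w a) = 0" using assms(1) by auto
  moreover have "(\<Sum>a\<in>A. w a * x a) \<ge> 0" using assms(2,4) by (intro sum_nonneg mult_nonneg_nonneg) (auto intro: less_imp_le)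
  ultimately show ?thesis by linarith
next
  case False
  then have pos: "x a > 0" if "a \<in> A" for a using assms(4)[OF that] that by force
  have "A \<noteq> {}" using assms(3) by auto
  then have "exp (\<Sum>a\<in>A. w a *\<^sub>R ln (x a)) \<le> (\<Sum>a\<in>A. w a * exp (ln (x a)))"
    using assms by (intro convex_on_sum[OF _ _ exp_convex]) (auto intro: less_imp_le)
  moreover have "exp (\<Sum>a\<in>A. w a *\<^sub>R ln (x a)) = (\<Prod>a\<in>A. x a powr w a)"
  proof (subst exp_sum[OF assms(1)], intro prod.cong refl)
    fix a assume "a \<in> A"
    then show "exp (w a *\<^sub>R ln (x a)) = x a powr w a" using pos[of a] by (simp add: powr_def)
  qed
  moreover have "(\<Sum>a\<in>A. w a * exp (ln (x a))) = (\<Sum>a\<in>A. w a * x a)"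
    using pos by (intro sum.cong) auto
  ultimately show ?thesis by simp
qed

lemma has_integral_threshold:
  fixes c :: real assumes "0 \<le> c" "c \<le> 1"
  shows "((\<lambda>t. if t \<le> c then 1 else 0) has_integral c) {0..1}"
proof -
  have "((\<lambda>t. if t \<in> {0..c} then 1 else (0::real)) has_integral c) {0..1}"
    using has_integral_const_real[of "1::real" 0 c] assms
    by (subst has_integral_restrict) auto
  then show ?thesis by (rule has_integral_eq[rotated]) auto
qed

text \<open>The layer-cake formula, with levels scaled to the unit interval by the bound
  \<open>m\<close>. It turns inequalities between sizes of level sets into inequalities between
  sums.\<close>

lemma has_integral_card_level:
  fixes F :: "'b \<Rightarrow> real"
  assumes "finite K" "m > 0" "\<And>k. k \<in> K \<Longrightarrow> 0 \<le> F k \<and> F k \<le> m"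
  shows "((\<lambda>t. real (card {k \<in> K. t * m \<le> F k})) has_integral (\<Sum>k\<in>K. F k) / m) {0..1}"
proof -
  have "real (card {k \<in> K. t * m \<le> F k}) = (\<Sum>k\<in>K. if t \<le> F k / m then 1 else 0)" for t
    using assms(1,2) by (simp add: sum.If_cases pos_le_divide_eq Int_def)
  moreover have "((\<lambda>t. \<Sum>k\<in>K. if t \<le> F k / m then 1 else 0) has_integral (\<Sum>k\<in>K. F k / m)) {0..1}"
    using assms by (intro has_integral_sum has_integral_threshold) auto
  ultimately show ?thesis by (simp add: sum_divide_distrib)
qed

text \<open>Each \<open>F a\<close> is normalized by its maximum. For every level \<open>t\<close>
  in the unit interval, the midpoints of the level sets of the \<open>F a\<close> lie in the level
  set of \<open>h\<close> at height \<open>t * H\<close>, so \<open>card_mid_points\<close> compares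
  the sizes. Integration over \<open>t\<close> bounds the arithmetic mean of the normalized sums,
  which dominates their geometric mean.\<close>

lemma discrete_prekopa_leindler_1d:
  fixes F :: "'a \<Rightarrow> nat \<Rightarrow> real" and h :: "nat \<Rightarrow> real"
  assumes A: "finite A" "\<And>a. a \<in> A \<Longrightarrow> w a > 0" "sum w A = 1"
    and F: "\<And>a k. a \<in> A \<Longrightarrow> k \<le> L \<Longrightarrow> F a k \<ge> 0" and h: "\<And>z. z \<le> L \<Longrightarrow> h z \<ge> 0"
    and le: "\<And>u z. \<lbrakk>\<And>a. a \<in> A \<Longrightarrow> u a \<le> L; z \<le> L; \<bar>real z - (\<Sum>a\<in>A. w a * real (u a))\<bar> < 1\<rbrakk> \<Longrightarrow>
        (\<Prod>a\<in>A. F a (u a) powr w a) \<le> h z"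
  shows "(\<Prod>a\<in>A. (\<Sum>k\<le>L. F a k) powr w a) \<le> (\<Sum>z\<le>L. h z)"
proof (cases "\<exists>a\<in>A. \<forall>k\<le>L. F a k = 0")
  case True
  then obtain a where a: "a \<in> A" "\<forall>k\<le>L. F a k = 0" by blast
  then have "(\<Sum>k\<le>L. F a k) powr w a = 0" by simp
  then have "(\<Prod>a\<in>A. (\<Sum>k\<le>L. F a k) powr w a) = 0" using A(1) a(1) by (intro prod_zero bexI[of _ a])
  moreover have "(\<Sum>z\<le>L. h z) \<ge> 0" using h by (intro sum_nonneg) auto
  ultimately show ?thesis by linarith
next
  case False
  define m where "m a = Max (F a ` {..L})" for a
  have Fm: "F a k \<le> m a" if "k \<le> L" for a k unfolding m_def using that by (intro Max_ge) auto
  have m_att: "\<exists>k\<le>L. F a k = m a" for a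
  proof -
    have "m a \<in> F a ` {..L}" unfolding m_def by (intro Max_in) auto
    then show ?thesis by auto
  qed
  have m: "m a > 0" if a: "a \<in> A" for a
  proof -
    obtain k where "k \<le> L" "F a k \<noteq> 0" using False a by blast
    then show ?thesis using F[OF a, of k] Fm[of k a] by linarith
  qed
  define H where "H = (\<Prod>a\<in>A. m a powr w a)"
  have H: "H > 0" unfolding H_def using m by (intro prod_pos) (metis powr_gt_zero less_irrefl)
  define S where "S t a = {k \<in> {..L}. t * m a \<le> F a k}" for t a
  \<comment> \<open>The layer-cake formula needs values bounded by the normalizer \<open>H\<close>,
    the geometric mean of the maxima. Capping \<open>h\<close> at \<open>H\<close> leaves its level
    sets at heights \<open>t * H\<close> with \<open>t \<le> 1\<close> unchanged.\<close>
  define hh where "hh z = min (h z) H" for z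
  define Z where "Z t = {z \<in> {..L}. t * H \<le> hh z}" for t
  have "(\<Sum>a\<in>A. w a * real (card (S t a))) \<le> real (card (Z t))" if t: "t \<in> {0..1}" for t
  proof -
    have "S t a \<noteq> {}" if a: "a \<in> A" for a
    proof -
      obtain k where "k \<le> L" "F a k = m a" using m_att by blast
      then have "k \<in> S t a" unfolding S_def using m[OF a] t by (simp add: mult_left_le_one_le)
      then show ?thesis by blast
    qed
    then have "(\<Sum>a\<in>A. w a * real (card (S t a))) \<le> real (card (mid_points A w (S t)))"
      using A by (intro card_mid_points) (auto simp: S_def)
    also have "mid_points A w (S t) \<subseteq> Z t"
    proof
      fix z assume "z \<in> mid_points A w (S t)"
      then obtain u where u: "\<And>a. a \<in> A \<Longrightarrow> u a \<in> S t a" "\<bar>real z - (\<Sum>a\<in>A. w a * real (u a))\<bar> < 1"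
        by (auto simp: mid_points_def)
      have uL: "u a \<le> L" if "a \<in> A" for a using u(1)[OF that] by (simp add: S_def)
      have "(\<Sum>a\<in>A. w a * real (u a)) \<le> (\<Sum>a\<in>A. w a * real L)"
        using uL A(2) by (intro sum_mono mult_left_mono) (auto intro: less_imp_le)
      also have "\<dots> = real L" using A(3) by (simp flip: sum_distrib_right)
      finally have zL: "z \<le> L" using u(2) by linarith
      have "t * H \<le> h z"
      proof (cases "t = 0")
        case True then show ?thesis using h[OF zL] by simp
      next
        case False
        then have tpos: "t > 0" using t by simp
        have "t = t powr (sum w A)" using tpos A(3) by simp
        also have "\<dots> = (\<Prod>a\<in>A. t powr w a)" using tpos by (intro powr_sum) auto
        finally have "t * H = (\<Prod>a\<in>A. t powr w a * m a powr w a)" unfolding H_def prod.distrib by simp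
        also have "\<dots> = (\<Prod>a\<in>A. (t * m a) powr w a)"
          using tpos m by (intro prod.cong refl) (simp add: powr_mult less_imp_le)
        also have "\<dots> \<le> (\<Prod>a\<in>A. F a (u a) powr w a)"
          using u(1) tpos m A(2) by (intro prod_mono conjI powr_mono2) (auto simp: S_def less_imp_le)
        also have "\<dots> \<le> h z" using le uL zL u(2) by blast
        finally show ?thesis .
      qed
      moreover have "t * H \<le> H" using t H by simp
      ultimately show "z \<in> Z t" using zL by (simp add: Z_def hh_def)
    qed
    then have "real (card (mid_points A w (S t))) \<le> real (card (Z t))"
      by (intro of_nat_mono card_mono) (auto simp: Z_def)
    finally show ?thesis .
  qed
  moreover have "((\<lambda>t. \<Sum>a\<in>A. w a * real (card (S t a))) has_integral (\<Sum>a\<in>A. w a * ((\<Sum>k\<le>L. F a k) / m a))) {0..1}"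
    unfolding S_def using A(1) F Fm m
    by (intro has_integral_sum has_integral_mult_right has_integral_card_level) auto
  moreover have "((\<lambda>t. real (card (Z t))) has_integral (\<Sum>z\<le>L. hh z) / H) {0..1}"
    unfolding Z_def using H h by (intro has_integral_card_level) (auto simp: hh_def)
  ultimately have 1: "(\<Sum>a\<in>A. w a * ((\<Sum>k\<le>L. F a k) / m a)) \<le> (\<Sum>z\<le>L. hh z) / H"
    by (meson has_integral_le)
  have "(\<Prod>a\<in>A. (\<Sum>k\<le>L. F a k) powr w a) / H = (\<Prod>a\<in>A. ((\<Sum>k\<le>L. F a k) / m a) powr w a)"
    unfolding H_def using m F
    by (subst prod_dividef[symmetric], intro prod.cong refl) (auto simp: powr_divide sum_nonneg less_imp_le)
  also have "\<dots> \<le> (\<Sum>a\<in>A. w a * ((\<Sum>k\<le>L. F a k) / m a))"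
    using A m F by (intro weighted_arith_geom_mean) (auto intro!: divide_nonneg_pos sum_nonneg)
  also note 1
  also have "(\<Sum>z\<le>L. hh z) / H \<le> (\<Sum>z\<le>L. h z) / H"
    using H by (intro divide_right_mono sum_mono) (auto simp: hh_def)
  finally show ?thesis using H by (simp add: divide_le_cancel)
qed

lemma sum_PiE_insert:
  assumes "e \<notin> E"
  shows "(\<Sum>\<gamma>\<in>PiE (insert e E) S. g \<gamma>) = (\<Sum>k\<in>S e. \<Sum>\<gamma>\<in>PiE E S. g (\<gamma>(e := k)))"
proof -
  have "(\<Sum>\<gamma>\<in>PiE (insert e E) S. g \<gamma>) = (\<Sum>(k, \<gamma>)\<in>S e \<times> PiE E S. g (\<gamma>(e := k)))"
    unfolding PiE_insert_eq using inj_combinator[OF assms, of S]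
    by (subst sum.reindex) (auto simp: case_prod_unfold)
  then show ?thesis by (simp add: sum.cartesian_product)
qed

text \<open>Tensorization: for fixed values of the coordinate \<open>e\<close>, the induction
  hypothesis on the other coordinates shows that the partial sums satisfy the premise of the
  one-dimensional inequality in \<open>e\<close>.\<close>

theorem discrete_prekopa_leindler:
  fixes F :: "'a \<Rightarrow> ('e \<Rightarrow> nat) \<Rightarrow> real" and h :: "('e \<Rightarrow> nat) \<Rightarrow> real"
  assumes A: "finite A" "\<And>a. a \<in> A \<Longrightarrow> w a > 0" "sum w A = 1" and "finite E"
    and F: "\<And>a \<gamma>. a \<in> A \<Longrightarrow> \<gamma> \<in> PiE E (\<lambda>_. {..L}) \<Longrightarrow> F a \<gamma> \<ge> 0"
    and h: "\<And>\<zeta>. \<zeta> \<in> PiE E (\<lambda>_. {..L}) \<Longrightarrow> h \<zeta> \<ge> 0"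
    and le: "\<And>u \<zeta>. \<lbrakk>\<And>a. a \<in> A \<Longrightarrow> u a \<in> PiE E (\<lambda>_. {..L}); \<zeta> \<in> PiE E (\<lambda>_. {..L});
        \<And>e. e \<in> E \<Longrightarrow> \<bar>real (\<zeta> e) - (\<Sum>a\<in>A. w a * real (u a e))\<bar> < 1\<rbrakk> \<Longrightarrow>
        (\<Prod>a\<in>A. F a (u a) powr w a) \<le> h \<zeta>"
  shows "(\<Prod>a\<in>A. (\<Sum>\<gamma>\<in>PiE E (\<lambda>_. {..L}). F a \<gamma>) powr w a) \<le> (\<Sum>\<zeta>\<in>PiE E (\<lambda>_. {..L}). h \<zeta>)"
  using assms(4) F h le
proof (induction E arbitrary: F h rule: finite_induct)
  case empty
  show ?case using empty.prems(3)[of "\<lambda>_ _. undefined" "\<lambda>_. undefined"] by simp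
next
  case (insert e E)
  have upd: "\<gamma>(e := k) \<in> PiE (insert e E) (\<lambda>_. {..L})" if "\<gamma> \<in> PiE E (\<lambda>_. {..L})" "k \<le> L" for \<gamma> k
    using that by (intro PiE_fun_upd) auto
  show ?case
    unfolding sum_PiE_insert[OF insert.hyps(2)]
  proof (rule discrete_prekopa_leindler_1d[OF A])
    fix u z assume u: "\<And>a. a \<in> A \<Longrightarrow> u a \<le> L" "z \<le> L" "\<bar>real z - (\<Sum>a\<in>A. w a * real (u a))\<bar> < 1"
    show "(\<Prod>a\<in>A. (\<Sum>\<gamma>\<in>PiE E (\<lambda>_. {..L}). F a (\<gamma>(e := u a))) powr w a)
          \<le> (\<Sum>\<gamma>\<in>PiE E (\<lambda>_. {..L}). h (\<gamma>(e := z)))"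
    proof (rule insert.IH)
      fix v \<zeta> assume v: "\<And>a. a \<in> A \<Longrightarrow> v a \<in> PiE E (\<lambda>_. {..L})" "\<zeta> \<in> PiE E (\<lambda>_. {..L})"
        "\<And>e. e \<in> E \<Longrightarrow> \<bar>real (\<zeta> e) - (\<Sum>a\<in>A. w a * real (v a e))\<bar> < 1"
      show "(\<Prod>a\<in>A. F a ((v a)(e := u a)) powr w a) \<le> h (\<zeta>(e := z))"
      proof (rule insert.prems(3)[of "\<lambda>a. (v a)(e := u a)"])
        fix e' assume "e' \<in> insert e E"
        then show "\<bar>real ((\<zeta>(e := z)) e') - (\<Sum>a\<in>A. w a * real (((v a)(e := u a)) e'))\<bar> < 1"
          using u(3) v(3)[of e'] by (cases "e' = e") simp_all
      next
        fix a assume "a \<in> A"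
        then show "(v a)(e := u a) \<in> PiE (insert e E) (\<lambda>_. {..L})" by (intro upd u(1) v(1))
      next
        show "\<zeta>(e := z) \<in> PiE (insert e E) (\<lambda>_. {..L})" by (intro upd u(2) v(2))
      qed
    next
      fix a \<gamma> assume "a \<in> A" "\<gamma> \<in> PiE E (\<lambda>_. {..L})"
      then show "F a (\<gamma>(e := u a)) \<ge> 0" by (intro insert.prems(1) upd u(1))
    next
      fix \<zeta> assume "\<zeta> \<in> PiE E (\<lambda>_. {..L})"
      then show "h (\<zeta>(e := z)) \<ge> 0" by (intro insert.prems(2) upd u(2))
    qed
  next
    fix a k assume "a \<in> A" "k \<le> L"
    then show "(\<Sum>\<gamma>\<in>PiE E (\<lambda>_. {..L}). F a (\<gamma>(e := k))) \<ge> 0"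
      by (intro sum_nonneg insert.prems(1) upd)
  next
    fix z assume "z \<le> L"
    then show "(\<Sum>\<gamma>\<in>PiE E (\<lambda>_. {..L}). h (\<gamma>(e := z))) \<ge> 0"
      by (intro sum_nonneg insert.prems(2) upd)
  qed
qed

section \<open>Tables and products of linear forms\<close>

text \<open>Tables are curried functions, so that each row is an exponent vector and a table amounts
  to a choice of one monomial from each row factor.\<close>

definition row_tables :: "'a set \<Rightarrow> 'b set \<Rightarrow> ('a \<Rightarrow> nat) \<Rightarrow> ('a \<Rightarrow> 'b \<Rightarrow> nat) set" where
  "row_tables I J r = PiE I (\<lambda>i. comps J (r i))"

definition col_sums :: "'a set \<Rightarrow> 'b set \<Rightarrow> ('a \<Rightarrow> 'b \<Rightarrow> nat) \<Rightarrow> 'b \<Rightarrow> nat" where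
  "col_sums I J D = (\<lambda>j\<in>J. \<Sum>i\<in>I. D i j)"

definition margin_tables :: "'a set \<Rightarrow> 'b set \<Rightarrow> ('a \<Rightarrow> nat) \<Rightarrow> ('b \<Rightarrow> nat) \<Rightarrow> ('a \<Rightarrow> 'b \<Rightarrow> nat) set" where
  "margin_tables I J r \<alpha> = {D \<in> row_tables I J r. col_sums I J D = \<alpha>}"

lemma finite_row_tables [simp]: "finite I \<Longrightarrow> finite J \<Longrightarrow> finite (row_tables I J r)"
  unfolding row_tables_def by (intro finite_PiE) auto

lemma finite_margin_tables [simp]: "finite I \<Longrightarrow> finite J \<Longrightarrow> finite (margin_tables I J r \<alpha>)"
  unfolding margin_tables_def by simp

lemma row_tables_sum: "D \<in> row_tables I J r \<Longrightarrow> i \<in> I \<Longrightarrow> sum (D i) J = r i"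
  unfolding row_tables_def comps_def by auto

lemma col_sums_in_comps:
  assumes "finite J" "D \<in> row_tables I J r"
  shows "col_sums I J D \<in> comps J (sum r I)"
proof (rule comps_memI)
  have "sum (col_sums I J D) J = (\<Sum>j\<in>J. \<Sum>i\<in>I. D i j)" by (simp add: col_sums_def)
  also have "\<dots> = sum r I" by (subst sum.swap) (simp add: row_tables_sum[OF assms(2)])
  finally show "sum (col_sums I J D) J = sum r I" .
qed (use assms in \<open>auto simp: col_sums_def\<close>)

text \<open>The product over rows is expanded by distributivity and the tables are grouped by column
  sums, which are the exponents of \<open>y\<close>. Entry weights \<open>c\<close> equal to 1 count
  tables; weights \<open>\<gamma> ^ d / d!\<close> give products of linear forms.\<close>

lemma prod_row_sums:
  fixes y :: "'b \<Rightarrow> 'c :: comm_semiring_1"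
  assumes "finite I" "finite J"
  shows "(\<Prod>i\<in>I. \<Sum>d\<in>comps J (r i). \<Prod>j\<in>J. c i j (d j) * y j ^ d j) =
    (\<Sum>\<alpha>\<in>comps J (sum r I). (\<Sum>D\<in>margin_tables I J r \<alpha>. \<Prod>i\<in>I. \<Prod>j\<in>J. c i j (D i j)) * (\<Prod>j\<in>J. y j ^ \<alpha> j))"
proof -
  have "(\<Prod>i\<in>I. \<Sum>d\<in>comps J (r i). \<Prod>j\<in>J. c i j (d j) * y j ^ d j) =
     (\<Sum>D\<in>row_tables I J r. \<Prod>i\<in>I. \<Prod>j\<in>J. c i j (D i j) * y j ^ D i j)"
    unfolding row_tables_def using assms by (intro prod_sum_PiE) auto
  also have "\<dots> = (\<Sum>\<alpha>\<in>comps J (sum r I). \<Sum>D\<in>{D \<in> row_tables I J r. col_sums I J D = \<alpha>}.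
      \<Prod>i\<in>I. \<Prod>j\<in>J. c i j (D i j) * y j ^ D i j)"
    using assms col_sums_in_comps by (subst sum.group) auto
  also have "\<dots> = (\<Sum>\<alpha>\<in>comps J (sum r I). (\<Sum>D\<in>margin_tables I J r \<alpha>. \<Prod>i\<in>I. \<Prod>j\<in>J. c i j (D i j)) * (\<Prod>j\<in>J. y j ^ \<alpha> j))"
    unfolding sum_distrib_right margin_tables_def
  proof (intro sum.cong refl)
    fix \<alpha> D assume "D \<in> {D \<in> row_tables I J r. col_sums I J D = \<alpha>}"
    then have \<alpha>: "\<alpha> j = (\<Sum>i\<in>I. D i j)" if "j \<in> J" for j using that by (auto simp: col_sums_def)
    have "(\<Prod>i\<in>I. \<Prod>j\<in>J. y j ^ D i j) = (\<Prod>j\<in>J. y j ^ \<alpha> j)"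
      by (subst prod.swap) (simp add: \<alpha> power_sum)
    then show "(\<Prod>i\<in>I. \<Prod>j\<in>J. c i j (D i j) * y j ^ D i j) =
      (\<Prod>i\<in>I. \<Prod>j\<in>J. c i j (D i j)) * (\<Prod>j\<in>J. y j ^ \<alpha> j)"
      by (simp add: prod.distrib)
  qed
  finally show ?thesis .
qed

lemma multinomial_comps:
  fixes x :: "'b \<Rightarrow> 'c :: {field_char_0}"
  assumes "finite J"
  shows "(\<Sum>j\<in>J. x j) ^ n / fact n = (\<Sum>d\<in>comps J n. \<Prod>j\<in>J. x j ^ d j / fact (d j))"
  using assms
proof (induction J arbitrary: n rule: finite_induct)
  case empty
  then show ?case by (cases n) (simp_all add: comps_empty)
next
  case (insert v J)
  have "(\<Sum>j\<in>insert v J. x j) ^ n / fact n = (\<Sum>k\<le>n. x v ^ k / fact k * ((\<Sum>j\<in>J. x j) ^ (n - k) / fact (n - k)))"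
    using insert.hyps by (simp add: binomial_ring sum_divide_distrib binomial_fact field_simps)
  also have "\<dots> = (\<Sum>k\<le>n. \<Sum>d\<in>comps J (n - k). \<Prod>j\<in>insert v J. x j ^ (d(v := k)) j / fact ((d(v := k)) j))"
  proof (unfold insert.IH sum_distrib_left, intro sum.cong refl)
    fix k d
    have "(\<Prod>j\<in>J. x j ^ (d(v := k)) j / fact ((d(v := k)) j)) = (\<Prod>j\<in>J. x j ^ d j / fact (d j))"
      using insert.hyps by (intro prod.cong) auto
    then show "x v ^ k / fact k * (\<Prod>j\<in>J. x j ^ d j / fact (d j)) =
      (\<Prod>j\<in>insert v J. x j ^ (d(v := k)) j / fact ((d(v := k)) j))"
      using insert.hyps by simp
  qed
  finally show ?case unfolding sum_comps_insert[OF insert.hyps] .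
qed

section \<open>Powers of linear forms\<close>

text \<open>The coefficient of the monomial with exponent \<open>\<alpha>\<close> in
  \<open>rate_poly\<close>, the product over the rows of the linear forms with coefficients
  \<open>\<gamma> (i, j)\<close>, raised to the power \<open>r i\<close> and divided by
  \<open>r i\<close> factorial.\<close>

definition rate_coeff :: "'a set \<Rightarrow> 'b set \<Rightarrow> ('a \<Rightarrow> nat) \<Rightarrow> ('a \<times> 'b \<Rightarrow> real) \<Rightarrow> ('b \<Rightarrow> nat) \<Rightarrow> real" where
  "rate_coeff I J r \<gamma> \<alpha> =
     (\<Sum>D\<in>margin_tables I J r \<alpha>. \<Prod>i\<in>I. \<Prod>j\<in>J. \<gamma> (i, j) ^ D i j / fact (D i j))"

definition rate_poly :: "'a set \<Rightarrow> 'b set \<Rightarrow> ('a \<Rightarrow> nat) \<Rightarrow> ('a \<times> 'b \<Rightarrow> real) \<Rightarrow> ('b \<Rightarrow> real) \<Rightarrow> real" where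
  "rate_poly I J r \<gamma> y = (\<Prod>i\<in>I. (\<Sum>j\<in>J. \<gamma> (i, j) * y j) ^ r i / fact (r i))"

text \<open>The scalar field is left open: complex \<open>y\<close> is needed for stability and real
  \<open>y\<close> for the capacity.\<close>

lemma prod_linear_forms_expand:
  fixes y :: "'b \<Rightarrow> 'c :: real_normed_field"
  assumes "finite I" "finite J"
  shows "(\<Prod>i\<in>I. (\<Sum>j\<in>J. of_real (\<gamma> (i, j)) * y j) ^ r i / fact (r i)) =
    (\<Sum>\<alpha>\<in>comps J (sum r I). of_real (rate_coeff I J r \<gamma> \<alpha>) * (\<Prod>j\<in>J. y j ^ \<alpha> j))"
proof -
  have "(\<Prod>i\<in>I. (\<Sum>j\<in>J. of_real (\<gamma> (i, j)) * y j) ^ r i / fact (r i)) =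
    (\<Prod>i\<in>I. \<Sum>d\<in>comps J (r i). \<Prod>j\<in>J. of_real (\<gamma> (i, j) ^ d j / fact (d j)) * y j ^ d j)"
    unfolding multinomial_comps[OF assms(2)] by (simp add: power_mult_distrib)
  then show ?thesis
    using prod_row_sums[OF assms, where y = y and r = r and c = "\<lambda>i j d. of_real (\<gamma> (i, j) ^ d / fact d)"]
    by (simp add: rate_coeff_def)
qed

lemma rate_poly_expand:
  assumes "finite I" "finite J"
  shows "rate_poly I J r \<gamma> y = (\<Sum>\<alpha>\<in>comps J (sum r I). rate_coeff I J r \<gamma> \<alpha> * (\<Prod>j\<in>J. y j ^ \<alpha> j))"
  using prod_linear_forms_expand[OF assms, where y = y and \<gamma> = \<gamma> and r = r] by (simp add: rate_poly_def)

lemma exists_le_sum: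
  fixes \<alpha> :: "'b \<Rightarrow> nat"
  assumes "finite J" "s \<le> sum \<alpha> J"
  shows "\<exists>d\<in>comps J s. \<forall>j\<in>J. d j \<le> \<alpha> j"
  using assms(2)
proof (induction s)
  case 0
  then show ?case using assms(1) by (simp add: comps_zero)
next
  case (Suc s)
  then obtain d where d: "d \<in> comps J s" "\<forall>j\<in>J. d j \<le> \<alpha> j" by auto
  then have "sum d J < sum \<alpha> J" using Suc.prems by (simp add: comps_def)
  then obtain j where j: "j \<in> J" "d j < \<alpha> j" by (metis not_le sum_mono)
  have "sum (d(j := Suc (d j))) J = Suc (sum d J)"
    using j(1) assms(1) by (simp add: sum.remove[of J j])
  moreover have "d(j := Suc (d j)) \<in> extensional J" using d(1) j(1) by (auto simp: comps_def PiE_def extensional_def)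
  ultimately have "d(j := Suc (d j)) \<in> comps J (Suc s)"
    using d(1) assms(1) by (intro comps_memI) (auto simp: comps_def)
  then show ?case using d(2) j(2) by (intro bexI[of _ "d(j := Suc (d j))"]) auto
qed

text \<open>Rows are filled one after another, each staying below the column sums that remain. This
  makes all coefficients of the polynomials positive.\<close>

lemma margin_tables_nonempty:
  assumes "finite I" "finite J" "\<alpha> \<in> comps J (sum r I)"
  shows "margin_tables I J r \<alpha> \<noteq> {}"
  using assms(1,3)
proof (induction I arbitrary: \<alpha> rule: finite_induct)
  case empty
  then have "\<alpha> = (\<lambda>j\<in>J. 0)" using comps_zero[OF assms(2)] by simp
  then show ?case by (auto simp: margin_tables_def row_tables_def col_sums_def)
next
  case (insert i I)
  have \<alpha>: "sum \<alpha> J = r i + sum r I" using insert by (simp add: comps_def)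
  then obtain d where d: "d \<in> comps J (r i)" "\<forall>j\<in>J. d j \<le> \<alpha> j"
    using exists_le_sum[OF assms(2), of "r i" \<alpha>] by auto
  let ?\<beta> = "\<lambda>j\<in>J. \<alpha> j - d j"
  have "sum ?\<beta> J = sum \<alpha> J - sum d J" using d(2) by (simp add: sum_subtractf_nat)
  also have "\<dots> = sum r I" using \<alpha> d(1) by (simp add: comps_def)
  finally have "?\<beta> \<in> comps J (sum r I)" using assms(2) by (intro comps_memI) auto
  then obtain D where D: "D \<in> margin_tables I J r ?\<beta>" using insert.IH by blast
  have "D(i := d) \<in> row_tables (insert i I) J r"
    using D d(1) unfolding margin_tables_def row_tables_def by (auto intro!: PiE_fun_upd)
  moreover have "col_sums (insert i I) J (D(i := d)) = \<alpha>"
  proof (rule extensionalityI)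
    show "col_sums (insert i I) J (D(i := d)) \<in> extensional J" by (simp add: col_sums_def)
    show "\<alpha> \<in> extensional J" using insert.prems by (simp add: comps_def PiE_def)
    fix j assume j: "j \<in> J"
    have "(\<Sum>i'\<in>I. (D(i := d)) i' j) = (\<Sum>i'\<in>I. D i' j)" using insert.hyps by (intro sum.cong) auto
    also have "\<dots> = \<alpha> j - d j" using D j by (auto simp: margin_tables_def col_sums_def dest: fun_cong[of _ _ j])
    finally show "col_sums (insert i I) J (D(i := d)) j = \<alpha> j"
      using j d(2) insert.hyps by (simp add: col_sums_def)
  qed
  ultimately show ?case by (auto simp: margin_tables_def)
qed

text \<open>A linear form with positive coefficients takes a point of the closed upper half space
  with at least one non-real coordinate into the open upper half plane, so no factor
  vanishes.\<close>

lemma strictly_stable_rate_coeff: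
  assumes "finite I" "finite J" "\<And>e. e \<in> I \<times> J \<Longrightarrow> \<gamma> e > 0"
  shows "strictly_stable J (sum r I) (rate_coeff I J r \<gamma>)"
  unfolding strictly_stable_def prod_linear_forms_expand[OF assms(1,2), symmetric]
proof (intro allI impI)
  fix z :: "'b \<Rightarrow> complex" assume z: "\<forall>j\<in>J. Im (z j) \<ge> 0" "\<exists>j\<in>J. Im (z j) > 0"
  have "(\<Sum>j\<in>J. of_real (\<gamma> (i, j)) * z j) \<noteq> 0" if i: "i \<in> I" for i
  proof -
    obtain j where j: "j \<in> J" "Im (z j) > 0" using z by auto
    have "\<gamma> (i, j) * Im (z j) \<ge> 0" if "j \<in> J" for j
      using z(1) that i assms(3)[of "(i, j)"] by (intro mult_nonneg_nonneg) auto
    moreover have "\<gamma> (i, j) * Im (z j) > 0" using j i assms(3)[of "(i, j)"] by simp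
    ultimately have "(\<Sum>j\<in>J. \<gamma> (i, j) * Im (z j)) > 0"
      using assms(2) j(1) by (intro sum_pos2[of J j])
    then have "Im (\<Sum>j\<in>J. of_real (\<gamma> (i, j)) * z j) > 0" by simp
    then show ?thesis by force
  qed
  then show "(\<Prod>i\<in>I. (\<Sum>j\<in>J. of_real (\<gamma> (i, j)) * z j) ^ r i / fact (r i)) \<noteq> 0"
    using assms(1) by simp
qed

text \<open>Strict stability requires positive rates. Rates that may be 0 are raised by
  \<open>1 / Suc n\<close>, which only increases the polynomial at positive \<open>y\<close>, and
  then \<open>n\<close> tends to infinity.\<close>

lemma rate_coeff_capacity:
  assumes "finite I" "finite J" and \<gamma>: "\<And>e. e \<in> I \<times> J \<Longrightarrow> \<gamma> e \<ge> 0" and C: "C \<in> comps J (sum r I)"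
    and B: "\<And>y. (\<And>j. j \<in> J \<Longrightarrow> y j > 0) \<Longrightarrow> rate_poly I J r \<gamma> y \<ge> B * (\<Prod>j\<in>J. y j ^ C j)" "B \<ge> 0"
  shows "rate_coeff I J r \<gamma> C \<ge> B / (real (sum r I) + 1) ^ card J"
proof -
  define \<gamma>' where "\<gamma>' n e = \<gamma> e + 1 / real (Suc n)" for n and e :: "'a \<times> 'b"
  have \<gamma>'_pos: "\<gamma>' n e > 0" if "e \<in> I \<times> J" for n e
    using \<gamma>[OF that] unfolding \<gamma>'_def by (intro add_nonneg_pos) auto
  have "rate_coeff I J r (\<gamma>' n) C \<ge> B / (real (sum r I) + 1) ^ card J" for n
  proof (rule strictly_stable_capacity)
    show "strictly_stable J (sum r I) (rate_coeff I J r (\<gamma>' n))"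
      using assms(1,2) \<gamma>'_pos by (intro strictly_stable_rate_coeff) auto
    fix \<alpha> assume \<alpha>: "\<alpha> \<in> comps J (sum r I)"
    show "rate_coeff I J r (\<gamma>' n) \<alpha> > 0" unfolding rate_coeff_def
      using margin_tables_nonempty[OF assms(1,2) \<alpha>] assms(1,2) \<gamma>'_pos
      by (intro sum_pos prod_pos divide_pos_pos) auto
  next
    fix y :: "'b \<Rightarrow> real" assume y: "\<And>j. j \<in> J \<Longrightarrow> y j > 0"
    have "B * (\<Prod>j\<in>J. y j ^ C j) \<le> rate_poly I J r \<gamma> y" using B y by blast
    also have "\<dots> \<le> rate_poly I J r (\<gamma>' n) y" unfolding rate_poly_def
    proof (intro prod_mono conjI divide_right_mono power_mono sum_mono mult_right_mono)
      fix i assume i: "i \<in> I"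
      have s: "(\<Sum>j\<in>J. \<gamma> (i, j) * y j) \<ge> 0"
        using i \<gamma> y by (intro sum_nonneg mult_nonneg_nonneg) (auto intro: less_imp_le)
      then show "(\<Sum>j\<in>J. \<gamma> (i, j) * y j) \<ge> 0" .
      show "(\<Sum>j\<in>J. \<gamma> (i, j) * y j) ^ r i / fact (r i) \<ge> 0" using s by simp
    qed (use y in \<open>auto simp: \<gamma>'_def less_imp_le\<close>)
    finally show "B * (\<Prod>j\<in>J. y j ^ C j) \<le> (\<Sum>\<alpha>\<in>comps J (sum r I). rate_coeff I J r (\<gamma>' n) \<alpha> * (\<Prod>j\<in>J. y j ^ \<alpha> j))"
      unfolding rate_poly_expand[OF assms(1,2)] .
  qed (use assms in auto)
  moreover have "(\<lambda>n. rate_coeff I J r (\<gamma>' n) C) \<longlonglongrightarrow> rate_coeff I J r (\<lambda>e. \<gamma> e + 0) C"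
    unfolding rate_coeff_def \<gamma>'_def using LIMSEQ_inverse_real_of_nat
    by (intro tendsto_intros) (simp_all add: inverse_eq_divide)
  ultimately show ?thesis using LIMSEQ_le_const by fastforce
qed

section \<open>Averaging over integer rates\<close>

lemma negative_binomial_sums:
  fixes \<theta> :: real
  assumes "0 < \<theta>" "\<theta> < 1"
  shows "(\<lambda>n. real ((n + d) choose d) * \<theta> ^ n) sums (1 / (1 - \<theta>) ^ Suc d)"
proof -
  have "(\<lambda>n. (- real (Suc d) gchoose n) * (- \<theta>) ^ n) sums (1 + (- \<theta>)) powr (- real (Suc d))"
    using assms by (intro gen_binomial_real) auto
  moreover have "(- real (Suc d) gchoose n) * (- \<theta>) ^ n = real ((n + d) choose d) * \<theta> ^ n" for n
  proof -
    have "real (Suc d) + real n - 1 = real (n + d)" by simp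
    then have "(- real (Suc d) gchoose n) = (- 1) ^ n * (real (n + d) gchoose n)"
      unfolding gbinomial_minus by metis
    also have "real (n + d) gchoose n = real ((n + d) choose n)" by (simp add: binomial_gbinomial)
    also have "(n + d) choose n = (n + d) choose d" using binomial_symmetric[of n "n + d"] by simp
    finally have "(- real (Suc d) gchoose n) * (- \<theta>) ^ n = ((- 1) ^ n * (- \<theta>) ^ n) * real ((n + d) choose d)"
      by (simp only: mult_ac)
    also have "(- 1) ^ n * (- \<theta>) ^ n = \<theta> ^ n" by (simp flip: power_mult_distrib)
    finally show ?thesis by (simp only: mult.commute)
  qed
  moreover have "(1 + (- \<theta>)) powr (- real (Suc d)) = 1 / (1 - \<theta>) ^ Suc d"
  proof -
    have "(1 - \<theta>) powr (- real (Suc d)) = 1 / (1 - \<theta>) powr real (Suc d)"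
      by (simp only: powr_minus_divide)
    also have "(1 - \<theta>) powr real (Suc d) = (1 - \<theta>) ^ Suc d" using assms by (intro powr_realpow) auto
    finally show ?thesis by simp
  qed
  ultimately show ?thesis by simp
qed

lemma power_le_fact_mult_choose: "m ^ d \<le> fact d * ((m + d) choose d)"
proof (induction d)
  case (Suc d)
  have "m ^ Suc d \<le> (m + Suc d) * (fact d * ((m + d) choose d))" unfolding power_Suc by (intro mult_le_mono Suc.IH) simp
  also have "\<dots> = fact d * (Suc (m + d) * ((m + d) choose d))" by (simp add: algebra_simps)
  also have "\<dots> = fact d * (Suc d * ((m + Suc d) choose Suc d))"
    using Suc_times_binomial[of d "m + d"] by simp
  also have "\<dots> = fact (Suc d) * ((m + Suc d) choose Suc d)" by (simp only: fact_Suc mult_ac of_nat_id)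
  finally show ?case .
qed simp

text \<open>A discrete counterpart of the Gamma integral of \<open>x ^ d / d!\<close>: since
  \<open>m ^ d / d!\<close> is at most \<open>(m + d) choose d\<close>, the sum is dominated by the
  negative binomial series. The arguments are shifted by 1 to match the rates after
  rounding.\<close>

lemma kernel_sum_le:
  fixes \<theta> :: real
  assumes "0 < \<theta>" "\<theta> < 1"
  shows "(\<Sum>k\<le>L. \<theta> ^ Suc k * (real (Suc k) ^ d / fact d)) \<le> (1 / (1 - \<theta>)) ^ Suc d"
proof -
  note s = negative_binomial_sums[OF assms, of d]
  have "(\<Sum>k\<le>L. \<theta> ^ Suc k * (real (Suc k) ^ d / fact d)) \<le> (\<Sum>k\<le>L. real ((Suc k + d) choose d) * \<theta> ^ Suc k)"
  proof (intro sum_mono)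
    fix k
    have "real (Suc k ^ d) \<le> real (fact d * ((Suc k + d) choose d))"
      using power_le_fact_mult_choose by (intro of_nat_mono)
    then have "real (Suc k) ^ d / fact d \<le> real ((Suc k + d) choose d)"
      by (simp add: divide_le_eq mult.commute)
    then show "\<theta> ^ Suc k * (real (Suc k) ^ d / fact d) \<le> real ((Suc k + d) choose d) * \<theta> ^ Suc k"
      using assms by (subst mult.commute, intro mult_right_mono) auto
  qed
  also have "\<dots> = (\<Sum>n\<in>Suc ` {..L}. real ((n + d) choose d) * \<theta> ^ n)"
    by (subst sum.reindex) (auto intro!: sum.cong)
  also have "\<dots> \<le> (\<Sum>n. real ((n + d) choose d) * \<theta> ^ n)"
    using s assms by (intro sum_le_suminf) (auto simp: sums_iff)
  also have "\<dots> = (1 / (1 - \<theta>)) ^ Suc d" using s by (simp add: sums_iff power_one_over)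
  finally show ?thesis .
qed

text \<open>The opposite comparison, from \<open>k choose d \<le> k ^ d / d!\<close>. One cutoff
  \<open>L\<close> has to serve all \<open>d \<le> N\<close>, since the rates range over a finite
  box.\<close>

lemma kernel_sum_ge:
  fixes \<theta> :: real
  assumes "0 < \<theta>" "\<theta> < 1"
  shows "\<exists>L. \<forall>d\<le>N. (\<Sum>k\<le>L. \<theta> ^ k * (real k ^ d / fact d)) \<ge> (\<theta> / (1 - \<theta>)) ^ Suc d"
proof -
  have "\<forall>\<^sub>F L in sequentially. (\<theta> / (1 - \<theta>)) ^ Suc d \<le> (\<Sum>k\<le>L. \<theta> ^ k * (real k ^ d / fact d))" for d
  proof -
    have "(\<lambda>L. \<Sum>n<L. real ((n + d) choose d) * \<theta> ^ n) \<longlonglongrightarrow> 1 / (1 - \<theta>) ^ Suc d"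
      using negative_binomial_sums[OF assms, of d] by (simp add: sums_def)
    moreover have "1 / (1 - \<theta>) ^ Suc d > 0" using assms by (intro divide_pos_pos zero_less_power) auto
    then have "\<theta> * (1 / (1 - \<theta>) ^ Suc d) < 1 / (1 - \<theta>) ^ Suc d"
      using mult_strict_right_mono[OF assms(2)] by (metis mult_1)
    ultimately have "\<forall>\<^sub>F L in sequentially. \<theta> * (1 / (1 - \<theta>) ^ Suc d) < (\<Sum>n<L. real ((n + d) choose d) * \<theta> ^ n)"
      by (rule order_tendstoD)
    then obtain L0 where L0: "\<theta> * (1 / (1 - \<theta>) ^ Suc d) < (\<Sum>n<L. real ((n + d) choose d) * \<theta> ^ n)" if "L \<ge> L0" for L
      by (auto simp: eventually_sequentially)
    have "(\<theta> / (1 - \<theta>)) ^ Suc d \<le> (\<Sum>k\<le>L. \<theta> ^ k * (real k ^ d / fact d))" if "L \<ge> L0 + d" for L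
    proof -
      \<comment> \<open>The full series would give
        \<open>\<theta> ^ d / (1 - \<theta>) ^ Suc d\<close>; the additional factor
        \<open>\<theta> < 1\<close> leaves room for the truncation.\<close>
      have "(\<theta> / (1 - \<theta>)) ^ Suc d = \<theta> ^ d * (\<theta> * (1 / (1 - \<theta>) ^ Suc d))" by (simp add: power_divide)
      also have "\<dots> \<le> \<theta> ^ d * (\<Sum>n<L0. real ((n + d) choose d) * \<theta> ^ n)"
        using L0[of L0] assms by (intro mult_left_mono) auto
      also have "\<dots> = (\<Sum>k\<in>(\<lambda>n. n + d) ` {..<L0}. real (k choose d) * \<theta> ^ k)"
        by (subst sum.reindex) (auto simp: sum_distrib_left power_add mult_ac intro!: sum.cong)
      also have "\<dots> \<le> (\<Sum>k\<le>L. real (k choose d) * \<theta> ^ k)"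
        using that assms by (intro sum_mono2) auto
      also have "\<dots> \<le> (\<Sum>k\<le>L. \<theta> ^ k * (real k ^ d / fact d))"
      proof (intro sum_mono)
        fix k
        have "real ((k choose d) * fact d) \<le> real (k ^ d)"
          using binomial_fact_pow by (intro of_nat_mono)
        then have "real (k choose d) \<le> real k ^ d / fact d" by (simp add: le_divide_eq)
        then show "real (k choose d) * \<theta> ^ k \<le> \<theta> ^ k * (real k ^ d / fact d)"
          using assms by (subst (2) mult.commute, intro mult_right_mono) auto
      qed
      finally show ?thesis .
    qed
    then show ?thesis by (auto simp: eventually_sequentially)
  qed
  then have "\<forall>\<^sub>F L in sequentially. \<forall>d\<in>{..N}. (\<theta> / (1 - \<theta>)) ^ Suc d \<le> (\<Sum>k\<le>L. \<theta> ^ k * (real k ^ d / fact d))"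
    by (intro eventually_ball_finite) auto
  then show ?thesis by (auto simp: eventually_sequentially)
qed

text \<open>For a fixed table the sum over all rate matrices factors into one sum per cell, and each
  of these is a kernel sum that is nearly a power with exponent \<open>D i j + 1\<close>.\<close>

lemma sum_rate_coeff:
  fixes p q :: "nat \<Rightarrow> real"
  assumes "finite I" "finite J"
  shows "(\<Sum>\<gamma>\<in>PiE (I \<times> J) (\<lambda>_. {..L}). (\<Prod>e\<in>I \<times> J. p (\<gamma> e)) * rate_coeff I J r (\<lambda>e. q (\<gamma> e)) \<alpha>) =
    (\<Sum>D\<in>margin_tables I J r \<alpha>. \<Prod>i\<in>I. \<Prod>j\<in>J. \<Sum>k\<le>L. p k * (q k ^ D i j / fact (D i j)))"
proof -
  have "(\<Prod>i\<in>I. \<Prod>j\<in>J. \<Sum>k\<le>L. p k * (q k ^ D i j / fact (D i j))) =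
     (\<Sum>\<gamma>\<in>PiE (I \<times> J) (\<lambda>_. {..L}). (\<Prod>e\<in>I \<times> J. p (\<gamma> e)) * (\<Prod>i\<in>I. \<Prod>j\<in>J. q (\<gamma> (i, j)) ^ D i j / fact (D i j)))"
    for D :: "'a \<Rightarrow> 'b \<Rightarrow> nat"
  proof -
    have "(\<Prod>i\<in>I. \<Prod>j\<in>J. \<Sum>k\<le>L. p k * (q k ^ D i j / fact (D i j))) =
       (\<Prod>e\<in>I \<times> J. \<Sum>k\<le>L. p k * (q k ^ D (fst e) (snd e) / fact (D (fst e) (snd e))))"
      by (simp add: prod.cartesian_product case_prod_unfold)
    also have "\<dots> = (\<Sum>\<gamma>\<in>PiE (I \<times> J) (\<lambda>_. {..L}). \<Prod>e\<in>I \<times> J. p (\<gamma> e) * (q (\<gamma> e) ^ D (fst e) (snd e) / fact (D (fst e) (snd e))))"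
      using assms by (intro prod_sum_PiE) auto
    finally show ?thesis unfolding prod.distrib by (simp add: prod.cartesian_product case_prod_unfold)
  qed
  then show ?thesis unfolding rate_coeff_def
    by (simp add: sum_distrib_left sum.swap[of _ "margin_tables I J r \<alpha>"])
qed

text \<open>The total exponent is the same for every table, so the kernel factors come out of the
  sum over tables and leave their number.\<close>

lemma prod_prod_power_Suc:
  fixes c :: "'c :: comm_monoid_mult"
  assumes "finite I" "D \<in> margin_tables I J r \<alpha>"
  shows "(\<Prod>i\<in>I. \<Prod>j\<in>J. c ^ Suc (D i j)) = c ^ (sum r I + card I * card J)"
proof -
  have "D \<in> row_tables I J r" using assms(2) by (simp add: margin_tables_def)
  have "(\<Prod>j\<in>J. c ^ Suc (D i j)) = c ^ (r i + card J)" if "i \<in> I" for i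
  proof -
    have "(\<Prod>j\<in>J. c ^ Suc (D i j)) = c ^ (\<Sum>j\<in>J. D i j + 1)"
      unfolding Suc_eq_plus1 by (rule power_sum[symmetric])
    also have "(\<Sum>j\<in>J. D i j + 1) = r i + card J"
      unfolding sum.distrib using row_tables_sum[OF \<open>D \<in> row_tables I J r\<close> that] by simp
    finally show ?thesis .
  qed
  then have "(\<Prod>i\<in>I. \<Prod>j\<in>J. c ^ Suc (D i j)) = (\<Prod>i\<in>I. c ^ (r i + card J))" by (intro prod.cong) auto
  also have "\<dots> = c ^ (\<Sum>i\<in>I. r i + card J)" by (rule power_sum[symmetric])
  also have "(\<Sum>i\<in>I. r i + card J) = sum r I + card I * card J" unfolding sum.distrib by simp
  finally show ?thesis .
qed

lemma sum_prod_power_Suc: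
  fixes c :: "'c :: comm_semiring_1"
  assumes "finite I"
  shows "(\<Sum>D\<in>margin_tables I J r \<alpha>. \<Prod>i\<in>I. \<Prod>j\<in>J. c ^ Suc (D i j)) =
    of_nat (card (margin_tables I J r \<alpha>)) * c ^ (sum r I + card I * card J)"
  by (subst sum_constant[symmetric], intro sum.cong refl prod_prod_power_Suc assms)

text \<open>Monomials are log-linear in the exponent, so their geometric mean is the monomial at the
  mean exponent.\<close>

lemma prod_monomial_powr:
  fixes y :: "'b \<Rightarrow> real"
  assumes y: "\<And>j. j \<in> J \<Longrightarrow> y j > 0"
    and C: "\<And>j. j \<in> J \<Longrightarrow> (\<Sum>a\<in>A. w a * real (\<alpha> a j)) = real (C j)"
  shows "(\<Prod>a\<in>A. (\<Prod>j\<in>J. y j ^ \<alpha> a j) powr w a) = (\<Prod>j\<in>J. y j ^ C j)"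
proof -
  have "(\<Prod>a\<in>A. (\<Prod>j\<in>J. y j ^ \<alpha> a j) powr w a) = (\<Prod>a\<in>A. \<Prod>j\<in>J. y j powr (w a * real (\<alpha> a j)))"
  proof (intro prod.cong refl)
    fix a
    have "(\<Prod>j\<in>J. y j ^ \<alpha> a j) powr w a = (\<Prod>j\<in>J. (y j ^ \<alpha> a j) powr w a)"
      by (rule prod_powr_distrib)
    also have "\<dots> = (\<Prod>j\<in>J. y j powr (w a * real (\<alpha> a j)))"
      using y by (intro prod.cong refl) (simp add: powr_powr mult.commute flip: powr_realpow)
    finally show "(\<Prod>j\<in>J. y j ^ \<alpha> a j) powr w a = (\<Prod>j\<in>J. y j powr (w a * real (\<alpha> a j)))" .
  qed
  also have "\<dots> = (\<Prod>j\<in>J. \<Prod>a\<in>A. y j powr (w a * real (\<alpha> a j)))" by (rule prod.swap)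
  also have "\<dots> = (\<Prod>j\<in>J. y j ^ C j)"
  proof (intro prod.cong refl)
    fix j assume j: "j \<in> J"
    have "(\<Prod>a\<in>A. y j powr (w a * real (\<alpha> a j))) = y j powr (\<Sum>a\<in>A. w a * real (\<alpha> a j))"
      using y[OF j] by (intro powr_sum[symmetric]) auto
    then show "(\<Prod>a\<in>A. y j powr (w a * real (\<alpha> a j))) = y j ^ C j"
      using C[OF j] y[OF j] by (simp add: powr_realpow)
  qed
  finally show ?thesis .
qed

section \<open>Capacity of products of linear forms\<close>

text \<open>The capacity in the sense of Gurvits. Unlike the coefficient itself, it is evidently
  log-concave and monotone in the rates.\<close>

definition rate_cap :: "'a set \<Rightarrow> 'b set \<Rightarrow> ('a \<Rightarrow> nat) \<Rightarrow> ('a \<times> 'b \<Rightarrow> real) \<Rightarrow> ('b \<Rightarrow> nat) \<Rightarrow> real" where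
  "rate_cap I J r \<gamma> \<alpha> = (INF y\<in>{y. \<forall>j\<in>J. y j > 0}. rate_poly I J r \<gamma> y / (\<Prod>j\<in>J. y j ^ \<alpha> j))"

context
  fixes I :: "'a set" and J :: "'b set" and r :: "'a \<Rightarrow> nat"
  assumes fin: "finite I" "finite J"
begin

lemma rate_poly_nonneg:
  assumes "\<And>e. e \<in> I \<times> J \<Longrightarrow> \<gamma> e \<ge> 0" "\<And>j. j \<in> J \<Longrightarrow> y j > 0"
  shows "rate_poly I J r \<gamma> y \<ge> 0"
  unfolding rate_poly_def using assms
  by (intro prod_nonneg divide_nonneg_nonneg zero_le_power sum_nonneg mult_nonneg_nonneg ballI)
    (auto intro: less_imp_le)

lemma rate_cap_bounds:
  assumes "\<And>e. e \<in> I \<times> J \<Longrightarrow> \<gamma> e \<ge> 0"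
  shows rate_cap_nonneg: "rate_cap I J r \<gamma> \<alpha> \<ge> 0"
    and rate_cap_le: "(\<And>j. j \<in> J \<Longrightarrow> y j > 0) \<Longrightarrow> rate_cap I J r \<gamma> \<alpha> \<le> rate_poly I J r \<gamma> y / (\<Prod>j\<in>J. y j ^ \<alpha> j)"
proof -
  let ?Y = "{y. \<forall>j\<in>J. (y j :: real) > 0}"
  have nn: "rate_poly I J r \<gamma> y / (\<Prod>j\<in>J. y j ^ \<alpha> j) \<ge> 0" if "y \<in> ?Y" for y
    using that assms by (intro divide_nonneg_pos rate_poly_nonneg prod_pos) auto
  have ne: "?Y \<noteq> {}" by (auto intro!: exI[of _ "\<lambda>_. 1"])
  show "rate_cap I J r \<gamma> \<alpha> \<ge> 0" unfolding rate_cap_def using nn by (intro cINF_greatest ne)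
  show "rate_cap I J r \<gamma> \<alpha> \<le> rate_poly I J r \<gamma> y / (\<Prod>j\<in>J. y j ^ \<alpha> j)" if "\<And>j. j \<in> J \<Longrightarrow> y j > 0"
    unfolding rate_cap_def using nn that by (intro cINF_lower bdd_belowI[of _ 0]) auto
qed

lemma rate_coeff_nonneg:
  assumes "\<And>e. e \<in> I \<times> J \<Longrightarrow> \<gamma> e \<ge> 0"
  shows "rate_coeff I J r \<gamma> \<alpha> \<ge> 0"
  unfolding rate_coeff_def using assms by (intro sum_nonneg prod_nonneg ballI) auto

lemma rate_coeff_le_cap:
  assumes "\<And>e. e \<in> I \<times> J \<Longrightarrow> \<gamma> e \<ge> 0" "\<alpha> \<in> comps J (sum r I)"
  shows "rate_coeff I J r \<gamma> \<alpha> \<le> rate_cap I J r \<gamma> \<alpha>"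
  unfolding rate_cap_def
proof (rule cINF_greatest)
  show "{y. \<forall>j\<in>J. (y j :: real) > 0} \<noteq> {}" by (auto intro!: exI[of _ "\<lambda>_. 1"])
  fix y :: "'b \<Rightarrow> real" assume y: "y \<in> {y. \<forall>j\<in>J. y j > 0}"
  have "rate_coeff I J r \<gamma> \<alpha> * (\<Prod>j\<in>J. y j ^ \<alpha> j) \<le> rate_poly I J r \<gamma> y"
    unfolding rate_poly_expand[OF fin] using assms y fin
    by (intro member_le_sum mult_nonneg_nonneg rate_coeff_nonneg prod_nonneg) (auto intro: less_imp_le)
  then show "rate_coeff I J r \<gamma> \<alpha> \<le> rate_poly I J r \<gamma> y / (\<Prod>j\<in>J. y j ^ \<alpha> j)"
    using y by (subst pos_le_divide_eq) (auto intro!: prod_pos)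
qed

text \<open>Gurvits' bound, with \<open>B\<close> chosen as the capacity itself.\<close>

lemma rate_cap_le_coeff:
  assumes "\<And>e. e \<in> I \<times> J \<Longrightarrow> \<gamma> e \<ge> 0" "\<alpha> \<in> comps J (sum r I)"
  shows "rate_cap I J r \<gamma> \<alpha> \<le> (real (sum r I) + 1) ^ card J * rate_coeff I J r \<gamma> \<alpha>"
proof -
  have "rate_coeff I J r \<gamma> \<alpha> \<ge> rate_cap I J r \<gamma> \<alpha> / (real (sum r I) + 1) ^ card J"
  proof (rule rate_coeff_capacity[OF fin assms])
    fix y :: "'b \<Rightarrow> real" assume y: "\<And>j. j \<in> J \<Longrightarrow> y j > 0"
    then show "rate_cap I J r \<gamma> \<alpha> * (\<Prod>j\<in>J. y j ^ \<alpha> j) \<le> rate_poly I J r \<gamma> y"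
      using rate_cap_le[where \<alpha> = \<alpha> and y = y and \<gamma> = \<gamma>, OF assms(1)] by (subst pos_le_divide_eq[symmetric]) (auto intro!: prod_pos)
  qed (use rate_cap_nonneg assms in auto)
  moreover have "(real (sum r I) + 1) ^ card J > 0" by (intro zero_less_power) linarith
  ultimately show ?thesis by (simp only: pos_divide_le_eq mult.commute)
qed

text \<open>For fixed \<open>y\<close> the function under the infimum is log-concave in \<open>(\<gamma>, \<alpha>)\<close> jointly,
  hence so is the capacity.\<close>
lemma rate_cap_log_concave:
  assumes A: "finite A" "\<And>a. a \<in> A \<Longrightarrow> w a > 0" "sum w A = 1"
    and u: "\<And>a e. a \<in> A \<Longrightarrow> e \<in> I \<times> J \<Longrightarrow> u a e \<ge> 0"
    and \<gamma>: "\<And>e. e \<in> I \<times> J \<Longrightarrow> (\<Sum>a\<in>A. w a * u a e) \<le> \<gamma> e"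
    and C: "\<And>j. j \<in> J \<Longrightarrow> (\<Sum>a\<in>A. w a * real (\<alpha> a j)) = real (C j)"
  shows "(\<Prod>a\<in>A. rate_cap I J r (u a) (\<alpha> a) powr w a) \<le> rate_cap I J r \<gamma> C"
  unfolding rate_cap_def[of _ _ _ \<gamma>]
proof (rule cINF_greatest)
  show "{y. \<forall>j\<in>J. (y j :: real) > 0} \<noteq> {}" by (auto intro!: exI[of _ "\<lambda>_. 1"])
  fix y :: "'b \<Rightarrow> real" assume "y \<in> {y. \<forall>j\<in>J. y j > 0}"
  then have y: "y j > 0" if "j \<in> J" for j using that by auto
  define s where "s a i = (\<Sum>j\<in>J. u a (i, j) * y j)" for a i
  have s: "s a i \<ge> 0" if "a \<in> A" "i \<in> I" for a i
    unfolding s_def using that u y by (intro sum_nonneg mult_nonneg_nonneg) (auto intro: less_imp_le)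
  \<comment> \<open>For one row, the geometric mean of the linear forms is at most their arithmetic
    mean, which is at most the form with rates \<open>\<gamma>\<close>; the factorials agree since
    the weights sum to 1.\<close>
  have row: "(\<Prod>a\<in>A. (s a i ^ r i / fact (r i)) powr w a) \<le> (\<Sum>j\<in>J. \<gamma> (i, j) * y j) ^ r i / fact (r i)"
    if i: "i \<in> I" for i
  proof -
    have "(\<Prod>a\<in>A. (s a i ^ r i / fact (r i)) powr w a) = (\<Prod>a\<in>A. (s a i powr w a) ^ r i / fact (r i) powr w a)"
    proof (intro prod.cong refl)
      fix a assume a: "a \<in> A"
      have "(s a i ^ k) powr w a = (s a i powr w a) ^ k" for k
        using s[OF a i] by (induction k) (auto simp: powr_mult)
      then show "(s a i ^ r i / fact (r i)) powr w a = (s a i powr w a) ^ r i / fact (r i) powr w a"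
        using s[OF a i] by (simp add: powr_divide)
    qed
    also have "\<dots> = (\<Prod>a\<in>A. s a i powr w a) ^ r i / fact (r i)"
      using A(3) by (simp add: prod_dividef prod_power_distrib flip: powr_sum)
    also have "\<dots> \<le> (\<Sum>j\<in>J. \<gamma> (i, j) * y j) ^ r i / fact (r i)"
    proof (intro divide_right_mono power_mono)
      have "(\<Prod>a\<in>A. s a i powr w a) \<le> (\<Sum>a\<in>A. w a * s a i)"
        using A s i by (intro weighted_arith_geom_mean) auto
      also have "\<dots> = (\<Sum>j\<in>J. (\<Sum>a\<in>A. w a * u a (i, j)) * y j)"
        unfolding s_def sum_distrib_left sum_distrib_right by (subst sum.swap) (simp add: mult_ac)
      also have "\<dots> \<le> (\<Sum>j\<in>J. \<gamma> (i, j) * y j)"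
        using \<gamma> i y by (intro sum_mono mult_right_mono) (auto intro: less_imp_le)
      finally show "(\<Prod>a\<in>A. s a i powr w a) \<le> (\<Sum>j\<in>J. \<gamma> (i, j) * y j)" .
    qed (auto intro!: prod_nonneg)
    finally show ?thesis .
  qed
  have mon: "(\<Prod>a\<in>A. (\<Prod>j\<in>J. y j ^ \<alpha> a j) powr w a) = (\<Prod>j\<in>J. y j ^ C j)"
    by (rule prod_monomial_powr[OF y C])
  have "(\<Prod>a\<in>A. rate_cap I J r (u a) (\<alpha> a) powr w a) \<le>
    (\<Prod>a\<in>A. (rate_poly I J r (u a) y / (\<Prod>j\<in>J. y j ^ \<alpha> a j)) powr w a)"
    using A(2) u y by (intro prod_mono conjI powr_mono2 rate_cap_le rate_cap_nonneg) (auto intro: less_imp_le)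
  also have "\<dots> = (\<Prod>a\<in>A. rate_poly I J r (u a) y powr w a) / (\<Prod>a\<in>A. (\<Prod>j\<in>J. y j ^ \<alpha> a j) powr w a)"
    unfolding prod_dividef[symmetric] by (intro prod.cong refl powr_divide)
  also have "(\<Prod>a\<in>A. rate_poly I J r (u a) y powr w a) = (\<Prod>i\<in>I. \<Prod>a\<in>A. (s a i ^ r i / fact (r i)) powr w a)"
    unfolding rate_poly_def s_def[symmetric] prod_powr_distrib by (rule prod.swap)
  also have "\<dots> / (\<Prod>a\<in>A. (\<Prod>j\<in>J. y j ^ \<alpha> a j) powr w a) \<le> rate_poly I J r \<gamma> y / (\<Prod>j\<in>J. y j ^ C j)"
    unfolding mon rate_poly_def using row y
    by (intro divide_right_mono prod_mono conjI prod_nonneg) (auto intro: less_imp_le)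
  finally show "(\<Prod>a\<in>A. rate_cap I J r (u a) (\<alpha> a) powr w a) \<le> rate_poly I J r \<gamma> y / (\<Prod>j\<in>J. y j ^ C j)" .
qed

end

section \<open>A Jensen-type inequality for numbers of tables\<close>

text \<open>Discrete Prekopa-Leindler is applied to capacities weighted by \<open>\<Theta>\<close>.
  The two kernel bounds differ by \<open>\<theta> ^ (N + K)\<close>, and rounding the rates costs
  \<open>\<theta> ^ K\<close> twice, once in the weights and once in the capacity; together this is
  the exponent \<open>N + 3 * K\<close>.\<close>

lemma card_margin_tables_geometric_mean:
  fixes \<theta> :: real
  assumes fin: "finite I" "finite J" and \<theta>: "0 < \<theta>" "\<theta> < 1"
    and A: "finite A" "\<And>a. a \<in> A \<Longrightarrow> w a > 0" "sum w A = 1"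
    and \<alpha>: "A \<subseteq> comps J (sum r I)" and C: "C \<in> comps J (sum r I)"
    and mean: "\<And>j. j \<in> J \<Longrightarrow> (\<Sum>\<alpha>\<in>A. w \<alpha> * real (\<alpha> j)) = real (C j)"
  shows "\<theta> ^ (sum r I + 3 * (card I * card J)) * (\<Prod>\<alpha>\<in>A. real (card (margin_tables I J r \<alpha>)) powr w \<alpha>)
    \<le> (real (sum r I) + 1) ^ card J * real (card (margin_tables I J r C))"
proof -
  define N K where "N = sum r I" and "K = card I * card J"
  define f where "f \<alpha> = real (card (margin_tables I J r \<alpha>))" for \<alpha>
  define M where "M = (real N + 1) ^ card J"
  define \<Theta> where "\<Theta> \<gamma> = (\<Prod>e\<in>I \<times> J. \<theta> ^ \<gamma> e)" for \<gamma> :: "'a \<times> 'b \<Rightarrow> nat"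
  have \<Theta>_pos: "\<Theta> \<gamma> > 0" for \<gamma> unfolding \<Theta>_def using \<theta> by (intro prod_pos) auto
  have M_pos: "M > 0" unfolding M_def by (intro zero_less_power) linarith
  obtain L where L: "\<And>d. d \<le> N \<Longrightarrow> (\<Sum>k\<le>L. \<theta> ^ k * (real k ^ d / fact d)) \<ge> (\<theta> / (1 - \<theta>)) ^ Suc d"
    using kernel_sum_ge[OF \<theta>] by blast
  define \<Gamma> where "\<Gamma> = PiE (I \<times> J) (\<lambda>_. {..L})"
  define F where "F \<alpha> \<gamma> = \<Theta> \<gamma> * rate_cap I J r (\<lambda>e. real (\<gamma> e)) \<alpha>" for \<alpha> \<gamma>
  \<comment> \<open>A point \<open>\<zeta>\<close> within distance 1 of an average has weight
    exponent at most 1 per cell too large, whence the division by \<open>\<theta> ^ K\<close>, and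
    its rates plus 1 dominate the average, whence \<open>Suc\<close>.\<close>
  define h where "h \<zeta> = \<Theta> \<zeta> / \<theta> ^ K * rate_cap I J r (\<lambda>e. real (Suc (\<zeta> e))) C" for \<zeta>
  have lower: "(\<theta> / (1 - \<theta>)) ^ (N + K) * f a \<le> (\<Sum>\<gamma>\<in>\<Gamma>. F a \<gamma>)" if a: "a \<in> A" for a
  proof -
    have "(\<theta> / (1 - \<theta>)) ^ (N + K) * f a = (\<Sum>D\<in>margin_tables I J r a. \<Prod>i\<in>I. \<Prod>j\<in>J. (\<theta> / (1 - \<theta>)) ^ Suc (D i j))"
      unfolding f_def N_def K_def sum_prod_power_Suc[OF fin(1)] by (simp only: mult.commute)
    also have "\<dots> \<le> (\<Sum>D\<in>margin_tables I J r a. \<Prod>i\<in>I. \<Prod>j\<in>J. \<Sum>k\<le>L. \<theta> ^ k * (real k ^ D i j / fact (D i j)))"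
    proof (intro sum_mono prod_mono conjI)
      fix D i j assume D: "D \<in> margin_tables I J r a" and ij: "i \<in> I" "j \<in> J"
      have "D i j \<le> sum (D i) J" using ij fin by (intro member_le_sum) auto
      also have "\<dots> = r i" using D ij row_tables_sum by (auto simp: margin_tables_def)
      also have "\<dots> \<le> N" unfolding N_def using ij fin by (intro member_le_sum) auto
      finally show "(\<theta> / (1 - \<theta>)) ^ Suc (D i j) \<le> (\<Sum>k\<le>L. \<theta> ^ k * (real k ^ D i j / fact (D i j)))"
        by (rule L)
      show "(\<theta> / (1 - \<theta>)) ^ Suc (D i j) \<ge> 0" using \<theta> by (intro zero_le_power) auto
    next
      fix D i assume "i \<in> I"
      show "(\<Prod>j\<in>J. (\<theta> / (1 - \<theta>)) ^ Suc (D i j)) \<ge> 0"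
        using \<theta> by (intro prod_nonneg ballI zero_le_power) auto
    qed
    also have "\<dots> = (\<Sum>\<gamma>\<in>\<Gamma>. \<Theta> \<gamma> * rate_coeff I J r (\<lambda>e. real (\<gamma> e)) a)"
      unfolding \<Gamma>_def \<Theta>_def using sum_rate_coeff[OF fin, where p = "\<lambda>k. \<theta> ^ k" and q = real] by simp
    also have "\<dots> \<le> (\<Sum>\<gamma>\<in>\<Gamma>. F a \<gamma>)"
      unfolding F_def using a \<alpha> \<Theta>_pos fin
      by (intro sum_mono mult_left_mono rate_coeff_le_cap) (auto intro: less_imp_le)
    finally show ?thesis .
  qed
  have upper: "(\<Sum>\<zeta>\<in>\<Gamma>. h \<zeta>) \<le> M * f C * (1 / (1 - \<theta>)) ^ (N + K) / \<theta> ^ (2 * K)"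
  proof -
    \<comment> \<open>Aligning the weights with the rates raised by 1 costs another
      \<open>\<theta> ^ K\<close>; then \<open>kernel_sum_le\<close> applies cell by cell.\<close>
    have shift: "\<Theta> \<zeta> / \<theta> ^ K = (\<Prod>e\<in>I \<times> J. \<theta> ^ Suc (\<zeta> e)) / \<theta> ^ (2 * K)" for \<zeta>
      unfolding \<Theta>_def using \<theta> by (simp add: prod.distrib K_def mult_2 power_add card_cartesian_product)
    have "(\<Sum>\<zeta>\<in>\<Gamma>. h \<zeta>) \<le> (\<Sum>\<zeta>\<in>\<Gamma>. \<Theta> \<zeta> / \<theta> ^ K * (M * rate_coeff I J r (\<lambda>e. real (Suc (\<zeta> e))) C))"
      unfolding h_def M_def N_def using C \<Theta>_pos \<theta> fin
      by (intro sum_mono mult_left_mono rate_cap_le_coeff) (auto intro!: divide_nonneg_pos less_imp_le)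
    also have "\<dots> = M / \<theta> ^ (2 * K) * (\<Sum>\<zeta>\<in>\<Gamma>. (\<Prod>e\<in>I \<times> J. \<theta> ^ Suc (\<zeta> e)) * rate_coeff I J r (\<lambda>e. real (Suc (\<zeta> e))) C)"
      unfolding shift sum_distrib_left by (intro sum.cong refl) simp
    also have "(\<Sum>\<zeta>\<in>\<Gamma>. (\<Prod>e\<in>I \<times> J. \<theta> ^ Suc (\<zeta> e)) * rate_coeff I J r (\<lambda>e. real (Suc (\<zeta> e))) C) =
      (\<Sum>D\<in>margin_tables I J r C. \<Prod>i\<in>I. \<Prod>j\<in>J. \<Sum>k\<le>L. \<theta> ^ Suc k * (real (Suc k) ^ D i j / fact (D i j)))"
      unfolding \<Gamma>_def by (rule sum_rate_coeff[OF fin, where p = "\<lambda>k. \<theta> ^ Suc k" and q = "\<lambda>k. real (Suc k)"])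
    also have "M / \<theta> ^ (2 * K) * \<dots> \<le> M / \<theta> ^ (2 * K) *
      (\<Sum>D\<in>margin_tables I J r C. \<Prod>i\<in>I. \<Prod>j\<in>J. (1 / (1 - \<theta>)) ^ Suc (D i j))"
      using \<theta> M_pos
      by (intro mult_left_mono sum_mono prod_mono conjI kernel_sum_le prod_nonneg sum_nonneg ballI mult_nonneg_nonneg)
        (auto intro: less_imp_le)
    also have "(\<Sum>D\<in>margin_tables I J r C. \<Prod>i\<in>I. \<Prod>j\<in>J. (1 / (1 - \<theta>)) ^ Suc (D i j)) = f C * (1 / (1 - \<theta>)) ^ (N + K)"
      unfolding f_def N_def K_def sum_prod_power_Suc[OF fin(1)] by (simp only: mult.commute)
    finally show ?thesis by simp
  qed
  have "(\<Prod>a\<in>A. (\<Sum>\<gamma>\<in>\<Gamma>. F a \<gamma>) powr w a) \<le> (\<Sum>\<zeta>\<in>\<Gamma>. h \<zeta>)"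
    unfolding \<Gamma>_def
  proof (rule discrete_prekopa_leindler[OF A])
    show "finite (I \<times> J)" using fin by simp
    show "F a \<gamma> \<ge> 0" for a \<gamma> unfolding F_def
      using \<Theta>_pos fin by (intro mult_nonneg_nonneg rate_cap_nonneg) (auto intro: less_imp_le)
    show "h \<zeta> \<ge> 0" for \<zeta> unfolding h_def
      using \<Theta>_pos fin \<theta> by (intro mult_nonneg_nonneg rate_cap_nonneg divide_nonneg_pos) (auto intro: less_imp_le)
    fix u \<zeta> assume near: "\<And>e. e \<in> I \<times> J \<Longrightarrow> \<bar>real (\<zeta> e) - (\<Sum>a\<in>A. w a * real (u a e))\<bar> < 1"
    have "(\<Prod>a\<in>A. F a (u a) powr w a) =
      (\<Prod>a\<in>A. \<Theta> (u a) powr w a) * (\<Prod>a\<in>A. rate_cap I J r (\<lambda>e. real (u a e)) a powr w a)"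
      unfolding F_def powr_mult prod.distrib ..
    also have "\<dots> \<le> \<Theta> \<zeta> / \<theta> ^ K * rate_cap I J r (\<lambda>e. real (Suc (\<zeta> e))) C"
    proof (intro mult_mono)
      show "(\<Prod>a\<in>A. rate_cap I J r (\<lambda>e. real (u a e)) a powr w a) \<le> rate_cap I J r (\<lambda>e. real (Suc (\<zeta> e))) C"
      proof (rule rate_cap_log_concave[OF fin A])
        fix e assume "e \<in> I \<times> J"
        then show "(\<Sum>a\<in>A. w a * real (u a e)) \<le> real (Suc (\<zeta> e))" using near[of e] by linarith
      qed (use mean in auto)
      have \<Theta>_powr: "\<Theta> \<gamma> = \<theta> powr (\<Sum>e\<in>I \<times> J. real (\<gamma> e))" for \<gamma>
        unfolding \<Theta>_def using \<theta> by (subst powr_sum) (auto simp: powr_realpow)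
      have "(\<Prod>a\<in>A. \<Theta> (u a) powr w a) = (\<Prod>a\<in>A. \<theta> powr (w a * (\<Sum>e\<in>I \<times> J. real (u a e))))"
        unfolding \<Theta>_powr powr_powr by (simp add: mult.commute)
      also have "\<dots> = \<theta> powr (\<Sum>a\<in>A. w a * (\<Sum>e\<in>I \<times> J. real (u a e)))"
        using \<theta> by (intro powr_sum[symmetric]) auto
      also have "(\<Sum>a\<in>A. w a * (\<Sum>e\<in>I \<times> J. real (u a e))) = (\<Sum>e\<in>I \<times> J. \<Sum>a\<in>A. w a * real (u a e))"
        unfolding sum_distrib_left by (rule sum.swap)
      \<comment> \<open>Since \<open>\<theta> < 1\<close>, a lower bound on the averaged exponent is
        an upper bound on the weight.\<close>
      also have "\<theta> powr \<dots> \<le> \<theta> powr (\<Sum>e\<in>I \<times> J. real (\<zeta> e) - 1)"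
      proof (intro powr_mono' sum_mono)
        fix e assume "e \<in> I \<times> J"
        then show "real (\<zeta> e) - 1 \<le> (\<Sum>a\<in>A. w a * real (u a e))" using near[of e] by linarith
      qed (use \<theta> in auto)
      also have "(\<Sum>e\<in>I \<times> J. real (\<zeta> e) - 1) = (\<Sum>e\<in>I \<times> J. real (\<zeta> e)) - real K"
        unfolding sum_subtractf by (simp add: K_def card_cartesian_product)
      also have "\<theta> powr \<dots> = \<Theta> \<zeta> / \<theta> ^ K"
        unfolding powr_diff \<Theta>_powr using \<theta> by (simp add: powr_realpow)
      finally show "(\<Prod>a\<in>A. \<Theta> (u a) powr w a) \<le> \<Theta> \<zeta> / \<theta> ^ K" .
    next
      show "\<Theta> \<zeta> / \<theta> ^ K \<ge> 0" using \<Theta>_pos[of \<zeta>] \<theta> by simp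
    qed (simp add: prod_nonneg)
    finally show "(\<Prod>a\<in>A. F a (u a) powr w a) \<le> h \<zeta>" unfolding h_def .
  qed
  note this
  moreover have "(\<Prod>a\<in>A. ((\<theta> / (1 - \<theta>)) ^ (N + K) * f a) powr w a) \<le> (\<Prod>a\<in>A. (\<Sum>\<gamma>\<in>\<Gamma>. F a \<gamma>) powr w a)"
    using lower A(2) \<theta>
    by (intro prod_mono conjI powr_mono2 mult_nonneg_nonneg zero_le_power) (auto simp: f_def less_imp_le)
  moreover have "(\<Prod>a\<in>A. ((\<theta> / (1 - \<theta>)) ^ (N + K) * f a) powr w a) = (\<theta> / (1 - \<theta>)) ^ (N + K) * (\<Prod>a\<in>A. f a powr w a)"
  proof -
    have pos: "(\<theta> / (1 - \<theta>)) ^ (N + K) > 0" using \<theta> by (intro zero_less_power) auto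
    have "(\<Prod>a\<in>A. ((\<theta> / (1 - \<theta>)) ^ (N + K)) powr w a) = ((\<theta> / (1 - \<theta>)) ^ (N + K)) powr sum w A"
      by (intro powr_sum[symmetric] pos[THEN less_imp_neq, THEN not_sym])
    also have "\<dots> = (\<theta> / (1 - \<theta>)) ^ (N + K)" using A(3) pos by simp
    finally show ?thesis unfolding powr_mult prod.distrib by simp
  qed
  ultimately have "(\<theta> / (1 - \<theta>)) ^ (N + K) * (\<Prod>a\<in>A. f a powr w a) \<le> M * f C * (1 / (1 - \<theta>)) ^ (N + K) / \<theta> ^ (2 * K)"
    using upper by linarith
  also have "\<dots> = (1 / (1 - \<theta>)) ^ (N + K) * (M * f C / \<theta> ^ (2 * K))" by simp
  finally have "(1 / (1 - \<theta>)) ^ (N + K) * (\<theta> ^ (N + K) * (\<Prod>a\<in>A. f a powr w a)) \<le> (1 / (1 - \<theta>)) ^ (N + K) * (M * f C / \<theta> ^ (2 * K))"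
    by (simp add: power_divide)
  moreover have "(1 / (1 - \<theta>)) ^ (N + K) > 0" using \<theta> by (intro zero_less_power) auto
  ultimately have "\<theta> ^ (N + K) * (\<Prod>a\<in>A. f a powr w a) \<le> M * f C / \<theta> ^ (2 * K)"
    by (simp only: mult_le_cancel_left_pos)
  moreover have "\<theta> ^ (2 * K) > 0" using \<theta> by simp
  ultimately have "\<theta> ^ (N + K) * (\<Prod>a\<in>A. f a powr w a) * \<theta> ^ (2 * K) \<le> M * f C"
    by (simp only: pos_le_divide_eq)
  moreover have "\<theta> ^ (N + 3 * K) = \<theta> ^ (N + K) * \<theta> ^ (2 * K)"
    unfolding power_add[symmetric] by (rule arg_cong[of _ _ "\<lambda>k. \<theta> ^ k"]) simp
  ultimately show ?thesis unfolding f_def M_def N_def K_def by (simp only: mult_ac)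
qed

section \<open>The generating function of tables with given row sums\<close>

text \<open>With the value 0 prescribed outside \<open>K\<close>, the box is a product of compact
  sets, so Tychonoff applies. Minima over functions on index sets are thus attained without a type
  for the dimension.\<close>

lemma compact_box_fun:
  fixes a b :: real and K :: "'k set"
  shows "compact {f :: 'k \<Rightarrow> real. (\<forall>k\<in>K. a \<le> f k \<and> f k \<le> b) \<and> (\<forall>k. k \<notin> K \<longrightarrow> f k = 0)}"
proof -
  have "compactin (product_topology (\<lambda>_::'k. euclideanreal) UNIV) (PiE UNIV (\<lambda>k. if k \<in> K then {a..b} else {0}))"
    by (subst compactin_PiE) auto
  moreover have "PiE UNIV (\<lambda>k. if k \<in> K then {a..b} else {0}) =
    {f. (\<forall>k\<in>K. a \<le> f k \<and> f k \<le> b) \<and> (\<forall>k. k \<notin> K \<longrightarrow> f k = 0)}"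
    by (auto simp: PiE_def Pi_def split: if_splits)
  ultimately show ?thesis by (simp add: euclidean_product_topology)
qed

definition row_gen :: "'a set \<Rightarrow> 'b set \<Rightarrow> ('a \<Rightarrow> nat) \<Rightarrow> ('b \<Rightarrow> real) \<Rightarrow> real" where
  "row_gen I J r y = (\<Prod>i\<in>I. \<Sum>d\<in>comps J (r i). \<Prod>j\<in>J. y j ^ d j)"

lemma row_gen_expand:
  assumes "finite I" "finite J"
  shows "row_gen I J r y = (\<Sum>\<alpha>\<in>comps J (sum r I). real (card (margin_tables I J r \<alpha>)) * (\<Prod>j\<in>J. y j ^ \<alpha> j))"
  unfolding row_gen_def using prod_row_sums[OF assms, where c = "\<lambda>_ _ _. 1" and y = y and r = r] by simp

lemma row_gen_scale:
  assumes "finite I" "finite J"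
  shows "row_gen I J r (\<lambda>j. s * y j) = s ^ sum r I * row_gen I J r y"
proof -
  have "(\<Prod>j\<in>J. (s * y j) ^ \<alpha> j) = s ^ sum r I * (\<Prod>j\<in>J. y j ^ \<alpha> j)" if "\<alpha> \<in> comps J (sum r I)" for \<alpha>
    using that by (simp add: power_mult_distrib prod.distrib comps_def flip: power_sum)
  then show ?thesis unfolding row_gen_expand[OF assms] sum_distrib_left
    by (intro sum.cong) (auto simp: mult_ac)
qed

lemma prod_power_scale:
  fixes s :: "'c :: comm_semiring_1"
  shows "C \<in> comps J N \<Longrightarrow> (\<Prod>j\<in>J. (s * y j) ^ C j) = s ^ N * (\<Prod>j\<in>J. y j ^ C j)"
  by (simp add: power_mult_distrib prod.distrib comps_def flip: power_sum)

text \<open>The table with all its mass in column \<open>j\<close> contributes this monomial, and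
  all other terms are nonnegative.\<close>

lemma row_gen_ge_power:
  assumes "finite I" "finite J" "j \<in> J" "\<And>j. j \<in> J \<Longrightarrow> y j > 0"
  shows "row_gen I J r y \<ge> y j ^ sum r I"
proof -
  define \<alpha> where "\<alpha> = (\<lambda>j'\<in>J. if j' = j then sum r I else 0)"
  have \<alpha>: "\<alpha> \<in> comps J (sum r I)" unfolding \<alpha>_def using assms(2,3) by (intro comps_memI) auto
  have "card (margin_tables I J r \<alpha>) \<ge> 1"
    using margin_tables_nonempty[OF assms(1,2) \<alpha>] assms(1,2) by (simp add: Suc_le_eq card_gt_0_iff)
  moreover have "(\<Prod>j'\<in>J. y j' ^ \<alpha> j') = y j ^ sum r I"
  proof -
    have "(\<Prod>j'\<in>J. y j' ^ \<alpha> j') = (\<Prod>j'\<in>J. if j' = j then y j ^ sum r I else 1)"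
      by (intro prod.cong) (auto simp: \<alpha>_def)
    then show ?thesis using assms(2,3) by simp
  qed
  moreover have "y j ^ sum r I \<ge> 0" using assms(3,4) by (simp add: less_imp_le)
  ultimately have "y j ^ sum r I \<le> real (card (margin_tables I J r \<alpha>)) * (\<Prod>j\<in>J. y j ^ \<alpha> j)"
    using mult_right_mono[of 1 "real (card (margin_tables I J r \<alpha>))" "y j ^ sum r I"] by simp
  also have "\<dots> \<le> row_gen I J r y"
    unfolding row_gen_expand[OF assms(1,2)] using assms(2,4) \<alpha>
    by (intro member_le_sum mult_nonneg_nonneg prod_nonneg ballI) (auto intro: less_imp_le)
  finally show ?thesis .
qed

text \<open>The quotient is invariant under scaling of \<open>y\<close>, so the largest coordinate
  may be taken as 1, which makes \<open>row_gen\<close> at least 1. A quotient not above its value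
  \<open>M\<close> at the all-ones point then forces every coordinate to be at least
  \<open>1 / M\<close>, and compactness gives the minimum.\<close>

lemma row_gen_minimizer:
  assumes fin: "finite I" "finite J" and "J \<noteq> {}"
    and C: "C \<in> comps J (sum r I)" and Cpos: "\<And>j. j \<in> J \<Longrightarrow> C j > 0"
  obtains y where "\<And>j. j \<in> J \<Longrightarrow> y j > 0"
    and "\<And>y'. (\<And>j. j \<in> J \<Longrightarrow> y' j > 0) \<Longrightarrow>
      row_gen I J r y / (\<Prod>j\<in>J. y j ^ C j) \<le> row_gen I J r y' / (\<Prod>j\<in>J. y' j ^ C j)"
proof -
  define g where "g y = row_gen I J r y / (\<Prod>j\<in>J. y j ^ C j)" for y
  define M where "M = g (\<lambda>_. 1)"
  define S where "S = {f :: 'b \<Rightarrow> real. (\<forall>k\<in>J. 1 / M \<le> f k \<and> f k \<le> 1) \<and> (\<forall>k. k \<notin> J \<longrightarrow> f k = 0)}"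
  obtain j0 where "j0 \<in> J" using \<open>J \<noteq> {}\<close> by auto
  then have M1: "M \<ge> 1" unfolding M_def g_def using row_gen_ge_power[OF fin, of j0 "\<lambda>_. 1" r] by simp
  have Spos: "f j > 0" if "f \<in> S" "j \<in> J" for f j
  proof -
    have "1 / M > 0" using M1 by simp
    moreover have "1 / M \<le> f j" using that by (simp add: S_def)
    ultimately show ?thesis by linarith
  qed
  have coord: "continuous_on S (\<lambda>f. f j)" for j
    by (rule continuous_on_subset[OF continuous_on_product_coordinates]) auto
  have "(\<Prod>j\<in>J. f j ^ C j) \<noteq> 0" if "f \<in> S" for f
    by (rule less_imp_neq[THEN not_sym]) (intro prod_pos zero_less_power Spos that ballI)
  then have "continuous_on S g"
    unfolding g_def row_gen_def by (intro continuous_intros coord) auto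
  moreover have "compact S" unfolding S_def by (rule compact_box_fun)
  moreover have "(\<lambda>j. if j \<in> J then 1 else 0) \<in> S" using M1 by (auto simp: S_def)
  ultimately obtain y where y: "y \<in> S" "\<And>y'. y' \<in> S \<Longrightarrow> g y \<le> g y'"
    using continuous_attains_inf[of S g] by blast
  have g_cong: "g y1 = g y2" if "\<And>j. j \<in> J \<Longrightarrow> y1 j = y2 j" for y1 y2
  proof -
    have "row_gen I J r y1 = row_gen I J r y2"
      unfolding row_gen_def using that by (intro prod.cong sum.cong refl) auto
    moreover have "(\<Prod>j\<in>J. y1 j ^ C j) = (\<Prod>j\<in>J. y2 j ^ C j)" using that by (intro prod.cong) auto
    ultimately show ?thesis by (simp add: g_def)
  qed
  have g_scale: "g (\<lambda>j. s * y j) = g y" if "s > 0" for s y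
    using that unfolding g_def row_gen_scale[OF fin] prod_power_scale[OF C] by simp
  have "g y \<le> g y'" if y': "\<And>j. j \<in> J \<Longrightarrow> y' j > 0" for y'
  proof (cases "g y' \<le> M")
    case False
    have "g y \<le> g (\<lambda>j. if j \<in> J then 1 else 0)" using y M1 by (auto simp: S_def)
    also have "\<dots> = M" unfolding M_def by (rule g_cong) simp
    finally show ?thesis using False by linarith
  next
    case True
    define s where "s = Max (y' ` J)"
    have "s \<in> y' ` J" unfolding s_def using fin \<open>J \<noteq> {}\<close> by (intro Max_in) auto
    then obtain j1 where j1: "j1 \<in> J" "y' j1 = s" by auto
    have s: "s > 0" using j1 y' by auto
    have le_s: "y' j \<le> s" if "j \<in> J" for j unfolding s_def using fin that by simp
    define y2 where "y2 j = (if j \<in> J then y' j / s else 0)" for j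
    have eq: "g y2 = g y'"
    proof -
      have "g y2 = g (\<lambda>j. 1 / s * y' j)" by (rule g_cong) (simp add: y2_def)
      also have "\<dots> = g y'" using s by (intro g_scale) simp
      finally show ?thesis .
    qed
    have y2: "0 < y2 j" "y2 j \<le> 1" if "j \<in> J" for j using that y' s le_s by (auto simp: y2_def)
    have "1 / M \<le> y2 j" if j: "j \<in> J" for j
    proof -
      have "y2 j1 = 1" using j1 s by (simp add: y2_def)
      then have 1: "row_gen I J r y2 \<ge> 1" using row_gen_ge_power[OF fin j1(1), of y2 r] y2 by simp
      have "(\<Prod>j\<in>J. y2 j ^ C j) = y2 j ^ C j * (\<Prod>j\<in>J - {j}. y2 j ^ C j)"
        using fin j by (simp add: prod.remove)
      \<comment> \<open>The other coordinates are at most 1, so the monomial is at most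
        \<open>y2 j ^ C j\<close>, and \<open>C j \<ge> 1\<close> reduces this to
        \<open>y2 j\<close>.\<close>
      also have "\<dots> \<le> y2 j ^ C j * 1"
        using y2 j by (intro mult_left_mono prod_le_1 conjI power_le_one) (auto intro: less_imp_le)
      also have "\<dots> \<le> y2 j ^ 1"
        using y2[OF j] Cpos[OF j] by (simp only: mult_1_right) (intro power_decreasing, auto)
      finally have 2: "(\<Prod>j\<in>J. y2 j ^ C j) \<le> y2 j" by simp
      have 3: "(\<Prod>j\<in>J. y2 j ^ C j) > 0" using y2 by (intro prod_pos) auto
      have "1 / y2 j \<le> 1 / (\<Prod>j\<in>J. y2 j ^ C j)" using 2 3 by (intro divide_left_mono) auto
      also have "\<dots> \<le> g y2" unfolding g_def using 1 3 by (intro divide_right_mono) auto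
      also have "\<dots> \<le> M" using eq True by simp
      finally show ?thesis using y2[OF j] M1 by (simp add: field_simps)
    qed
    then have "y2 \<in> S" using y2 by (auto simp: S_def y2_def)
    then show ?thesis using y(2)[of y2] eq by simp
  qed
  then show ?thesis using that[of y] Spos[OF y(1)] unfolding g_def by blast
qed

text \<open>The first-order condition at the minimum in the direction that multiplies
  \<open>y j\<close> by \<open>t\<close>: it says that the normalized weights have mean
  \<open>C\<close>.\<close>

lemma row_gen_minimizer_mean:
  assumes fin: "finite I" "finite J" and C: "C \<in> comps J (sum r I)"
    and y: "\<And>j. j \<in> J \<Longrightarrow> y j > 0"
    and min: "\<And>y'. (\<And>j. j \<in> J \<Longrightarrow> y' j > 0) \<Longrightarrow>
      row_gen I J r y / (\<Prod>j\<in>J. y j ^ C j) \<le> row_gen I J r y' / (\<Prod>j\<in>J. y' j ^ C j)"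
    and j: "j \<in> J"
  shows "(\<Sum>\<alpha>\<in>comps J (sum r I). real (card (margin_tables I J r \<alpha>)) * (\<Prod>j\<in>J. y j ^ \<alpha> j) * real (\<alpha> j)) =
    real (C j) * row_gen I J r y"
proof -
  define b where "b \<alpha> = real (card (margin_tables I J r \<alpha>)) * (\<Prod>j\<in>J. y j ^ \<alpha> j)" for \<alpha>
  define p where "p t = (\<Sum>\<alpha>\<in>comps J (sum r I). b \<alpha> * t ^ \<alpha> j)" for t :: real
  have upd: "(\<Prod>j'\<in>J. (y(j := t * y j)) j' ^ \<alpha> j') = t ^ \<alpha> j * (\<Prod>j\<in>J. y j ^ \<alpha> j)" for t \<alpha>
  proof -
    have "(\<Prod>j'\<in>J - {j}. (y(j := t * y j)) j' ^ \<alpha> j') = (\<Prod>j'\<in>J - {j}. y j' ^ \<alpha> j')"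
      by (intro prod.cong) auto
    then show ?thesis using fin j by (simp add: prod.remove[of J j] power_mult_distrib)
  qed
  have gen: "row_gen I J r (y(j := t * y j)) = p t" for t
    unfolding row_gen_expand[OF fin] upd p_def b_def by (intro sum.cong refl) simp
  have p1: "row_gen I J r y = p 1" using gen[of 1] by simp
  have Cy: "(\<Prod>j\<in>J. y j ^ C j) > 0" using y by (intro prod_pos) auto
  have le: "p 1 * t ^ C j \<le> p t" if "t > 0" for t
  proof -
    have "row_gen I J r y / (\<Prod>j\<in>J. y j ^ C j) \<le>
        row_gen I J r (y(j := t * y j)) / (\<Prod>j'\<in>J. (y(j := t * y j)) j' ^ C j')"
      using y that j by (intro min) auto
    then have "p 1 / (\<Prod>j\<in>J. y j ^ C j) \<le> p t / (t ^ C j * (\<Prod>j\<in>J. y j ^ C j))"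
      unfolding gen p1 upd .
    then show ?thesis using Cy that by (simp add: field_simps)
  qed
  \<comment> \<open>Clearing the denominator turns minimality of the quotient into a local minimum
    of the polynomial \<open>q\<close> at 1, whose derivative is the claimed difference.\<close>
  define q where "q t = p t - p 1 * t ^ C j" for t
  have deriv: "(q has_real_derivative (\<Sum>\<alpha>\<in>comps J (sum r I). b \<alpha> * real (\<alpha> j)) - p 1 * real (C j)) (at 1)"
    unfolding q_def p_def by (auto intro!: derivative_eq_intros sum.cong)
  have "\<forall>t. \<bar>1 - t\<bar> < 1 \<longrightarrow> q 1 \<le> q t" using le by (auto simp: q_def)
  from DERIV_local_min[OF deriv _ this]
  have "(\<Sum>\<alpha>\<in>comps J (sum r I). b \<alpha> * real (\<alpha> j)) - p 1 * real (C j) = 0" by simp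
  then show ?thesis unfolding p1 b_def by (simp add: mult_ac)
qed

section \<open>Log-concavity of complete homogeneous polynomials and the choice of the row
  variables\<close>

definition complete_hom :: "'b set \<Rightarrow> nat \<Rightarrow> ('b \<Rightarrow> real) \<Rightarrow> real" where
  "complete_hom J k y = (\<Sum>d\<in>comps J k. \<Prod>j\<in>J. y j ^ d j)"

lemma row_gen_complete_hom: "row_gen I J r y = (\<Prod>i\<in>I. complete_hom J (r i) y)"
  by (simp add: row_gen_def complete_hom_def)

lemma complete_hom_ge_power:
  assumes "finite J" "j \<in> J" "\<And>j. j \<in> J \<Longrightarrow> y j > 0"
  shows "y j ^ k \<le> complete_hom J k y"
  using row_gen_ge_power[of "{()}" J j y "\<lambda>_. k"] assms by (simp add: row_gen_complete_hom)

text \<open>Neighbouring inequalities are multiplied along \<open>e\<close> steps; positivity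
  permits cancelling the common factors.\<close>

lemma log_conc_shift:
  assumes "log_conc a" "\<And>k. a k > 0" "l \<le> p"
  shows "a l * a (p + e) \<le> a p * a (l + e)"
proof (induction e)
  case (Suc e)
  have "(a l * a (p + e)) * (a (l + e) * a (Suc (p + e))) \<le> (a p * a (l + e)) * (a (Suc (l + e)) * a (p + e))"
  proof (rule mult_mono)
    show "a (l + e) * a (Suc (p + e)) \<le> a (Suc (l + e)) * a (p + e)"
      using log_concD[OF assms(1), of "l + e" "p + e"] assms(3) by simp
  qed (use Suc assms(2) in \<open>auto simp: less_imp_le\<close>)
  then have "(a (p + e) * a (l + e)) * (a l * a (Suc (p + e))) \<le> (a (p + e) * a (l + e)) * (a p * a (Suc (l + e)))"
    by (simp only: mult_ac)
  then show ?case using assms(2) by (simp add: mult_le_cancel_left_pos)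
qed (simp add: mult.commute)

text \<open>Because \<open>b (Suc k) = a (Suc k) + y * b k\<close>, the terms with
  \<open>b i * b j\<close> cancel. What remains is
  \<open>a (Suc j) * b i \<le> a (Suc i) * b j\<close>, which follows termwise from
  \<open>log_conc_shift\<close> after moving the summation index by \<open>j - i\<close>.\<close>

lemma log_conc_convolve_geometric:
  assumes "log_conc a" "\<And>k. a k > 0" "y > 0" and b: "\<And>k. b k = (\<Sum>l\<le>k. y ^ l * a (k - l))"
  shows "log_conc b"
  unfolding log_conc_def
proof (intro conjI allI impI)
  have bpos: "b i \<ge> 0" for i unfolding b using assms(2,3) by (intro sum_nonneg) (simp add: less_imp_le)
  then show "0 \<le> b i" for i .
  have b': "b k = (\<Sum>l\<le>k. a l * y ^ (k - l))" for k
    unfolding b by (rule sum.reindex_bij_witness[of _ "\<lambda>l. k - l" "\<lambda>l. k - l"]) auto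
  have bSuc: "b (Suc k) = a (Suc k) + y * b k" for k
    unfolding b sum.atMost_Suc_shift sum_distrib_left by (simp add: mult_ac)
  fix i j :: nat assume ij: "i < j"
  have "a (Suc j) * b i = (\<Sum>l\<le>i. (a l * a (Suc i + (j - i))) * y ^ (i - l))"
    unfolding b' sum_distrib_left using ij by (intro sum.cong) (auto simp: mult_ac)
  also have "\<dots> \<le> (\<Sum>l\<le>i. (a (Suc i) * a (l + (j - i))) * y ^ (i - l))"
    using assms(3) by (intro sum_mono mult_right_mono log_conc_shift[OF assms(1,2)]) auto
  also have "\<dots> = (\<Sum>l\<in>(\<lambda>l. l + (j - i)) ` {..i}. a (Suc i) * (a l * y ^ (j - l)))"
    using ij by (subst sum.reindex) (auto intro!: sum.cong simp: mult_ac inj_on_def)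
  also have "\<dots> \<le> (\<Sum>l\<le>j. a (Suc i) * (a l * y ^ (j - l)))"
    using assms(2,3) ij by (intro sum_mono2) (auto simp: less_imp_le)
  also have "\<dots> = a (Suc i) * b j" unfolding b' sum_distrib_left ..
  finally show "b i * b (Suc j) \<le> b (Suc i) * b j"
    unfolding bSuc by (simp add: algebra_simps)
qed

lemma complete_hom_insert:
  assumes "finite J" "v \<notin> J"
  shows "complete_hom (insert v J) k y = (\<Sum>l\<le>k. y v ^ l * complete_hom J (k - l) y)"
  unfolding complete_hom_def sum_comps_insert[OF assms] sum_distrib_left
proof (intro sum.cong refl)
  fix l d
  have "(\<Prod>j\<in>J. y j ^ (d(v := l)) j) = (\<Prod>j\<in>J. y j ^ d j)"
    using assms by (intro prod.cong) auto
  then show "(\<Prod>j\<in>insert v J. y j ^ (d(v := l)) j) = y v ^ l * (\<Prod>j\<in>J. y j ^ d j)"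
    using assms by simp
qed

lemma complete_hom_pos:
  assumes "finite J" "J \<noteq> {}" "\<And>j. j \<in> J \<Longrightarrow> y j > 0"
  shows "complete_hom J k y > 0"
  unfolding complete_hom_def using assms comps_nonempty by (intro sum_pos prod_pos) auto

text \<open>Adding a variable convolves the sequence with the geometric sequence of that
  variable.\<close>

lemma log_conc_complete_hom:
  assumes "finite J" "J \<noteq> {}" "\<And>j. j \<in> J \<Longrightarrow> y j > 0"
  shows "log_conc (\<lambda>k. complete_hom J k y)"
  using assms
proof (induction J rule: finite_ne_induct)
  case (singleton v)
  have "complete_hom {} k y = (if k = 0 then 1 else 0)" for k by (simp add: complete_hom_def comps_empty)
  then have "(\<Sum>l\<le>k. y v ^ l * complete_hom {} (k - l) y) = (\<Sum>l\<le>k. if l = k then y v ^ k else 0)" for k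
    by (intro sum.cong) auto
  then have "complete_hom {v} k y = y v ^ k" for k
    using complete_hom_insert[of "{}" v k y] by simp
  then show ?case using singleton.prems by (simp add: log_conc_def less_imp_le)
next
  case (insert v J)
  show ?case
  proof (rule log_conc_convolve_geometric)
    show "log_conc (\<lambda>k. complete_hom J k y)" using insert.IH insert.prems by simp
    show "complete_hom J k y > 0" for k using insert.hyps insert.prems by (intro complete_hom_pos) auto
    show "y v > 0" using insert.prems by simp
    show "complete_hom (insert v J) k y = (\<Sum>l\<le>k. y v ^ l * complete_hom J (k - l) y)" for k
      using insert.hyps by (intro complete_hom_insert)
  qed
qed

text \<open>A finite form of the identity between the product of the \<open>1 / (1 - z j)\<close>
  and the sum of all complete homogeneous polynomials: the truncated product contains every monomial
  of degree \<open>M\<close> and none of degree above \<open>card J * M\<close>.\<close>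

lemma prod_geometric_partial_sums:
  fixes z :: "'b \<Rightarrow> real"
  assumes "finite J" "\<And>j. j \<in> J \<Longrightarrow> z j \<ge> 0"
  shows "(\<Prod>j\<in>J. \<Sum>d\<le>M. z j ^ d) \<le> (\<Sum>k\<le>card J * M. complete_hom J k z)"
    and "complete_hom J M z \<le> (\<Prod>j\<in>J. \<Sum>d\<le>M. z j ^ d)"
proof -
  have eq: "(\<Prod>j\<in>J. \<Sum>d\<le>M. z j ^ d) = (\<Sum>d\<in>PiE J (\<lambda>_. {..M}). \<Prod>j\<in>J. z j ^ d j)"
    using assms(1) by (intro prod_sum_PiE) auto
  show "complete_hom J M z \<le> (\<Prod>j\<in>J. \<Sum>d\<le>M. z j ^ d)"
    unfolding eq complete_hom_def using assms
    by (intro sum_mono2 finite_PiE prod_nonneg ballI zero_le_power) (auto simp: comps_def)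
  have "PiE J (\<lambda>_. {..M}) \<subseteq> (\<Union>k\<le>card J * M. comps J k)"
  proof
    fix d assume d: "d \<in> PiE J (\<lambda>_. {..M})"
    then have "sum d J \<le> card J * M" using sum_bounded_above[of J d M] by (auto simp: PiE_def Pi_def)
    moreover have "d \<in> comps J (sum d J)" using d assms(1) by (intro comps_memI) (auto simp: PiE_def)
    ultimately show "d \<in> (\<Union>k\<le>card J * M. comps J k)" by blast
  qed
  then have "(\<Prod>j\<in>J. \<Sum>d\<le>M. z j ^ d) \<le> (\<Sum>d\<in>(\<Union>k\<le>card J * M. comps J k). \<Prod>j\<in>J. z j ^ d j)"
    unfolding eq using assms by (intro sum_mono2 prod_nonneg ballI zero_le_power) auto
  also have "\<dots> = (\<Sum>k\<le>card J * M. complete_hom J k z)"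
    unfolding complete_hom_def using assms(1)
    by (intro sum.UNION_disjoint ballI impI finite_comps) (auto simp: comps_def)
  finally show "(\<Prod>j\<in>J. \<Sum>d\<le>M. z j ^ d) \<le> (\<Sum>k\<le>card J * M. complete_hom J k z)" .
qed

lemma complete_hom_scale: "complete_hom J k (\<lambda>j. x * y j) = x ^ k * complete_hom J k y"
  unfolding complete_hom_def sum_distrib_left by (intro sum.cong refl prod_power_scale)

lemma prod_geometric_tendsto:
  fixes z :: "'b \<Rightarrow> real"
  assumes "\<And>j. j \<in> J \<Longrightarrow> 0 \<le> z j \<and> z j < 1"
  shows "(\<lambda>M. \<Prod>j\<in>J. \<Sum>d\<le>M. z j ^ d) \<longlonglongrightarrow> (\<Prod>j\<in>J. 1 / (1 - z j))"
proof (intro tendsto_prod)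
  fix j assume "j \<in> J"
  then have "(\<lambda>d. z j ^ d) sums (1 / (1 - z j))" using assms by (intro geometric_sums) auto
  then show "(\<lambda>M. \<Sum>d\<le>M. z j ^ d) \<longlonglongrightarrow> 1 / (1 - z j)" by (simp add: sums_def_le)
qed

lemma complete_hom_le_prod:
  assumes "finite J" "\<And>j. j \<in> J \<Longrightarrow> 0 \<le> z j \<and> z j < 1"
  shows "complete_hom J k z \<le> (\<Prod>j\<in>J. 1 / (1 - z j))"
proof -
  have "complete_hom J k z \<le> (\<Prod>j\<in>J. \<Sum>d\<le>k. z j ^ d)"
    using assms by (intro prod_geometric_partial_sums) auto
  also have "\<dots> \<le> (\<Prod>j\<in>J. 1 / (1 - z j))"
  proof (intro prod_mono conjI)
    fix j assume j: "j \<in> J"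
    have "(\<lambda>d. z j ^ d) sums (1 / (1 - z j))" using assms(2)[OF j] by (intro geometric_sums) auto
    then show "(\<Sum>d\<le>k. z j ^ d) \<le> 1 / (1 - z j)"
      using sum_le_suminf[of "\<lambda>d. z j ^ d" "{..k}"] assms(2)[OF j] by (simp add: sums_iff)
    show "(\<Sum>d\<le>k. z j ^ d) \<ge> 0" using assms(2)[OF j] by (intro sum_nonneg) auto
  qed
  finally show ?thesis .
qed

text \<open>The tilt \<open>\<tau>\<close> makes the \<open>n\<close>-th term the largest in the
  series for the product. Damping it by \<open>\<theta>\<close> bounds the series by a geometric
  one, at the price of a factor linear in \<open>n\<close>.\<close>

lemma exists_row_weight:
  assumes "finite J" "J \<noteq> {}" and y: "\<And>j. j \<in> J \<Longrightarrow> y j > 0"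
  shows "\<exists>x>0. (\<forall>j\<in>J. x * y j < 1) \<and>
    (\<Prod>j\<in>J. 1 / (1 - x * y j)) \<le> 3 * (real n + 2) * (x ^ n * complete_hom J n y)"
proof -
  define a where "a k = complete_hom J k y" for k
  have apos: "a k > 0" for k unfolding a_def using assms by (rule complete_hom_pos)
  have lc: "log_conc a" unfolding a_def using assms by (rule log_conc_complete_hom)
  define \<tau> where "\<tau> = a n / a (Suc n)"
  have \<tau>: "\<tau> > 0" unfolding \<tau>_def using apos by simp
  have max: "a k * \<tau> ^ k \<le> a n * \<tau> ^ n" for k
  proof -
    \<comment> \<open>A range reaching beyond \<open>n\<close> forces the tilt from
      \<open>log_conc_max\<close> to be the ratio \<open>\<tau>\<close>, so a single
      \<open>\<tau>\<close> works for all \<open>k\<close>.\<close>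
    have "n \<le> max k (Suc n)" by simp
    then obtain t where t: "\<And>i. i \<le> max k (Suc n) \<Longrightarrow> a i * t ^ i \<le> a n * t ^ n"
      "n < max k (Suc n) \<Longrightarrow> t = a n / a (Suc n)"
      using log_conc_max[OF lc apos] by metis
    then have "t = \<tau>" by (simp add: \<tau>_def less_max_iff_disj)
    then show ?thesis using t(1)[of k] by simp
  qed
  have le1: "\<tau> * y j \<le> 1" if j: "j \<in> J" for j
  proof (rule ccontr)
    assume "\<not> \<tau> * y j \<le> 1"
    \<comment> \<open>Powers of a number above 1 would exceed the fixed bound
      \<open>a n * \<tau> ^ n\<close>, although they are at most the terms
      \<open>a k * \<tau> ^ k\<close>.\<close>
    then obtain k where "(\<tau> * y j) ^ k > a n * \<tau> ^ n" using real_arch_pow[of "\<tau> * y j"] by auto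
    moreover have "(\<tau> * y j) ^ k \<le> a k * \<tau> ^ k"
      using complete_hom_ge_power[where k = k, OF assms(1) j y] \<tau>
      by (simp add: a_def power_mult_distrib mult.commute mult_right_mono)
    ultimately show False using max[of k] by linarith
  qed
  \<comment> \<open>This balances the geometric sum \<open>1 / (1 - \<theta>) = n + 2\<close>
    against the loss \<open>(1 / \<theta>) ^ n\<close>, which stays below
    \<open>exp 1\<close>.\<close>
  define \<theta> where "\<theta> = (real n + 1) / (real n + 2)"
  have \<theta>: "0 < \<theta>" "\<theta> < 1" by (auto simp: \<theta>_def)
  define x where "x = \<theta> * \<tau>"
  have x: "x > 0" using \<theta> \<tau> by (simp add: x_def)
  have lt1: "x * y j < 1" if "j \<in> J" for j
  proof -
    have "x * y j = \<theta> * (\<tau> * y j)" by (simp add: x_def)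
    also have "\<dots> \<le> \<theta> * 1" using \<theta> le1[OF that] by (intro mult_left_mono) auto
    finally show ?thesis using \<theta> by simp
  qed
  have tail: "1 / ((1 - \<theta>) * \<theta> ^ n) \<le> 3 * (real n + 2)"
  proof -
    have "(1 + 1 / (real n + 1)) ^ n \<le> exp (1 / (real n + 1)) ^ n"
      by (intro power_mono exp_ge_add_one_self) auto
    also have "\<dots> = exp (real n / (real n + 1))" by (simp flip: exp_of_nat_mult)
    also have "\<dots> \<le> exp 1" by simp
    also have "\<dots> \<le> 3" by (rule exp_le)
    finally have "(1 + 1 / (real n + 1)) ^ n \<le> 3" .
    moreover have "1 / \<theta> = 1 + 1 / (real n + 1)" by (simp add: \<theta>_def field_simps)
    ultimately have "(1 / \<theta>) ^ n \<le> 3" by simp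
    moreover have "1 / (1 - \<theta>) = real n + 2" by (simp add: \<theta>_def field_simps)
    moreover have "1 / ((1 - \<theta>) * \<theta> ^ n) = (1 / (1 - \<theta>)) * (1 / \<theta>) ^ n" by (simp add: power_divide)
    ultimately show ?thesis using mult_left_mono[of "(1 / \<theta>) ^ n" 3 "real n + 2"] by simp
  qed
  have "(\<Prod>j\<in>J. \<Sum>d\<le>M. (x * y j) ^ d) \<le> 3 * (real n + 2) * (x ^ n * a n)" for M
  proof -
    have "(\<Prod>j\<in>J. \<Sum>d\<le>M. (x * y j) ^ d) \<le> (\<Sum>k\<le>card J * M. x ^ k * a k)"
      using prod_geometric_partial_sums(1)[OF assms(1), of "\<lambda>j. x * y j" M] y x
      unfolding complete_hom_scale a_def by (simp add: less_imp_le)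
    also have "\<dots> \<le> (\<Sum>k\<le>card J * M. \<theta> ^ k * (a n * \<tau> ^ n))"
    proof (intro sum_mono)
      fix k
      show "x ^ k * a k \<le> \<theta> ^ k * (a n * \<tau> ^ n)"
        using mult_left_mono[OF max[of k], of "\<theta> ^ k"] \<theta> by (simp add: x_def power_mult_distrib mult_ac)
    qed
    also have "\<dots> = (\<Sum>k\<le>card J * M. \<theta> ^ k) * (a n * \<tau> ^ n)" by (rule sum_distrib_right[symmetric])
    also have "\<dots> \<le> 1 / (1 - \<theta>) * (a n * \<tau> ^ n)"
    proof (rule mult_right_mono)
      have "(\<lambda>d. \<theta> ^ d) sums (1 / (1 - \<theta>))" using \<theta> by (intro geometric_sums) auto
      then show "(\<Sum>k\<le>card J * M. \<theta> ^ k) \<le> 1 / (1 - \<theta>)"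
        using sum_le_suminf[of "\<lambda>d. \<theta> ^ d" "{..card J * M}"] \<theta> by (simp add: sums_iff)
      show "a n * \<tau> ^ n \<ge> 0" using apos[of n] \<tau> by simp
    qed
    also have "\<dots> = 1 / ((1 - \<theta>) * \<theta> ^ n) * (x ^ n * a n)"
      using \<theta> by (simp add: x_def power_mult_distrib)
    also have "\<dots> \<le> 3 * (real n + 2) * (x ^ n * a n)"
      using tail x apos[of n] by (intro mult_right_mono) auto
    finally show ?thesis .
  qed
  moreover have "(\<lambda>M. \<Prod>j\<in>J. \<Sum>d\<le>M. (x * y j) ^ d) \<longlonglongrightarrow> (\<Prod>j\<in>J. 1 / (1 - x * y j))"
    using lt1 x y by (intro prod_geometric_tendsto) (auto simp: less_imp_le)
  ultimately have "(\<Prod>j\<in>J. 1 / (1 - x * y j)) \<le> 3 * (real n + 2) * (x ^ n * a n)"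
    by (intro LIMSEQ_le_const2) auto
  then show ?thesis using x lt1 unfolding a_def by blast
qed

lemma card_comps_le: "finite J \<Longrightarrow> card (comps J N) \<le> (N + 1) ^ card J"
  using card_mono[of "PiE J (\<lambda>_. {..N})" "comps J N"]
  by (simp add: finite_PiE card_PiE comps_def subset_iff)

section \<open>Lower bound for the number of tables\<close>

text \<open>The terms of the generating function divided by \<open>P\<close> are probability weights
  with mean \<open>C\<close>. Solving for \<open>f\<close> and taking geometric means gives
  \<open>P / mon C\<close> times the exponential of minus the entropy, and the entropy is at most
  \<open>ln (card A)\<close>.\<close>

lemma card_margin_tables_ge:
  assumes fin: "finite I" "finite J" and ne: "I \<noteq> {}" "J \<noteq> {}"
    and C: "C \<in> comps J (sum r I)" and y: "\<And>j. j \<in> J \<Longrightarrow> y j > 0"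
    and min: "\<And>y'. (\<And>j. j \<in> J \<Longrightarrow> y' j > 0) \<Longrightarrow>
      row_gen I J r y / (\<Prod>j\<in>J. y j ^ C j) \<le> row_gen I J r y' / (\<Prod>j\<in>J. y' j ^ C j)"
  shows "row_gen I J r y / (\<Prod>j\<in>J. y j ^ C j) \<le>
    2 * (real (sum r I) + 1) ^ (2 * card J) * real (card (margin_tables I J r C))"
proof -
  define N A where "N = sum r I" and "A = comps J N"
  define f where "f \<alpha> = real (card (margin_tables I J r \<alpha>))" for \<alpha>
  define mon where "mon \<alpha> = (\<Prod>j\<in>J. y j ^ \<alpha> j)" for \<alpha>
  define P where "P = row_gen I J r y"
  define w where "w \<alpha> = f \<alpha> * mon \<alpha> / P" for \<alpha>
  have mon: "mon \<alpha> > 0" for \<alpha> unfolding mon_def using y by (intro prod_pos) auto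
  have f: "f \<alpha> > 0" if "\<alpha> \<in> A" for \<alpha>
    unfolding f_def using margin_tables_nonempty[OF fin that[unfolded A_def N_def]] fin
    by (simp add: card_gt_0_iff)
  have P_eq: "P = (\<Sum>\<alpha>\<in>A. f \<alpha> * mon \<alpha>)" unfolding P_def A_def N_def f_def mon_def by (rule row_gen_expand[OF fin])
  have finA: "finite A" and neA: "A \<noteq> {}" using fin ne comps_nonempty by (auto simp: A_def)
  have P: "P > 0" unfolding P_eq using finA neA f mon by (intro sum_pos) auto
  have w: "w \<alpha> > 0" if "\<alpha> \<in> A" for \<alpha> using f[OF that] mon P by (simp add: w_def)
  have sum_w: "sum w A = 1" unfolding w_def using P by (simp add: P_eq flip: sum_divide_distrib)
  have mean: "(\<Sum>\<alpha>\<in>A. w \<alpha> * real (\<alpha> j)) = real (C j)" if "j \<in> J" for j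
  proof -
    have "(\<Sum>\<alpha>\<in>A. f \<alpha> * mon \<alpha> * real (\<alpha> j)) = real (C j) * P"
      unfolding A_def N_def f_def mon_def P_def
      by (rule row_gen_minimizer_mean[OF fin C y min that])
    then show ?thesis using P unfolding w_def by (simp add: field_simps flip: sum_divide_distrib)
  qed
  define E where "E = N + 3 * (card I * card J)"
  have E: "E > 0" using fin ne by (simp add: E_def card_gt_0_iff)
  \<comment> \<open>So close to 1 that the whole loss in
    \<open>card_margin_tables_geometric_mean\<close> is a factor 2.\<close>
  define \<theta> where "\<theta> = root E (1 / 2)"
  have \<theta>: "0 < \<theta>" "\<theta> < 1" "\<theta> ^ E = 1 / 2" using E by (auto simp: \<theta>_def)
  have key: "1 / 2 * (\<Prod>\<alpha>\<in>A. f \<alpha> powr w \<alpha>) \<le> (real N + 1) ^ card J * f C"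
  proof -
    have "\<theta> ^ E * (\<Prod>\<alpha>\<in>A. f \<alpha> powr w \<alpha>) \<le> (real N + 1) ^ card J * f C"
      unfolding E_def N_def f_def
      by (rule card_margin_tables_geometric_mean[OF fin \<theta>(1,2) finA w sum_w _ C mean])
        (simp_all add: A_def N_def)
    then show ?thesis by (simp only: \<theta>(3))
  qed
  have "P / mon C / real (card A) \<le> (\<Prod>\<alpha>\<in>A. f \<alpha> powr w \<alpha>)"
  proof -
    \<comment> \<open>The entropy bound is the inequality of arithmetic and geometric means for the
      numbers \<open>1 / w \<alpha>\<close>.\<close>
    have "(\<Prod>\<alpha>\<in>A. (1 / w \<alpha>) powr w \<alpha>) \<le> (\<Sum>\<alpha>\<in>A. w \<alpha> * (1 / w \<alpha>))"
      using w by (intro weighted_arith_geom_mean finA sum_w) (auto intro: less_imp_le)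
    also have "\<dots> = (\<Sum>\<alpha>\<in>A. 1)" by (intro sum.cong refl) (use w in force)
    finally have "1 / (\<Prod>\<alpha>\<in>A. w \<alpha> powr w \<alpha>) \<le> real (card A)"
      by (simp add: powr_divide prod_dividef)
    moreover have "(\<Prod>\<alpha>\<in>A. w \<alpha> powr w \<alpha>) > 0" by (intro prod_pos) (use w in force)
    moreover have "real (card A) > 0" using finA neA by (simp add: card_gt_0_iff)
    ultimately have ent: "1 / real (card A) \<le> (\<Prod>\<alpha>\<in>A. w \<alpha> powr w \<alpha>)" by (simp add: field_simps)
    have "(\<Prod>\<alpha>\<in>A. f \<alpha> powr w \<alpha>) = (\<Prod>\<alpha>\<in>A. w \<alpha> powr w \<alpha> * P powr w \<alpha> / mon \<alpha> powr w \<alpha>)"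
    proof (intro prod.cong refl)
      fix \<alpha> assume "\<alpha> \<in> A"
      have "f \<alpha> = w \<alpha> * P / mon \<alpha>" using P mon[of \<alpha>] by (simp add: w_def)
      then show "f \<alpha> powr w \<alpha> = w \<alpha> powr w \<alpha> * P powr w \<alpha> / mon \<alpha> powr w \<alpha>"
        by (metis powr_mult powr_divide)
    qed
    also have "\<dots> = (\<Prod>\<alpha>\<in>A. w \<alpha> powr w \<alpha>) * (\<Prod>\<alpha>\<in>A. P powr w \<alpha>) / (\<Prod>\<alpha>\<in>A. mon \<alpha> powr w \<alpha>)"
      by (simp add: prod.distrib prod_dividef)
    also have "(\<Prod>\<alpha>\<in>A. P powr w \<alpha>) = P" using P sum_w powr_sum[of P w A] by simp
    also have "(\<Prod>\<alpha>\<in>A. mon \<alpha> powr w \<alpha>) = mon C"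
      unfolding mon_def using y mean by (intro prod_monomial_powr) auto
    finally have "(\<Prod>\<alpha>\<in>A. f \<alpha> powr w \<alpha>) = (\<Prod>\<alpha>\<in>A. w \<alpha> powr w \<alpha>) * (P / mon C)" by simp
    moreover have "P / mon C > 0" using P mon by simp
    ultimately show ?thesis using mult_right_mono[OF ent, of "P / mon C"] by (simp add: mult_ac)
  qed
  then have "P / mon C / real (card A) \<le> 2 * (real N + 1) ^ card J * f C" using key by linarith
  moreover have "real (card A) > 0" using finA neA by (simp add: card_gt_0_iff)
  ultimately have "P / mon C \<le> 2 * (real N + 1) ^ card J * f C * real (card A)"
    by (simp only: pos_divide_le_eq)
  also have "\<dots> \<le> 2 * (real N + 1) ^ card J * f C * (real N + 1) ^ card J"
  proof (rule mult_left_mono)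
    have "real (card A) \<le> real ((N + 1) ^ card J)"
      unfolding A_def using card_comps_le[OF fin(2)] by (intro of_nat_mono)
    then show "real (card A) \<le> (real N + 1) ^ card J" by (simp add: add.commute)
  qed (auto simp: f_def)
  also have "\<dots> = 2 * (real N + 1) ^ (2 * card J) * f C" unfolding mult_2[of "card J"] power_add by (simp only: mult_ac)
  finally show ?thesis unfolding P_def mon_def N_def f_def .
qed

section \<open>The minimum over the cube\<close>

definition cube_fun :: "'a set \<Rightarrow> 'b set \<Rightarrow> ('a \<Rightarrow> nat) \<Rightarrow> ('b \<Rightarrow> nat) \<Rightarrow> ('a \<Rightarrow> real) \<Rightarrow> ('b \<Rightarrow> real) \<Rightarrow> real" where
  "cube_fun I J r c x y = (\<Prod>i\<in>I. 1 / x i ^ r i) * (\<Prod>j\<in>J. 1 / y j ^ c j) *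
     (\<Prod>i\<in>I. \<Prod>j\<in>J. 1 / (1 - x i * y j))"

lemma cube_fun_cong:
  assumes "\<And>i. i \<in> I \<Longrightarrow> x i = x' i" "\<And>j. j \<in> J \<Longrightarrow> y j = y' j"
  shows "cube_fun I J r c x y = cube_fun I J r c x' y'"
proof -
  have "(\<Prod>i\<in>I. 1 / x i ^ r i) = (\<Prod>i\<in>I. 1 / x' i ^ r i)" "(\<Prod>j\<in>J. 1 / y j ^ c j) = (\<Prod>j\<in>J. 1 / y' j ^ c j)"
    "(\<Prod>i\<in>I. \<Prod>j\<in>J. 1 / (1 - x i * y j)) = (\<Prod>i\<in>I. \<Prod>j\<in>J. 1 / (1 - x' i * y' j))"
    using assms by (auto intro!: prod.cong)
  then show ?thesis by (simp add: cube_fun_def)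
qed

lemma cube_fun_scale:
  assumes "s > 0" "sum r I = sum c J"
  shows "cube_fun I J r c (\<lambda>i. s * x i) (\<lambda>j. y j / s) = cube_fun I J r c x y"
proof -
  have "(\<Prod>i\<in>I. 1 / (s * x i) ^ r i) = (\<Prod>i\<in>I. 1 / x i ^ r i) / s ^ sum r I"
    by (simp add: power_mult_distrib prod_dividef prod.distrib power_sum)
  moreover have "(\<Prod>j\<in>J. 1 / (y j / s) ^ c j) = (\<Prod>j\<in>J. 1 / y j ^ c j) * s ^ sum c J"
    by (simp add: power_divide prod_dividef power_sum)
  moreover have "s * x i * (y j / s) = x i * y j" for i j using assms(1) by simp
  ultimately show ?thesis using assms unfolding cube_fun_def by simp
qed

text \<open>Multiplying \<open>x\<close> by \<open>s\<close> and dividing \<open>y\<close> by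
  \<open>s\<close> preserves the function because the margins have equal totals. Making both maxima
  equal to the root of their product moves the point into the cube; the last clause controls the
  distance to its boundary.\<close>

lemma cube_normalize:
  fixes x :: "'a \<Rightarrow> real" and y :: "'b \<Rightarrow> real"
  assumes fin: "finite I" "finite J" and ne: "I \<noteq> {}" "J \<noteq> {}" and sums: "sum r I = sum c J"
    and x: "\<And>i. i \<in> I \<Longrightarrow> x i > 0" and y: "\<And>j. j \<in> J \<Longrightarrow> y j > 0"
    and xy: "\<And>i j. i \<in> I \<Longrightarrow> j \<in> J \<Longrightarrow> x i * y j < 1"
  obtains x' y' \<beta> where "\<beta> < 1" "\<And>i. i \<in> I \<Longrightarrow> 0 < x' i \<and> x' i \<le> \<beta>"
    "\<And>j. j \<in> J \<Longrightarrow> 0 < y' j \<and> y' j \<le> \<beta>"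
    "cube_fun I J r c x' y' = cube_fun I J r c x y"
    "\<exists>i\<in>I. \<exists>j\<in>J. x' i * y' j = \<beta>\<^sup>2"
proof -
  define a b where "a = Max (x ` I)" and "b = Max (y ` J)"
  have "a \<in> x ` I" "b \<in> y ` J" unfolding a_def b_def using fin ne by (auto intro!: Max_in)
  then obtain i0 j0 where i0: "i0 \<in> I" "x i0 = a" and j0: "j0 \<in> J" "y j0 = b" by auto
  have ab: "a > 0" "b > 0" "a * b < 1" using x[OF i0(1)] y[OF j0(1)] xy[OF i0(1) j0(1)] i0 j0 by auto
  have le: "x i \<le> a" if "i \<in> I" for i unfolding a_def using fin that by simp
  have le': "y j \<le> b" if "j \<in> J" for j unfolding b_def using fin that by simp
  define s where "s = sqrt (b / a)"
  have s: "s > 0" using ab by (simp add: s_def)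
  have sa: "s * a = sqrt (a * b)" and bs: "b / s = sqrt (a * b)"
  proof -
    have s2: "s\<^sup>2 = b / a" unfolding s_def using ab by (intro real_sqrt_pow2) simp
    have "(s * a)\<^sup>2 = a * b" unfolding power_mult_distrib s2 using ab by (simp add: power2_eq_square)
    then show 1: "s * a = sqrt (a * b)" using ab s by (intro real_sqrt_unique[symmetric]) auto
    have "(b / s)\<^sup>2 = a * b" unfolding power_divide s2 using ab by (simp add: power2_eq_square)
    then show "b / s = sqrt (a * b)" using ab s by (intro real_sqrt_unique[symmetric]) auto
  qed
  show ?thesis
  proof (rule that[of "sqrt (a * b)" "\<lambda>i. s * x i" "\<lambda>j. y j / s"])
    show "sqrt (a * b) < 1" using ab by simp
    show "0 < s * x i \<and> s * x i \<le> sqrt (a * b)" if "i \<in> I" for i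
      using x[OF that] s le[OF that] unfolding sa[symmetric] by simp
    show "0 < y j / s \<and> y j / s \<le> sqrt (a * b)" if "j \<in> J" for j
      using y[OF that] s le'[OF that] unfolding bs[symmetric] by (simp add: divide_right_mono)
    show "cube_fun I J r c (\<lambda>i. s * x i) (\<lambda>j. y j / s) = cube_fun I J r c x y"
      using s sums by (rule cube_fun_scale)
    show "\<exists>i\<in>I. \<exists>j\<in>J. s * x i * (y j / s) = (sqrt (a * b))\<^sup>2"
      using i0 j0 ab s by (intro bexI[of _ i0] bexI[of _ j0]) auto
  qed
qed

lemma member_le_prod_real:
  fixes f :: "'a \<Rightarrow> real"
  assumes "finite A" "a \<in> A" "\<And>a. a \<in> A \<Longrightarrow> f a \<ge> 1"
  shows "f a \<le> prod f A"
proof -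
  have "f a * 1 \<le> f a * prod f (A - {a})"
    using assms(2,3) by (intro mult_left_mono prod_ge_1) (auto intro: order_trans[of 0 1])
  then show ?thesis using assms(1,2) by (simp add: prod.remove)
qed

text \<open>Inside the cube every factor is at least 1, so a bound on the value bounds each
  factor.\<close>

lemma cube_fun_ge_factors:
  assumes fin: "finite I" "finite J"
    and x: "\<And>i. i \<in> I \<Longrightarrow> 0 < x i \<and> x i < 1" and y: "\<And>j. j \<in> J \<Longrightarrow> 0 < y j \<and> y j < 1"
  shows "i \<in> I \<Longrightarrow> 1 / x i ^ r i \<le> cube_fun I J r c x y"
    and "j \<in> J \<Longrightarrow> 1 / y j ^ c j \<le> cube_fun I J r c x y"
    and "i \<in> I \<Longrightarrow> j \<in> J \<Longrightarrow> 1 / (1 - x i * y j) \<le> cube_fun I J r c x y"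
proof -
  have 1: "1 / x i ^ r i \<ge> 1" if "i \<in> I" for i using x[OF that] by (simp add: power_le_one)
  have 2: "1 / y j ^ c j \<ge> 1" if "j \<in> J" for j using y[OF that] by (simp add: power_le_one)
  have 3: "1 / (1 - x i * y j) \<ge> 1" if "i \<in> I" "j \<in> J" for i j
    using x[OF that(1)] y[OF that(2)] mult_strict_mono[of "x i" 1 "y j" 1] by (simp add: le_divide_eq)
  define A B D where "A = (\<Prod>i\<in>I. 1 / x i ^ r i)" and "B = (\<Prod>j\<in>J. 1 / y j ^ c j)"
    and "D = (\<Prod>i\<in>I. \<Prod>j\<in>J. 1 / (1 - x i * y j))"
  have row: "(\<Prod>j\<in>J. 1 / (1 - x i * y j)) \<ge> 1" if "i \<in> I" for i using 3 that by (intro prod_ge_1) auto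
  have ge: "A \<ge> 1" "B \<ge> 1" "D \<ge> 1" unfolding A_def B_def D_def by (intro prod_ge_1 1 2 row; assumption)+
  have F: "cube_fun I J r c x y = A * B * D" by (simp add: cube_fun_def A_def B_def D_def)
  have AB: "A * B \<ge> 1" using mult_mono[of 1 A 1 B] ge by simp
  have le: "A \<le> A * B" "B \<le> A * B" "A * B \<le> A * B * D" "D \<le> A * B * D"
    using ge AB mult_left_mono[of 1 B A] mult_right_mono[of 1 A B] mult_left_mono[of 1 D "A * B"]
      mult_right_mono[of 1 "A * B" D] by auto
  show "1 / x i ^ r i \<le> cube_fun I J r c x y" if i: "i \<in> I"
  proof -
    have "1 / x i ^ r i \<le> A" unfolding A_def
      by (rule member_le_prod_real[OF fin(1) i, of "\<lambda>i. 1 / x i ^ r i"]) (rule 1)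
    then show ?thesis using le unfolding F by linarith
  qed
  show "1 / y j ^ c j \<le> cube_fun I J r c x y" if j: "j \<in> J"
  proof -
    have "1 / y j ^ c j \<le> B" unfolding B_def
      by (rule member_le_prod_real[OF fin(2) j, of "\<lambda>j. 1 / y j ^ c j"]) (rule 2)
    then show ?thesis using le unfolding F by linarith
  qed
  show "1 / (1 - x i * y j) \<le> cube_fun I J r c x y" if i: "i \<in> I" and j: "j \<in> J"
  proof -
    have "1 / (1 - x i * y j) \<le> (\<Prod>j\<in>J. 1 / (1 - x i * y j))"
      by (rule member_le_prod_real[OF fin(2) j, of "\<lambda>j. 1 / (1 - x i * y j)"]) (rule 3[OF i])
    also have "\<dots> \<le> D" unfolding D_def
      by (rule member_le_prod_real[OF fin(1) i, of "\<lambda>i. \<Prod>j\<in>J. 1 / (1 - x i * y j)"]) (rule row)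
    finally show ?thesis using le unfolding F by linarith
  qed
qed

text \<open>Only points with value at most \<open>M\<close>, the value at the centre, matter. After
  normalization the factor at the largest product keeps the coordinates below
  \<open>\<beta>0\<close>, and the power factors keep them above \<open>1 / M\<close>; on this box
  the continuous function attains its minimum.\<close>

lemma cube_fun_minimizer:
  fixes I :: "'a set" and J :: "'b set"
  assumes fin: "finite I" "finite J" and ne: "I \<noteq> {}" "J \<noteq> {}" and sums: "sum r I = sum c J"
    and r: "\<And>i. i \<in> I \<Longrightarrow> r i > 0" and c: "\<And>j. j \<in> J \<Longrightarrow> c j > 0"
  obtains x y where "\<And>i. i \<in> I \<Longrightarrow> 0 < x i \<and> x i < 1" "\<And>j. j \<in> J \<Longrightarrow> 0 < y j \<and> y j < 1"
    "\<And>x' y'. (\<And>i. i \<in> I \<Longrightarrow> 0 < x' i \<and> x' i < 1) \<Longrightarrow> (\<And>j. j \<in> J \<Longrightarrow> 0 < y' j \<and> y' j < 1) \<Longrightarrow>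
      cube_fun I J r c x y \<le> cube_fun I J r c x' y'"
proof -
  define M where "M = cube_fun I J r c (\<lambda>_. 1 / 2) (\<lambda>_. 1 / 2)"
  have "M \<ge> 2"
  proof -
    obtain i where i: "i \<in> I" using ne by auto
    have "(2::real) ^ 1 \<le> 2 ^ r i" using r[OF i] by (intro power_increasing) auto
    then show ?thesis
      unfolding M_def using cube_fun_ge_factors(1)[OF fin, of "\<lambda>_. 1 / 2" "\<lambda>_. 1 / 2" i r c] i
      by (simp add: power_divide)
  qed
  define \<beta>0 where "\<beta>0 = sqrt (1 - 1 / M)"
  have M: "0 < 1 / M" "1 / M \<le> 1 / 2" using \<open>M \<ge> 2\<close> by (auto simp: field_simps)
  have \<beta>0: "1 / 2 \<le> \<beta>0" "\<beta>0 < 1" "\<beta>0\<^sup>2 = 1 - 1 / M"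
  proof -
    have "(1 / 2 :: real)\<^sup>2 = 1 / 4" by (simp add: power2_eq_square)
    then have "(1 / 2 :: real)\<^sup>2 \<le> 1 - 1 / M" using M by linarith
    then show "1 / 2 \<le> \<beta>0" unfolding \<beta>0_def by (intro real_le_rsqrt)
    show "\<beta>0 < 1" unfolding \<beta>0_def using M by simp
    show "\<beta>0\<^sup>2 = 1 - 1 / M" unfolding \<beta>0_def using M by (intro real_sqrt_pow2) simp
  qed
  \<comment> \<open>Both families of variables are packed into one function on the sum type, so that
    a single compact box serves.\<close>
  define K where "K = Inl ` I \<union> (Inr ` J :: ('a + 'b) set)"
  define S where "S = {f :: 'a + 'b \<Rightarrow> real. (\<forall>k\<in>K. 1 / M \<le> f k \<and> f k \<le> \<beta>0) \<and> (\<forall>k. k \<notin> K \<longrightarrow> f k = 0)}"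
  define g where "g f = cube_fun I J r c (\<lambda>i. f (Inl i)) (\<lambda>j. f (Inr j))" for f
  have SI: "1 / M \<le> f (Inl i)" "f (Inl i) \<le> \<beta>0" if "f \<in> S" "i \<in> I" for f i
    using that by (auto simp: S_def K_def)
  have SJ: "1 / M \<le> f (Inr j)" "f (Inr j) \<le> \<beta>0" if "f \<in> S" "j \<in> J" for f j
    using that by (auto simp: S_def K_def)
  have xI: "0 < f (Inl i) \<and> f (Inl i) < 1" if "f \<in> S" "i \<in> I" for f i
    using SI[OF that] M(1) \<beta>0(2) by linarith
  have yJ: "0 < f (Inr j) \<and> f (Inr j) < 1" if "f \<in> S" "j \<in> J" for f j
    using SJ[OF that] M(1) \<beta>0(2) by linarith
  have coord: "continuous_on S (\<lambda>f. f k)" for k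
    by (rule continuous_on_subset[OF continuous_on_product_coordinates]) auto
  have "continuous_on S g"
    unfolding g_def cube_fun_def
  proof (intro continuous_intros coord ballI)
    fix f i assume "i \<in> I" "f \<in> S"
    then show "f (Inl i) ^ r i \<noteq> 0" using xI[of f i] by simp
  next
    fix f j assume "j \<in> J" "f \<in> S"
    then show "f (Inr j) ^ c j \<noteq> 0" using yJ[of f j] by simp
  next
    fix f i j assume "i \<in> I" "j \<in> J" "f \<in> S"
    then have "f (Inl i) * f (Inr j) < 1 * 1"
      using xI[of f i] yJ[of f j] by (intro mult_strict_mono) auto
    then show "1 - f (Inl i) * f (Inr j) \<noteq> 0" by simp
  qed
  moreover have "compact S" unfolding S_def by (rule compact_box_fun)
  moreover have half: "(\<lambda>k. if k \<in> K then 1 / 2 else 0) \<in> S" using M \<beta>0 by (auto simp: S_def)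
  ultimately obtain f where f: "f \<in> S" "\<And>f'. f' \<in> S \<Longrightarrow> g f \<le> g f'"
    using continuous_attains_inf[of S g] by blast
  have "g f \<le> cube_fun I J r c x' y'"
    if x': "\<And>i. i \<in> I \<Longrightarrow> 0 < x' i \<and> x' i < 1" and y': "\<And>j. j \<in> J \<Longrightarrow> 0 < y' j \<and> y' j < 1" for x' y'
  proof (cases "cube_fun I J r c x' y' \<le> M")
    case False
    have "g f \<le> g (\<lambda>k. if k \<in> K then 1 / 2 else 0)" by (rule f(2)[OF half])
    also have "\<dots> = M" unfolding g_def M_def by (intro cube_fun_cong) (auto simp: K_def)
    finally show ?thesis using False by linarith
  next
    case True
    have xy': "x' i * y' j < 1" if "i \<in> I" "j \<in> J" for i j
      using x'[OF that(1)] y'[OF that(2)] mult_strict_mono[of "x' i" 1 "y' j" 1] by simp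
    obtain x2 y2 \<beta> where n: "\<beta> < 1" "\<And>i. i \<in> I \<Longrightarrow> 0 < x2 i \<and> x2 i \<le> \<beta>"
      "\<And>j. j \<in> J \<Longrightarrow> 0 < y2 j \<and> y2 j \<le> \<beta>" "cube_fun I J r c x2 y2 = cube_fun I J r c x' y'"
      "\<exists>i\<in>I. \<exists>j\<in>J. x2 i * y2 j = \<beta>\<^sup>2"
      by (rule cube_normalize[OF fin ne sums, of x' y']) (use x' y' xy' in blast)+
    have x2: "0 < x2 i \<and> x2 i < 1" if "i \<in> I" for i using n(1) n(2)[OF that] by linarith
    have y2: "0 < y2 j \<and> y2 j < 1" if "j \<in> J" for j using n(1) n(3)[OF that] by linarith
    have le_M: "t \<le> M" if "t \<le> cube_fun I J r c x2 y2" for t using that n(4) True by linarith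
    have fac1: "1 / x2 i ^ r i \<le> M" if "i \<in> I" for i
      by (rule le_M, rule cube_fun_ge_factors[OF fin]) (use x2 y2 that in auto)
    have fac2: "1 / y2 j ^ c j \<le> M" if "j \<in> J" for j
      by (rule le_M, rule cube_fun_ge_factors[OF fin]) (use x2 y2 that in auto)
    have fac3: "1 / (1 - x2 i * y2 j) \<le> M" if "i \<in> I" "j \<in> J" for i j
      by (rule le_M, rule cube_fun_ge_factors[OF fin]) (use x2 y2 that in auto)
    obtain i0 j0 where ij: "i0 \<in> I" "j0 \<in> J" "x2 i0 * y2 j0 = \<beta>\<^sup>2" using n(5) by blast
    have "\<beta> > 0" using n(2)[OF ij(1)] by linarith
    have "1 / (1 - \<beta>\<^sup>2) \<le> M" using fac3[OF ij(1,2)] ij(3) by simp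
    moreover have "\<beta>\<^sup>2 < 1" using n(1) \<open>\<beta> > 0\<close> by (simp add: power_less_one_iff)
    ultimately have "\<beta>\<^sup>2 \<le> 1 - 1 / M" using \<open>M \<ge> 2\<close> by (simp add: field_simps)
    then have \<beta>: "\<beta> \<le> \<beta>0" unfolding \<beta>0_def by (intro real_le_rsqrt)
    have inv: "1 / M \<le> t" if "0 < t" "t < 1" "k > 0" "1 / t ^ k \<le> M" for t :: real and k :: nat
    proof -
      \<comment> \<open>Positive margins enter here: with exponent at least 1, a bound on
        \<open>1 / t ^ k\<close> bounds \<open>1 / t\<close>.\<close>
      have "t ^ k \<le> t ^ 1" using that by (intro power_decreasing) auto
      then have "1 / t \<le> 1 / t ^ k" using that by (intro divide_left_mono) auto
      then have "1 / t \<le> M" using that by linarith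
      then show ?thesis using that \<open>M \<ge> 2\<close> by (simp add: field_simps)
    qed
    have bx: "1 / M \<le> x2 i" if "i \<in> I" for i
      using inv[of "x2 i" "r i"] x2[OF that] r[OF that] fac1[OF that] by linarith
    have by': "1 / M \<le> y2 j" if "j \<in> J" for j
      using inv[of "y2 j" "c j"] y2[OF that] c[OF that] fac2[OF that] by linarith
    define f2 where "f2 k = (if k \<in> K then case_sum x2 y2 k else 0)" for k
    have "1 / M \<le> f2 k \<and> f2 k \<le> \<beta>0" if "k \<in> K" for k
      using that bx by' n(2,3) unfolding f2_def K_def by (auto intro: order_trans[OF _ \<beta>])
    then have "f2 \<in> S" by (simp add: S_def f2_def)
    then have "g f \<le> g f2" by (rule f(2))
    also have "\<dots> = cube_fun I J r c x2 y2" unfolding g_def by (intro cube_fun_cong) (auto simp: f2_def K_def)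
    finally show ?thesis using n(4) by simp
  qed
  then show ?thesis using that[of "\<lambda>i. f (Inl i)" "\<lambda>j. f (Inr j)"] xI[OF f(1)] yJ[OF f(1)] unfolding g_def by blast
qed

text \<open>One monomial of \<open>row_gen\<close> is at most the whole, and by homogeneity
  \<open>x i ^ r i\<close> times a row factor is a complete homogeneous polynomial in the
  \<open>x i * y j\<close>, which is bounded by the product of geometric series.\<close>

lemma cube_fun_ge_card:
  assumes fin: "finite I" "finite J" and C: "C \<in> comps J (sum r I)"
    and x: "\<And>i. i \<in> I \<Longrightarrow> 0 < x i \<and> x i < 1" and y: "\<And>j. j \<in> J \<Longrightarrow> 0 < y j \<and> y j < 1"
  shows "real (card (margin_tables I J r C)) \<le> cube_fun I J r C x y"
proof -
  have xpos: "(\<Prod>i\<in>I. x i ^ r i) > 0" and ypos: "(\<Prod>j\<in>J. y j ^ C j) > 0"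
    using x y by (auto intro!: prod_pos)
  have "real (card (margin_tables I J r C)) * (\<Prod>j\<in>J. y j ^ C j) \<le> row_gen I J r y"
    unfolding row_gen_expand[OF fin] using fin C y
    by (intro member_le_sum mult_nonneg_nonneg prod_nonneg ballI) (auto intro: less_imp_le)
  also have "\<dots> * (\<Prod>i\<in>I. x i ^ r i) = (\<Prod>i\<in>I. complete_hom J (r i) (\<lambda>j. x i * y j))"
    unfolding row_gen_complete_hom complete_hom_scale prod.distrib by (rule mult.commute)
  also have "\<dots> \<le> (\<Prod>i\<in>I. \<Prod>j\<in>J. 1 / (1 - x i * y j))"
  proof (intro prod_mono conjI complete_hom_le_prod fin)
    fix i j assume ij: "i \<in> I" "j \<in> J"
    then have "x i * y j < 1 * 1" using x[of i] y[of j] by (intro mult_strict_mono) auto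
    then show "x i * y j < 1" by simp
    show "0 \<le> x i * y j" using ij x[of i] y[of j] by simp
  next
    fix i assume "i \<in> I"
    then show "0 \<le> complete_hom J (r i) (\<lambda>j. x i * y j)"
      unfolding complete_hom_def using x[of i] y
      by (intro sum_nonneg prod_nonneg ballI zero_le_power) (auto simp: less_imp_le)
  qed
  finally have "real (card (margin_tables I J r C)) * (\<Prod>j\<in>J. y j ^ C j) * (\<Prod>i\<in>I. x i ^ r i)
    \<le> (\<Prod>i\<in>I. \<Prod>j\<in>J. 1 / (1 - x i * y j))" using xpos by simp
  moreover have "t \<le> 1 / X * (1 / Y) * P" if "t * Y * X \<le> P" "X > 0" "Y > 0" for t X Y P :: real
    using that by (simp add: field_simps)
  ultimately have "real (card (margin_tables I J r C)) \<le>
    1 / (\<Prod>i\<in>I. x i ^ r i) * (1 / (\<Prod>j\<in>J. y j ^ C j)) * (\<Prod>i\<in>I. \<Prod>j\<in>J. 1 / (1 - x i * y j))"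
    using xpos ypos by blast
  then show ?thesis unfolding cube_fun_def prod_dividef[of "\<lambda>_. 1"] by simp
qed

text \<open>\<open>y\<close> minimizes the quotient of \<open>row_gen\<close> by the monomial of
  \<open>C\<close>, and each \<open>x i\<close> is then chosen by \<open>exists_row_weight\<close>.
  This point may lie outside the cube, but all products \<open>x i * y j\<close> are below 1, so
  normalization brings it inside.\<close>

lemma exists_cube_fun_le:
  assumes fin: "finite I" "finite J" and ne: "I \<noteq> {}" "J \<noteq> {}"
    and C: "C \<in> comps J (sum r I)" and Cpos: "\<And>j. j \<in> J \<Longrightarrow> C j > 0"
  obtains x y where "\<And>i. i \<in> I \<Longrightarrow> 0 < x i \<and> x i < 1" "\<And>j. j \<in> J \<Longrightarrow> 0 < y j \<and> y j < 1"
    "cube_fun I J r C x y \<le> (\<Prod>i\<in>I. 3 * (real (r i) + 2)) *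
      (2 * (real (sum r I) + 1) ^ (2 * card J) * real (card (margin_tables I J r C)))"
proof -
  obtain y where y: "\<And>j. j \<in> J \<Longrightarrow> y j > 0"
    and min: "\<And>y'. (\<And>j. j \<in> J \<Longrightarrow> y' j > 0) \<Longrightarrow>
      row_gen I J r y / (\<Prod>j\<in>J. y j ^ C j) \<le> row_gen I J r y' / (\<Prod>j\<in>J. y' j ^ C j)"
    using row_gen_minimizer[OF fin ne(2) C Cpos] by blast
  have "\<forall>i. \<exists>x>0. (\<forall>j\<in>J. x * y j < 1) \<and>
    (\<Prod>j\<in>J. 1 / (1 - x * y j)) \<le> 3 * (real (r i) + 2) * (x ^ r i * complete_hom J (r i) y)"
    by (intro allI exists_row_weight fin ne y)
  then obtain x where x: "\<And>i. x i > 0" "\<And>i j. j \<in> J \<Longrightarrow> x i * y j < 1"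
    "\<And>i. (\<Prod>j\<in>J. 1 / (1 - x i * y j)) \<le> 3 * (real (r i) + 2) * (x i ^ r i * complete_hom J (r i) y)"
    by metis
  have sums: "sum r I = sum C J" using C by (simp add: comps_def)
  obtain x' y' \<beta> where n: "\<beta> < 1" "\<And>i. i \<in> I \<Longrightarrow> 0 < x' i \<and> x' i \<le> \<beta>"
    "\<And>j. j \<in> J \<Longrightarrow> 0 < y' j \<and> y' j \<le> \<beta>" "cube_fun I J r C x' y' = cube_fun I J r C x y"
    by (rule cube_normalize[OF fin ne sums, of x y]) (use x y in auto)
  have xpos: "(\<Prod>i\<in>I. x i ^ r i) > 0" and ypos: "(\<Prod>j\<in>J. y j ^ C j) > 0"
    using x y by (auto intro!: prod_pos)
  have "(\<Prod>i\<in>I. \<Prod>j\<in>J. 1 / (1 - x i * y j)) \<le>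
    (\<Prod>i\<in>I. 3 * (real (r i) + 2) * (x i ^ r i * complete_hom J (r i) y))"
    using x(2,3) by (intro prod_mono conjI prod_nonneg ballI) (auto simp: less_imp_le)
  also have "\<dots> = (\<Prod>i\<in>I. 3 * (real (r i) + 2)) * ((\<Prod>i\<in>I. x i ^ r i) * row_gen I J r y)"
    unfolding row_gen_complete_hom by (simp only: prod.distrib)
  finally have "cube_fun I J r C x y \<le> 1 / (\<Prod>i\<in>I. x i ^ r i) * (1 / (\<Prod>j\<in>J. y j ^ C j)) *
    ((\<Prod>i\<in>I. 3 * (real (r i) + 2)) * ((\<Prod>i\<in>I. x i ^ r i) * row_gen I J r y))"
    unfolding cube_fun_def prod_dividef[of "\<lambda>_. 1"] prod.neutral_const
    using xpos ypos by (intro mult_left_mono) auto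
  also have "\<dots> = (\<Prod>i\<in>I. 3 * (real (r i) + 2)) * (row_gen I J r y / (\<Prod>j\<in>J. y j ^ C j))"
    using xpos by simp
  also have "\<dots> \<le> (\<Prod>i\<in>I. 3 * (real (r i) + 2)) *
      (2 * (real (sum r I) + 1) ^ (2 * card J) * real (card (margin_tables I J r C)))"
    by (intro mult_left_mono card_margin_tables_ge[OF fin ne C y min] prod_nonneg ballI) auto
  finally have "cube_fun I J r C x' y' \<le> (\<Prod>i\<in>I. 3 * (real (r i) + 2)) *
      (2 * (real (sum r I) + 1) ^ (2 * card J) * real (card (margin_tables I J r C)))" unfolding n(4) .
  moreover have "0 < x' i \<and> x' i < 1" if "i \<in> I" for i using n(1) n(2)[OF that] by linarith
  moreover have "0 < y' j \<and> y' j < 1" if "j \<in> J" for j using n(1) n(3)[OF that] by linarith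
  ultimately show ?thesis using that[of x' y'] by blast
qed

section \<open>Transfer to vectors and matrices, and the constant\<close>

unbundle no vec_syntax and no fps_syntax

lemma num_tables_eq_card_margin_tables:
  fixes R C :: "nat vec"
  assumes "R \<in> carrier_vec m" "C \<in> carrier_vec n"
  shows "num_tables R C = card (margin_tables {..<m} {..<n} (($) R) (\<lambda>j\<in>{..<n}. C $ j))"
proof -
  have dims: "dim_vec R = m" "dim_vec C = n" using assms by auto
  let ?f = "\<lambda>D. \<lambda>i\<in>{..<m}. \<lambda>j\<in>{..<n}. D $$ (i, j)"
  let ?g = "\<lambda>f. mat m n (\<lambda>(i, j). f i j)"
  have "bij_betw ?f (contingency_tables R C) (margin_tables {..<m} {..<n} (($) R) (\<lambda>j\<in>{..<n}. C $ j))"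
  proof (rule bij_betw_byWitness[of _ ?g])
    show "\<forall>D\<in>contingency_tables R C. ?g (?f D) = D"
      by (auto simp: contingency_tables_def dims intro!: eq_matI)
    show "\<forall>f\<in>margin_tables {..<m} {..<n} (($) R) (\<lambda>j\<in>{..<n}. C $ j). ?f (?g f) = f"
    proof
      fix f assume f: "f \<in> margin_tables {..<m} {..<n} (($) R) (\<lambda>j\<in>{..<n}. C $ j)"
      then have f': "f \<in> PiE {..<m} (\<lambda>i. comps {..<n} (R $ i))" by (simp add: margin_tables_def row_tables_def)
      show "?f (?g f) = f"
      proof (rule extensionalityI[of _ "{..<m}"])
        show "f \<in> extensional {..<m}" using f' by (simp add: PiE_def)
        fix i assume i: "i \<in> {..<m}"
        then have "f i \<in> extensional {..<n}" using f' by (auto simp: PiE_def Pi_def comps_def)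
        then show "?f (?g f) i = f i" using i by (intro extensionalityI[of _ "{..<n}"]) auto
      qed simp
    qed
    show "?f ` contingency_tables R C \<subseteq> margin_tables {..<m} {..<n} (($) R) (\<lambda>j\<in>{..<n}. C $ j)"
      by (auto simp: contingency_tables_def dims margin_tables_def row_tables_def col_sums_def
          intro!: comps_memI restrict_ext)
    show "?g ` margin_tables {..<m} {..<n} (($) R) (\<lambda>j\<in>{..<n}. C $ j) \<subseteq> contingency_tables R C"
    proof
      fix D assume "D \<in> ?g ` margin_tables {..<m} {..<n} (($) R) (\<lambda>j\<in>{..<n}. C $ j)"
      then obtain f where D: "D = ?g f" and f: "f \<in> row_tables {..<m} {..<n} (($) R)"
        and col: "col_sums {..<m} {..<n} f = (\<lambda>j\<in>{..<n}. C $ j)"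
        by (auto simp: margin_tables_def)
      have "(\<Sum>i<m. f i j) = C $ j" if "j < n" for j
        using fun_cong[OF col, of j] that by (simp add: col_sums_def)
      then show "D \<in> contingency_tables R C"
        using row_tables_sum[OF f] by (auto simp: contingency_tables_def dims D)
    qed
  qed
  then show ?thesis unfolding num_tables_def by (rule bij_betw_same_card)
qed

lemma table_fun_eq_cube_fun:
  assumes "R \<in> carrier_vec m" "C \<in> carrier_vec n"
  shows "table_fun R C x y = cube_fun {..<m} {..<n} (($) R) (\<lambda>j\<in>{..<n}. C $ j) (($) x) (($) y)"
  using assms by (auto simp: table_fun_def cube_fun_def power_int_minus divide_inverse intro!: arg_cong2[of _ _ _ _ "(*)"] prod.cong)

theorem theorem1p1:
  "\<exists>\<gamma>::real. \<gamma> > 0 \<and>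
     (\<forall>(m::nat) (n::nat) (N::nat) (R::nat vec) (C::nat vec).
        m > 1 \<longrightarrow> n > 1 \<longrightarrow>
        R \<in> carrier_vec m \<longrightarrow> C \<in> carrier_vec n \<longrightarrow>
        (\<forall>i<m. R $ i > 0) \<longrightarrow> (\<forall>j<n. C $ j > 0) \<longrightarrow>
        (\<Sum>i<m. R $ i) = N \<longrightarrow> (\<Sum>j<n. C $ j) = N \<longrightarrow>
        (\<exists>x\<in>open_cube m. \<exists>y\<in>open_cube n.
           table_fun R C x y = rho R C \<and>
           (\<forall>x'\<in>open_cube m. \<forall>y'\<in>open_cube n. table_fun R C x y \<le> table_fun R C x' y')) \<and>
        rho R C \<ge> real (num_tables R C) \<and>
        real (num_tables R C) \<ge> real N powr (- \<gamma> * real (m + n)) * rho R C)"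
proof (rule exI[of _ 5], intro conjI allI impI)
  \<comment> \<open>The losses are at most \<open>N ^ 4\<close> per row, \<open>N ^ 4\<close> per
    column and one further factor \<open>N\<close>, and
    \<open>4 * (m + n) + 1 \<le> 5 * (m + n)\<close>.\<close>
  show "(0::real) < 5" by simp
  fix m n N :: nat and R C :: "nat vec"
  assume mn: "m > 1" "n > 1" and RC: "R \<in> carrier_vec m" "C \<in> carrier_vec n"
    and Rpos: "\<forall>i<m. R $ i > 0" and Cpos: "\<forall>j<n. C $ j > 0"
    and RN: "(\<Sum>i<m. R $ i) = N" and CN: "(\<Sum>j<n. C $ j) = N"
  define I J where "I = {..<m}" and "J = {..<n}"
  define r c where "r = ($) R" and "c = (\<lambda>j\<in>J. C $ j)"
  have fin: "finite I" "finite J" and ne: "I \<noteq> {}" "J \<noteq> {}"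
    using mn by (auto simp: I_def J_def lessThan_empty_iff)
  have rN: "sum r I = N" using RN by (simp add: r_def I_def)
  have cN: "sum c J = N" using CN by (simp add: c_def J_def)
  have sums: "sum r I = sum c J" using rN cN by simp
  have c: "c \<in> comps J (sum r I)" unfolding rN using cN fin by (intro comps_memI) (auto simp: c_def)
  have rpos: "r i > 0" if "i \<in> I" for i using that Rpos by (simp add: r_def I_def)
  have cpos: "c j > 0" if "j \<in> J" for j using that Cpos by (simp add: c_def J_def)
  have tf: "table_fun R C x y = cube_fun I J r c (($) x) (($) y)" for x y
    unfolding I_def J_def r_def c_def by (rule table_fun_eq_cube_fun[OF RC])
  have tf_vec: "table_fun R C (vec m x) (vec n y) = cube_fun I J r c x y" for x y
    unfolding tf by (rule cube_fun_cong) (auto simp: I_def J_def)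
  have nt: "num_tables R C = card (margin_tables I J r c)"
    unfolding I_def J_def r_def c_def by (rule num_tables_eq_card_margin_tables[OF RC])
  have cubeI: "vec m x \<in> open_cube m" if "\<And>i. i \<in> I \<Longrightarrow> 0 < x i \<and> x i < 1" for x
    using that by (auto simp: open_cube_def I_def)
  have cubeJ: "vec n y \<in> open_cube n" if "\<And>j. j \<in> J \<Longrightarrow> 0 < y j \<and> y j < 1" for y
    using that by (auto simp: open_cube_def J_def)
  have inI: "0 < (x :: real vec) $ i \<and> x $ i < 1" if "x \<in> open_cube m" "i \<in> I" for x i
    using that by (auto simp: open_cube_def I_def)
  have inJ: "0 < (y :: real vec) $ j \<and> y $ j < 1" if "y \<in> open_cube n" "j \<in> J" for y j
    using that by (auto simp: open_cube_def J_def)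
  obtain x0 y0 where xy0: "\<And>i. i \<in> I \<Longrightarrow> 0 < x0 i \<and> x0 i < 1" "\<And>j. j \<in> J \<Longrightarrow> 0 < y0 j \<and> y0 j < 1"
    and min: "\<And>x' y'. (\<And>i. i \<in> I \<Longrightarrow> 0 < x' i \<and> x' i < 1) \<Longrightarrow> (\<And>j. j \<in> J \<Longrightarrow> 0 < y' j \<and> y' j < 1) \<Longrightarrow>
      cube_fun I J r c x0 y0 \<le> cube_fun I J r c x' y'"
    using cube_fun_minimizer[OF fin ne sums rpos cpos] by blast
  have min': "table_fun R C (vec m x0) (vec n y0) \<le> table_fun R C x' y'"
    if "x' \<in> open_cube m" "y' \<in> open_cube n" for x' y'
    unfolding tf_vec tf[of x'] using inI[OF that(1)] inJ[OF that(2)] by (rule min)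
  have rho: "rho R C = table_fun R C (vec m x0) (vec n y0)"
    unfolding rho_def using RC cubeI[OF xy0(1)] cubeJ[OF xy0(2)] min'
    by (intro cInf_eq_minimum) (auto intro!: image_eqI[of _ _ "(vec m x0, vec n y0)"])
  then show "\<exists>x\<in>open_cube m. \<exists>y\<in>open_cube n. table_fun R C x y = rho R C \<and>
      (\<forall>x'\<in>open_cube m. \<forall>y'\<in>open_cube n. table_fun R C x y \<le> table_fun R C x' y')"
    using cubeI[OF xy0(1)] cubeJ[OF xy0(2)] min'
    by (intro bexI[of _ "vec m x0"] bexI[of _ "vec n y0"]) auto
  show "rho R C \<ge> real (num_tables R C)"
    unfolding rho tf_vec nt using xy0 by (intro cube_fun_ge_card[OF fin c])
  have "real N \<ge> 2"
  proof -
    \<comment> \<open>Every row sum is at least 1 and there are at least two rows. From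
      \<open>N \<ge> 2\<close> on, numerical constants can be absorbed into powers of
      \<open>N\<close>.\<close>
    have "card I \<le> sum r I" using sum_mono[of I "\<lambda>_. 1" r] rpos by (simp add: Suc_le_eq)
    then show ?thesis using mn rN by (simp add: I_def)
  qed
  define T where "T = real (card (margin_tables I J r c))"
  obtain x y where xy: "\<And>i. i \<in> I \<Longrightarrow> 0 < x i \<and> x i < 1" "\<And>j. j \<in> J \<Longrightarrow> 0 < y j \<and> y j < 1"
    "cube_fun I J r c x y \<le> (\<Prod>i\<in>I. 3 * (real (r i) + 2)) * (2 * (real N + 1) ^ (2 * card J) * T)"
    using exists_cube_fun_le[OF fin ne c cpos] unfolding rN T_def by blast
  have "rho R C \<le> (\<Prod>i\<in>I. 3 * (real (r i) + 2)) * (2 * (real N + 1) ^ (2 * card J) * T)"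
    unfolding rho tf_vec by (rule order_trans[OF min xy(3)]) (rule xy(1,2); assumption)+
  also have "\<dots> \<le> (real N ^ 4) ^ m * (real N * (real N ^ 4) ^ n * T)"
  proof (intro mult_mono)
    \<comment> \<open>Each row factor is at most \<open>8 * N \<le> N ^ 4\<close>.\<close>
    have "(\<Prod>i\<in>I. 3 * (real (r i) + 2)) \<le> (\<Prod>i\<in>I. real N ^ 4)"
    proof (intro prod_mono conjI)
      fix i assume "i \<in> I"
      then have "r i \<le> N" unfolding rN[symmetric] using fin by (intro member_le_sum) auto
      then have "3 * (real (r i) + 2) \<le> 2 ^ 3 * real N" using \<open>real N \<ge> 2\<close> by simp
      also have "\<dots> \<le> real N ^ 3 * real N" using \<open>real N \<ge> 2\<close> by (intro mult_right_mono power_mono) auto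
      finally show "3 * (real (r i) + 2) \<le> real N ^ 4" by (simp add: power_numeral_reduce)
    qed auto
    then show "(\<Prod>i\<in>I. 3 * (real (r i) + 2)) \<le> (real N ^ 4) ^ m" by (simp add: I_def)
    have "real N + 1 \<le> 2 * real N" using \<open>real N \<ge> 2\<close> by simp
    also have "\<dots> \<le> real N * real N" using \<open>real N \<ge> 2\<close> by (intro mult_right_mono) auto
    finally have "(real N + 1) ^ (2 * card J) \<le> (real N * real N) ^ (2 * card J)" by (intro power_mono) auto
    also have "\<dots> = (real N ^ 4) ^ n"
      unfolding power_mult by (rule arg_cong2[of _ _ _ _ power]) (simp_all add: J_def power_numeral_reduce)
    finally show "(real N + 1) ^ (2 * card J) \<le> (real N ^ 4) ^ n" .
  qed (use \<open>real N \<ge> 2\<close> in \<open>auto simp: T_def intro!: mult_nonneg_nonneg\<close>)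
  also have "\<dots> = real N ^ (4 * (m + n) + 1) * T" by (simp add: power_add distrib_left power_mult)
  also have "\<dots> \<le> real N ^ (5 * (m + n)) * T"
    using \<open>real N \<ge> 2\<close> mn by (intro mult_right_mono power_increasing) (auto simp: T_def)
  finally have le: "rho R C \<le> real N ^ (5 * (m + n)) * T" .
  have pos: "real N ^ (5 * (m + n)) > 0" using \<open>real N \<ge> 2\<close> by simp
  have "real N powr (- 5 * real (m + n)) = 1 / real N powr real (5 * (m + n))"
    by (simp flip: powr_minus_divide)
  also have "real N powr real (5 * (m + n)) = real N ^ (5 * (m + n))"
    using \<open>real N \<ge> 2\<close> by (intro powr_realpow) simp
  finally show "real (num_tables R C) \<ge> real N powr (- 5 * real (m + n)) * rho R C"
    using le pos unfolding nt T_def[symmetric] by (simp add: divide_le_eq mult.commute)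
qed

end
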